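(* Let $\rho$ be a random time on $(\Omega,\mathcal{F},(\mathcal{F}_t)_{t\ge 0},\mathbb{P})$ with $\mathbb{P}[\rho=\infty]=0$. The following four properties are equivalent: (1) $\rho$ is an $(\mathcal{F}_t)$ pseudo-stopping time, i.e. $\mathbb{E}[M_\rho]=\mathbb{E}[M_0]$ for every $(\mathcal{F}_t)$-martingale $M$ in $\mathcal{H}^1$; (2) $\mu_t^\rho\equiv 1$ a.s.; (3) $A_\infty^\rho\equiv 1$ a.s.; (4) for every $(\mathcal{F}_t)$-local martingale $(M_t)$, the stopped process $(M_{t\wedge\rho})_{t\ge 0}$ is an $(\mathcal{F}_t^\rho)$-local martingale. If, furthermore, all $(\mathcal{F}_t)$-martingales are continuous, then each of the preceding properties is equivalent to (5) $(Z_t^\rho)_{t\ge 0}$ is a decreasing (i.e. nonincreasing) $(\mathcal{F}_t)$-predictable process.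
   Context: $(\Omega,\mathcal{F},(\mathcal{F}_t)_{t\ge0},\mathbb{P})$ is a filtered probability space satisfying the usual conditions; martingales are taken càdlàg; $\mathcal{F}_\infty=\sigma(\bigcup_t\mathcal{F}_t)$. A random time is an $\mathcal{F}$-measurable nonnegative random variable $\rho$ (not necessarily a stopping time, not necessarily $\mathcal{F}_\infty$-measurable). $\mathcal{H}^1$ is the space of càdlàg $(\mathcal{F}_t)$-martingales $M$ with $\mathbb{E}[\sup_{t\ge 0}|M_t|]<\infty$. $(\mathcal{F}_t^\rho)$ is the progressive enlargement of $(\mathcal{F}_t)$ by $\rho$: the smallest filtration (satisfying the usual conditions) containing $(\mathcal{F}_t)$ and making $\rho$ a stopping time. $Z_t^\rho=\mathbb{P}[\rho>t\mid\mathcal{F}_t]$ is the càdlàg Azéma supermartingale of $\rho$. $A^\rho$ is the $(\mathcal{F}_t)$-dual optional projection of $1_{\{\rho\le t\}}$, i.e. the càdlàg increasing $(\mathcal{F}_t)$-adapted process (with $A^\rho_{0-}=0$, so a jump at $0$ is allowed) such that $\mathbb{E}[X_\rho]=\mathbb{E}[\int_{[0,\infty)}X_s\,dA_s^\rho]$ for every bounded $(\mathcal{F}_t)$-optional process $X$. $\mu_t^\rho=\mathbb{E}[A_\infty^\rho\mid\mathcal{F}_t]=A_t^\rho+Z_t^\rho$ (càdlàg version). *)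

theory Defs
  imports "HOL-Probability.Probability"
begin

text \<open>
  Filtrations are indexed by \<open>[0,\<infinity>]\<close>, that is by \<^typ>\<open>ennreal\<close>, so that a \<open>[0,\<infinity>]\<close>-valued random time
  has the type expected by \<^const>\<open>stopping_time\<close>; the index \<open>\<infinity>\<close> carries \<open>\<sigma>(\<Union>t<\<infinity>. F t)\<close>.
  Processes are functions \<open>X :: real \<Rightarrow> 'a \<Rightarrow> real\<close> of which only the restriction to times \<open>t \<ge> 0\<close>
  is ever used.
\<close>

definition usual_conditions :: "'a measure \<Rightarrow> (ennreal \<Rightarrow> 'a measure) \<Rightarrow> bool" where
  "usual_conditions M F \<longleftrightarrow>
     complete_measure M \<and>
     filtration (space M) F \<and>
     (\<forall>t. subalgebra M (F t)) \<and>
     null_sets M \<subseteq> sets (F 0) \<and>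
     (\<forall>t<\<infinity>. sets (F t) = (\<Inter>u\<in>{t<..}. sets (F u))) \<and>
     sets (F \<infinity>) = sigma_sets (space M) (\<Union>t\<in>{..<\<infinity>}. sets (F t))"

definition adapted :: "(ennreal \<Rightarrow> 'a measure) \<Rightarrow> (real \<Rightarrow> 'a \<Rightarrow> real) \<Rightarrow> bool" where
  "adapted F X \<longleftrightarrow> (\<forall>t\<ge>0. X t \<in> borel_measurable (F (ennreal t)))"

definition cadlag :: "'a measure \<Rightarrow> (real \<Rightarrow> 'a \<Rightarrow> real) \<Rightarrow> bool" where
  "cadlag M X \<longleftrightarrow> (\<forall>\<omega>\<in>space M.
     (\<forall>t\<ge>0. continuous (at_right t) (\<lambda>s. X s \<omega>)) \<and>
     (\<forall>t>0. \<exists>l. ((\<lambda>s. X s \<omega>) \<longlongrightarrow> l) (at_left t)))"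

definition left_continuous :: "'a measure \<Rightarrow> (real \<Rightarrow> 'a \<Rightarrow> real) \<Rightarrow> bool" where
  "left_continuous M X \<longleftrightarrow> (\<forall>\<omega>\<in>space M. \<forall>t>0. continuous (at_left t) (\<lambda>s. X s \<omega>))"

definition process_sigma :: "'a measure \<Rightarrow> (real \<Rightarrow> 'a \<Rightarrow> real) set \<Rightarrow> (real \<times> 'a) measure" where
  "process_sigma M \<X> = sigma ({0..} \<times> space M)
     {{(t, \<omega>) \<in> {0..} \<times> space M. X t \<omega> \<in> B} | X B. X \<in> \<X> \<and> B \<in> sets borel}"

definition optional_process ::
    "'a measure \<Rightarrow> (ennreal \<Rightarrow> 'a measure) \<Rightarrow> (real \<Rightarrow> 'a \<Rightarrow> real) \<Rightarrow> bool" where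
  "optional_process M F X \<longleftrightarrow>
     (\<lambda>(t, \<omega>). X t \<omega>) \<in> borel_measurable (process_sigma M {Y. adapted F Y \<and> cadlag M Y})"

definition predictable_process ::
    "'a measure \<Rightarrow> (ennreal \<Rightarrow> 'a measure) \<Rightarrow> (real \<Rightarrow> 'a \<Rightarrow> real) \<Rightarrow> bool" where
  "predictable_process M F X \<longleftrightarrow>
     (\<lambda>(t, \<omega>). X t \<omega>) \<in> borel_measurable (process_sigma M {Y. adapted F Y \<and> left_continuous M Y})"

definition martingale ::
    "'a measure \<Rightarrow> (ennreal \<Rightarrow> 'a measure) \<Rightarrow> (real \<Rightarrow> 'a \<Rightarrow> real) \<Rightarrow> bool" where
  "martingale M F X \<longleftrightarrow>
     adapted F X \<and> cadlag M X \<and> (\<forall>t\<ge>0. integrable M (X t)) \<and>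
     (\<forall>s\<ge>0. \<forall>t\<ge>s. AE \<omega> in M. real_cond_exp M (F (ennreal s)) (X t) \<omega> = X s \<omega>)"

definition H1_martingale ::
    "'a measure \<Rightarrow> (ennreal \<Rightarrow> 'a measure) \<Rightarrow> (real \<Rightarrow> 'a \<Rightarrow> real) \<Rightarrow> bool" where
  "H1_martingale M F X \<longleftrightarrow>
     martingale M F X \<and> (\<integral>\<^sup>+\<omega>. (SUP t\<in>{0..}. ennreal \<bar>X t \<omega>\<bar>) \<partial>M) < \<infinity>"

text \<open>\<open>X\<^sub>T\<close>; where \<open>T = \<infinity>\<close> it takes the irrelevant value \<open>X\<^sub>0\<close>, and it is only
  used for almost surely finite \<open>T\<close>.\<close>

definition value_at :: "(real \<Rightarrow> 'a \<Rightarrow> real) \<Rightarrow> ('a \<Rightarrow> ennreal) \<Rightarrow> 'a \<Rightarrow> real" where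
  "value_at X T \<omega> = X (enn2real (T \<omega>)) \<omega>"

definition stopped :: "(real \<Rightarrow> 'a \<Rightarrow> real) \<Rightarrow> ('a \<Rightarrow> ennreal) \<Rightarrow> real \<Rightarrow> 'a \<Rightarrow> real" where
  "stopped X T t \<omega> = X (enn2real (min (ennreal t) (T \<omega>))) \<omega>"

text \<open>Subtracting \<open>X\<^sub>0\<close> before localizing means that \<open>X\<^sub>0\<close> need not be integrable.\<close>

definition local_martingale ::
    "'a measure \<Rightarrow> (ennreal \<Rightarrow> 'a measure) \<Rightarrow> (real \<Rightarrow> 'a \<Rightarrow> real) \<Rightarrow> bool" where
  "local_martingale M F X \<longleftrightarrow>
     adapted F X \<and> cadlag M X \<and>
     (\<exists>\<tau> :: nat \<Rightarrow> 'a \<Rightarrow> ennreal.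
        (\<forall>n. stopping_time F (\<tau> n)) \<and>
        (AE \<omega> in M. incseq (\<lambda>n. \<tau> n \<omega>) \<and> (\<lambda>n. \<tau> n \<omega>) \<longlonglongrightarrow> \<infinity>) \<and>
        (\<forall>n. martingale M F (\<lambda>t \<omega>. stopped X (\<tau> n) t \<omega> - X 0 \<omega>)))"

definition enlargement ::
    "'a measure \<Rightarrow> (ennreal \<Rightarrow> 'a measure) \<Rightarrow> ('a \<Rightarrow> ennreal) \<Rightarrow> (ennreal \<Rightarrow> 'a measure) \<Rightarrow> bool" where
  "enlargement M F \<rho> H \<longleftrightarrow>
     usual_conditions M H \<and> (\<forall>t. sets (F t) \<subseteq> sets (H t)) \<and> stopping_time H \<rho>"

definition progressive_enlargement ::
    "'a measure \<Rightarrow> (ennreal \<Rightarrow> 'a measure) \<Rightarrow> ('a \<Rightarrow> ennreal) \<Rightarrow> (ennreal \<Rightarrow> 'a measure) \<Rightarrow> bool" where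
  "progressive_enlargement M F \<rho> G \<longleftrightarrow>
     enlargement M F \<rho> G \<and> (\<forall>H. enlargement M F \<rho> H \<longrightarrow> (\<forall>t. sets (G t) \<subseteq> sets (H t)))"

text \<open>\<open>X\<close> is a cadlag adapted version of \<open>t \<mapsto> E[V\<^sub>t | F\<^sub>t]\<close>.\<close>

definition cadlag_projection ::
    "'a measure \<Rightarrow> (ennreal \<Rightarrow> 'a measure) \<Rightarrow> (real \<Rightarrow> 'a \<Rightarrow> real) \<Rightarrow> (real \<Rightarrow> 'a \<Rightarrow> real) \<Rightarrow> bool" where
  "cadlag_projection M F V X \<longleftrightarrow>
     adapted F X \<and> cadlag M X \<and>
     (\<forall>t\<ge>0. AE \<omega> in M. X t \<omega> = real_cond_exp M (F (ennreal t)) (V t) \<omega>)"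

definition azema_supermartingale ::
    "'a measure \<Rightarrow> (ennreal \<Rightarrow> 'a measure) \<Rightarrow> ('a \<Rightarrow> ennreal) \<Rightarrow> (real \<Rightarrow> 'a \<Rightarrow> real) \<Rightarrow> bool" where
  "azema_supermartingale M F \<rho> Z \<longleftrightarrow>
     cadlag_projection M F (\<lambda>t. indicator {\<omega>\<in>space M. ennreal t < \<rho> \<omega>}) Z"

text \<open>\<open>\<integral>\<^bsub>[0,\<infinity>)\<^esub> X\<^sub>s dA\<^sub>s\<close>: extending \<open>A\<close> by \<open>0\<close> to negative times implements \<open>A\<^bsub>0-\<^esub> = 0\<close>, so that
  \<open>dA\<close> has an atom of mass \<open>A\<^sub>0\<close> at time \<open>0\<close>.\<close>

definition stieltjes_integral ::
    "(real \<Rightarrow> 'a \<Rightarrow> real) \<Rightarrow> (real \<Rightarrow> 'a \<Rightarrow> real) \<Rightarrow> 'a \<Rightarrow> real" where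
  "stieltjes_integral X A \<omega> =
     (LINT s:{0..}|interval_measure (\<lambda>t. if t < 0 then 0 else A t \<omega>). X s \<omega>)"

definition dual_optional_projection ::
    "'a measure \<Rightarrow> (ennreal \<Rightarrow> 'a measure) \<Rightarrow> ('a \<Rightarrow> ennreal) \<Rightarrow> (real \<Rightarrow> 'a \<Rightarrow> real) \<Rightarrow> bool" where
  "dual_optional_projection M F \<rho> A \<longleftrightarrow>
     adapted F A \<and> cadlag M A \<and>
     (\<forall>\<omega>\<in>space M. 0 \<le> A 0 \<omega> \<and> mono_on {0..} (\<lambda>t. A t \<omega>)) \<and>
     (\<forall>X. optional_process M F X \<and> (\<exists>c. \<forall>t\<ge>0. \<forall>\<omega>\<in>space M. \<bar>X t \<omega>\<bar> \<le> c) \<longrightarrow>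
        (\<integral>\<omega>. value_at X \<rho> \<omega> \<partial>M) = (\<integral>\<omega>. stieltjes_integral X A \<omega> \<partial>M))"

text \<open>The limit \<open>A\<^sub>\<infinity>\<close> of an increasing process, taken in \<open>[0,\<infinity>]\<close>, where it always exists.\<close>

definition terminal_value :: "(real \<Rightarrow> 'a \<Rightarrow> real) \<Rightarrow> 'a \<Rightarrow> ennreal" where
  "terminal_value A \<omega> = Lim at_top (\<lambda>t. ennreal (A t \<omega>))"

definition mu_martingale ::
    "'a measure \<Rightarrow> (ennreal \<Rightarrow> 'a measure) \<Rightarrow> (real \<Rightarrow> 'a \<Rightarrow> real) \<Rightarrow> (real \<Rightarrow> 'a \<Rightarrow> real) \<Rightarrow> bool" where
  "mu_martingale M F A \<mu> \<longleftrightarrow>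
     cadlag_projection M F (\<lambda>_ \<omega>. enn2real (terminal_value A \<omega>)) \<mu>"

definition pseudo_stopping_time ::
    "'a measure \<Rightarrow> (ennreal \<Rightarrow> 'a measure) \<Rightarrow> ('a \<Rightarrow> ennreal) \<Rightarrow> bool" where
  "pseudo_stopping_time M F \<rho> \<longleftrightarrow>
     (\<forall>X. H1_martingale M F X \<longrightarrow> (\<integral>\<omega>. value_at X \<rho> \<omega> \<partial>M) = (\<integral>\<omega>. X 0 \<omega> \<partial>M))"

text \<open>Continuity can only be required almost surely: under the usual conditions a
  cadlag martingale may be changed arbitrarily (to cadlag paths) on a null set.\<close>

definition all_martingales_continuous :: "'a measure \<Rightarrow> (ennreal \<Rightarrow> 'a measure) \<Rightarrow> bool" where
  "all_martingales_continuous M F \<longleftrightarrow>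
     (\<forall>X. martingale M F X \<longrightarrow> (AE \<omega> in M. continuous_on {0..} (\<lambda>t. X t \<omega>)))"

definition decreasing_process :: "'a measure \<Rightarrow> (real \<Rightarrow> 'a \<Rightarrow> real) \<Rightarrow> bool" where
  "decreasing_process M X \<longleftrightarrow> (AE \<omega> in M. antimono_on {0..} (\<lambda>t. X t \<omega>))"

end

theory Submission
  imports Defs
begin

text \<open>
  A Stieltjes integral against \<open>dA\<close> is a limit of Riemann sums with right end points. In the summand
  \<open>X\<^bsub>t(k+1)\<^esub> (A\<^bsub>t(k+1)\<^esub> - A\<^bsub>t(k)\<^esub>)\<close> the value of a martingale \<open>X\<close> may be replaced by \<open>X\<^sub>t\<close>, so that
  \<open>E[X\<^sub>\<rho> 1\<^bsub>\<rho> \<le> t\<^esub>] = E[A\<^sub>t X\<^sub>t]\<close> whenever \<open>A\<^sub>t X\<^sub>t\<close> is integrable.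

  The martingale \<open>\<mu> = A + Z\<close> is dominated by \<open>1 + A\<^sub>\<infinity>\<close>, and \<open>A\<^sub>\<infinity>\<close> is square integrable. For a
  pseudo-stopping time, \<open>1 = E[\<mu>\<^sub>0] = E[\<mu>\<^sub>\<rho>] = E[A\<^sub>\<infinity>\<^sup>2]\<close>; since \<open>E[A\<^sub>\<infinity>] = 1\<close>, \<open>A\<^sub>\<infinity> = 1\<close>.
  Conversely, if \<open>A\<^sub>\<infinity> = 1\<close> then \<open>Z = 1 - A\<close>, and
  \<open>E[X\<^bsub>t\<and>\<rho>\<^esub>] = E[A\<^sub>t X\<^sub>t] + E[Z\<^sub>t X\<^sub>t] = E[X\<^sub>0]\<close> for every martingale \<open>X\<close>. Applied to
  \<open>1\<^sub>C (X\<^bsub>s\<or>t\<^esub> - X\<^sub>s)\<close> with \<open>C \<in> F\<^sub>s\<close>, this is the martingale property of the stopped process in the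
  enlarged filtration, because there every event agrees with one of \<open>F\<^sub>s\<close> on \<open>{s < \<rho>}\<close>. Any localizing
  sequence of \<open>X\<close> localizes the stopped process as well, and no optional stopping theorem is needed.

  If \<open>Z\<close> decreases, then \<open>\<mu> = A + Z\<close> is a continuous martingale of finite variation, hence constant.
  If all martingales are continuous, then for a stopping time \<open>T\<close> the continuous martingale
  \<open>L\<^sub>t = E[e\<^bsup>-T\<^esup> | F\<^sub>t]\<close> satisfies \<open>T \<le> t \<longleftrightarrow> e\<^bsup>-t\<^esup> \<le> L\<^sub>t\<close>, so \<open>[T,\<infinity>)\<close> is predictable; the level sets of a
  decreasing right-continuous process are of this form.
\<close>

section \<open>Dyadic times and right-continuous paths\<close>

text \<open>The formula that defines \<open>A\<close> is an identity of Bochner integrals for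
  bounded integrands, and a non-integrable function has Bochner integral 0. Hence integrability of
  \<open>A t\<close>, square integrability of A_\<infinity> and the formula for an unbounded
  martingale all have to be extracted by truncation. What truncation cuts off is controlled by
  convexity: \<open>excess K\<close> of a martingale is a submartingale, so in mean its Riemann sums
  are at most its value at the horizon weighted by \<open>A t\<close>.

  The second moment of A_\<infinity> decides (2) as well as (1): E[A_t \<mu>_t] =
  E[A_t A_\<infinity>] tends to E[A_\<infinity>^2], and a variable with mean 1 and second moment 1
  is constant.

  For (5), continuity is assumed of cadlag martingales only. While Z and \<mu> are given with cadlag
  paths, E[e^-T | F_t] is not, so a cadlag version has to be constructed before the hypothesis can
  be applied. That version takes values in [0,1], so squares of increments suffice to count its
  oscillations.\<close>

lemma right_continuous_compose_seq:
  fixes f :: "real \<Rightarrow> 'b::topological_space"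
  assumes "continuous (at_right t) f" "\<And>n. t \<le> r n" "r \<longlonglongrightarrow> t"
  shows "(\<lambda>n. f (r n)) \<longlonglongrightarrow> f t"
proof -
  have "continuous (at t within {t..}) f"
    using assms(1) by (simp add: continuous_within at_within_Ici_at_right)
  then show ?thesis
    by (rule continuous_within_tendsto_compose) (use assms in auto)
qed

text \<open>Floor plus one, rather than the ceiling, puts the dyadic time strictly to the right of
  \<open>t\<close> even when \<open>t\<close> is itself dyadic. Right limits along these times
  therefore never see the value at \<open>t\<close>.\<close>

definition dyadic_above :: "nat \<Rightarrow> real \<Rightarrow> real" where
  "dyadic_above n t = real (nat \<lfloor>2 ^ n * t\<rfloor> + 1) / 2 ^ n"

lemma countable_dyadics: "countable dyadics"
  unfolding dyadics_def by simp

lemma dyadics_nonneg: "q \<in> dyadics ==> 0 \<le> (q :: real)"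
  by (auto simp: dyadics_def)

lemma dyadics_I: "real k / 2 ^ n \<in> dyadics"
  unfolding dyadics_def by auto

lemma dyadic_above_in: "dyadic_above n t \<in> dyadics"
  unfolding dyadic_above_def by (rule dyadics_I)

lemma dyadic_above_gt: "0 \<le> t ==> t < dyadic_above n t"
  unfolding dyadic_above_def by (simp add: field_simps) linarith

lemma dyadic_above_le: "0 \<le> t ==> dyadic_above n t \<le> t + (1/2) ^ n"
proof -
  assume "0 \<le> t"
  then have "real (nat \<lfloor>2 ^ n * t\<rfloor>) \<le> 2 ^ n * t" by simp
  then show ?thesis unfolding dyadic_above_def by (simp add: field_simps)
qed

lemma dyadic_above_tendsto:
  assumes "0 \<le> t" shows "(\<lambda>n. dyadic_above n t) \<longlonglongrightarrow> t"
proof (rule tendsto_sandwich)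
  show "\<forall>\<^sub>F n in sequentially. t \<le> dyadic_above n t"
    using less_imp_le[OF dyadic_above_gt[OF assms]] by (intro always_eventually allI)
  show "\<forall>\<^sub>F n in sequentially. dyadic_above n t \<le> t + (1/2) ^ n"
    using dyadic_above_le[OF assms] by auto
  have "(\<lambda>n. t + (1/2::real) ^ n) \<longlonglongrightarrow> t + 0"
    by (intro tendsto_intros LIMSEQ_power_zero) auto
  then show "(\<lambda>n. t + (1/2::real) ^ n) \<longlonglongrightarrow> t" by simp
qed auto

lemma right_continuous_dyadic_seq:
  assumes "0 \<le> t" "continuous (at_right t) f"
  shows "(\<lambda>n. f (dyadic_above n t)) \<longlonglongrightarrow> f t"
  using assms(2) less_imp_le[OF dyadic_above_gt[OF assms(1)]] dyadic_above_tendsto[OF assms(1)]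
  by (rule right_continuous_compose_seq)

lemma le_of_le_on_dyadics:
  fixes f g :: "real \<Rightarrow> real"
  assumes "0 \<le> t" "continuous (at_right t) f" "continuous (at_right t) g"
    and "\<And>q. q \<in> dyadics ==> f q \<le> g q"
  shows "f t \<le> g t"
  by (rule LIMSEQ_le[OF right_continuous_dyadic_seq[OF assms(1,2)] right_continuous_dyadic_seq[OF assms(1,3)]])
     (use assms(4) dyadic_above_in in auto)

lemma cadlag_rightD: "cadlag M X ==> w \<in> space M ==> 0 \<le> t ==> continuous (at_right t) (\<lambda>s. X s w)"
  by (auto simp: cadlag_def)

text \<open>Only countably many null sets are united, one for each dyadic time; right continuity
  carries the inequality to all other times.\<close>

lemma AE_all_le:
  assumes "cadlag M X" "cadlag M Y"
    and "\<And>t. 0 \<le> t ==> AE w in M. X t w \<le> (Y t w :: real)"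
  shows "AE w in M. \<forall>t\<ge>0. X t w \<le> Y t w"
proof -
  have "AE w in M. \<forall>q\<in>dyadics. X q w \<le> Y q w"
    using assms(3) dyadics_nonneg by (subst AE_ball_countable) (auto simp: countable_dyadics)
  then show ?thesis
    using AE_space
  proof eventually_elim
    case (elim w)
    show ?case
    proof (intro allI impI)
      fix t :: real assume t: "0 \<le> t"
      show "X t w \<le> Y t w"
        by (rule le_of_le_on_dyadics[where f = "\<lambda>s. X s w" and g = "\<lambda>s. Y s w", OF t
              cadlag_rightD[OF assms(1) elim(2) t] cadlag_rightD[OF assms(2) elim(2) t]])
           (use elim(1) in blast)
    qed
  qed
qed

lemma AE_all_eq:
  assumes "cadlag M X" "cadlag M Y"
    and "\<And>t. 0 \<le> t ==> AE w in M. X t w = (Y t w :: real)"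
  shows "AE w in M. \<forall>t\<ge>0. X t w = Y t w"
proof -
  have 1: "AE w in M. X t w \<le> Y t w" if "0 \<le> t" for t
    using assms(3)[OF that] by eventually_elim simp
  have 2: "AE w in M. Y t w \<le> X t w" if "0 \<le> t" for t
    using assms(3)[OF that] by eventually_elim simp
  have "AE w in M. \<forall>t\<ge>0. X t w \<le> Y t w" using assms(1,2) 1 by (rule AE_all_le)
  moreover have "AE w in M. \<forall>t\<ge>0. Y t w \<le> X t w" using assms(2,1) 2 by (rule AE_all_le)
  ultimately show ?thesis by eventually_elim (auto intro: antisym)
qed

lemma cadlag_const: "cadlag M (\<lambda>t. f)"
  unfolding cadlag_def by (intro ballI conjI allI impI; (rule continuous_const | rule exI, rule tendsto_const))

lemma cadlag_cong:
  assumes X: "cadlag M X" and eq: "\<And>t w. 0 \<le> t ==> X t w = Y t w"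
  shows "cadlag M Y"
  unfolding cadlag_def
proof (intro ballI conjI allI impI)
  fix w and t :: real assume w: "w \<in> space M"
  { assume t: "0 \<le> t"
    have "\<forall>\<^sub>F s in at_right t. X s w = Y s w"
      unfolding eventually_at_filter using t by (intro always_eventually) (auto intro: eq)
    moreover have "((\<lambda>s. X s w) \<longlongrightarrow> Y t w) (at_right t)"
      using cadlag_rightD[OF X w t] eq[OF t] by (simp add: continuous_within)
    ultimately show "continuous (at_right t) (\<lambda>s. Y s w)"
      unfolding continuous_within by (rule Lim_transform_eventually[rotated]) }
  assume t: "0 < t"
  have "\<forall>\<^sub>F s in at_left t. X s w = Y s w"
    using eventually_at_left_real[OF t] by eventually_elim (auto intro: eq)
  moreover obtain l where "((\<lambda>s. X s w) \<longlongrightarrow> l) (at_left t)"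
    using X w t unfolding cadlag_def by blast
  ultimately show "\<exists>l. ((\<lambda>s. Y s w) \<longlongrightarrow> l) (at_left t)" by (blast intro: Lim_transform_eventually)
qed

lemma cadlag_combine:
  assumes "cadlag M X" "cadlag M Y" "continuous_on UNIV (\<lambda>p::real\<times>real. h (fst p) (snd p))"
  shows "cadlag M (\<lambda>t w. h (X t w) (Y t w) :: real)"
proof -
  have c: "isCont (\<lambda>p::real\<times>real. h (fst p) (snd p)) p" for p
    using assms(3) by (meson UNIV_I continuous_on_eq_continuous_at open_UNIV)
  have *: "((\<lambda>s. h (x s) (y s)) \<longlongrightarrow> h a b) F" if "(x \<longlongrightarrow> a) F" "(y \<longlongrightarrow> b) F" for x y a b and F :: "real filter"
    using isCont_tendsto_compose[OF c tendsto_Pair[OF that]] by simp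
  show ?thesis
    unfolding cadlag_def
  proof (intro ballI conjI allI impI)
    fix w and t :: real assume w: "w \<in> space M"
    { assume "0 \<le> t"
      then show "continuous (at_right t) (\<lambda>s. h (X s w) (Y s w))"
        using cadlag_rightD[OF assms(1) w] cadlag_rightD[OF assms(2) w]
        unfolding continuous_within by (intro *) auto }
    assume "0 < t"
    then obtain a b where "((\<lambda>s. X s w) \<longlongrightarrow> a) (at_left t)" "((\<lambda>s. Y s w) \<longlongrightarrow> b) (at_left t)"
      using assms(1,2) w unfolding cadlag_def by blast
    from *[OF this] show "\<exists>l. ((\<lambda>s. h (X s w) (Y s w)) \<longlongrightarrow> l) (at_left t)" by blast
  qed
qed

lemma cadlag_fun:
  assumes "cadlag M X" "continuous_on UNIV (h :: real \<Rightarrow> real)"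
  shows "cadlag M (\<lambda>t w. h (X t w))"
proof -
  have "continuous_on UNIV (\<lambda>p::real\<times>real. h (fst p))"
    by (rule continuous_on_compose2[OF assms(2) continuous_on_fst[OF continuous_on_id]]) simp
  then show ?thesis
    using cadlag_combine[where h = "\<lambda>a b. h a", OF assms(1,1)] by simp
qed

lemma cadlag_add:
  assumes "cadlag M X" "cadlag M Y" shows "cadlag M (\<lambda>t w. X t w + Y t w)"
  using assms by (rule cadlag_combine[where h = "(+)"])
    (rule continuous_on_add[OF continuous_on_fst[OF continuous_on_id] continuous_on_snd[OF continuous_on_id]])

lemma cadlag_diff:
  assumes "cadlag M X" "cadlag M Y" shows "cadlag M (\<lambda>t w. X t w - Y t w)"
  using assms by (rule cadlag_combine[where h = "(-)"])
    (rule continuous_on_diff[OF continuous_on_fst[OF continuous_on_id] continuous_on_snd[OF continuous_on_id]])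

lemma cadlag_mult:
  assumes "cadlag M X" "cadlag M Y" shows "cadlag M (\<lambda>t w. X t w * Y t w)"
  using assms by (rule cadlag_combine[where h = "(*)"])
    (rule continuous_on_mult[OF continuous_on_fst[OF continuous_on_id] continuous_on_snd[OF continuous_on_id]])

text \<open>Each dyadic approximation of \<open>T\<close> takes countably many values, so it selects
  among countably many measurable variables; right continuity gives the limit.\<close>

lemma measurable_right_continuous_at:
  fixes X :: "real \<Rightarrow> 'a \<Rightarrow> real"
  assumes X: "\<And>t. 0 \<le> t ==> X t \<in> borel_measurable N"
    and rc: "\<And>w t. w \<in> space N ==> 0 \<le> t ==> continuous (at_right t) (\<lambda>s. X s w)"
    and T: "T \<in> borel_measurable N" "\<And>w. w \<in> space N ==> 0 \<le> T w"
  shows "(\<lambda>w. X (T w) w) \<in> borel_measurable N"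
proof (rule borel_measurable_LIMSEQ_real)
  fix n
  note [measurable] = T(1)
  show "(\<lambda>w. X (dyadic_above n (T w)) w) \<in> borel_measurable N"
    unfolding dyadic_above_def
    by (rule measurable_compose_countable[where g = "\<lambda>w. nat \<lfloor>2 ^ n * T w\<rfloor>"]) (rule X, simp, measurable)
qed (rule right_continuous_dyadic_seq, auto intro: T rc)

section \<open>Riemann sums for Stieltjes integrals\<close>

text \<open>The term \<open>y 0 * b 0\<close> is the atom at time 0 that comes from b(0-) = 0. Right
  end points are chosen because right continuity of \<open>y\<close> then gives convergence, and
  because for adapted processes the increment of \<open>b\<close> is known at the time at which
  \<open>y\<close> is evaluated.\<close>

definition riemann_sum :: "(real \<Rightarrow> real) \<Rightarrow> (real \<Rightarrow> real) \<Rightarrow> real \<Rightarrow> nat \<Rightarrow> real" where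
  "riemann_sum y b t n = y 0 * b 0 +
     (\<Sum>k<Suc n. y (t * real (Suc k) / real (Suc n)) *
        (b (t * real (Suc k) / real (Suc n)) - b (t * real k / real (Suc n))))"

definition grid_above :: "real \<Rightarrow> nat \<Rightarrow> real \<Rightarrow> real" where
  "grid_above t n s = t * of_int \<lceil>s * real (Suc n) / t\<rceil> / real (Suc n)"

lemma grid_above_ge: "0 < t ==> s \<le> grid_above t n s"
proof -
  assume t: "0 < t"
  have "s * real (Suc n) / t \<le> of_int \<lceil>s * real (Suc n) / t\<rceil>" by simp
  then have "s * real (Suc n) \<le> t * of_int \<lceil>s * real (Suc n) / t\<rceil>"
    using t by (metis mult.commute pos_divide_le_eq)
  then show ?thesis unfolding grid_above_def by (simp add: pos_le_divide_eq del: of_nat_Suc)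
qed

lemma grid_above_le: "0 < t ==> grid_above t n s \<le> s + t / real (Suc n)"
proof -
  assume t: "0 < t"
  have "of_int \<lceil>s * real (Suc n) / t\<rceil> \<le> s * real (Suc n) / t + 1" by linarith
  then have "t * of_int \<lceil>s * real (Suc n) / t\<rceil> \<le> t * (s * real (Suc n) / t + 1)"
    using t by (intro mult_left_mono) auto
  also have "\<dots> = s * real (Suc n) + t" using t by (simp add: distrib_left del: of_nat_Suc)
  finally show ?thesis
    unfolding grid_above_def by (simp add: pos_divide_le_eq distrib_right del: of_nat_Suc)
qed

lemma grid_above_tendsto:
  assumes "0 < t" shows "(\<lambda>n. grid_above t n s) \<longlonglongrightarrow> s"
proof (rule tendsto_sandwich)
  show "\<forall>\<^sub>F n in sequentially. s \<le> grid_above t n s"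
    using grid_above_ge[OF assms] by (intro always_eventually allI)
  show "\<forall>\<^sub>F n in sequentially. grid_above t n s \<le> s + t / real (Suc n)"
    using grid_above_le[OF assms] by (intro always_eventually allI)
  have "(\<lambda>n. s + t / real (Suc n)) \<longlonglongrightarrow> s + 0"
    by (intro tendsto_add tendsto_const LIMSEQ_Suc[OF lim_const_over_n])
  then show "(\<lambda>n. s + t / real (Suc n)) \<longlonglongrightarrow> s" by simp
qed auto

text \<open>The ceiling of s (n+1) / t is the number of the half-open interval that contains s, so
  at most one term of the sum survives. The point 0 lies in none of these intervals and carries the
  initial term.\<close>

lemma step_function_eq:
  fixes y :: "real \<Rightarrow> real"
  assumes t: "0 < t"
  shows "y 0 * indicator {0} s + (\<Sum>k<Suc n. y (t * real (Suc k) / real (Suc n)) *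
           indicator {t * real k / real (Suc n)<..t * real (Suc k) / real (Suc n)} s)
         = y (grid_above t n s) * indicator {0..t} s"
proof -
  define m where "m = real (Suc n)"
  have m: "0 < m" by (simp add: m_def)
  define c where "c = \<lceil>s * m / t\<rceil>"
  have iff: "s \<in> {t * real k / m<..t * real (Suc k) / m} \<longleftrightarrow> c = int (Suc k)" for k
  proof -
    have "s \<in> {t * real k / m<..t * real (Suc k) / m} \<longleftrightarrow> real k < s * m / t \<and> s * m / t \<le> real (Suc k)"
      using t m by (auto simp: field_simps)
    also have "\<dots> \<longleftrightarrow> c = int (Suc k)"
      unfolding c_def ceiling_eq_iff by simp
    finally show ?thesis .
  qed
  have ind: "indicator {t * real k / m<..t * real (Suc k) / m} s = (if c = int (Suc k) then 1 else 0 :: real)" for k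
    unfolding indicator_def iff by simp
  have "(\<Sum>k<Suc n. y (t * real (Suc k) / m) * indicator {t * real k / m<..t * real (Suc k) / m} s)
      = (\<Sum>k<Suc n. if k = nat c - 1 \<and> 0 < c then y (t * of_int c / m) else 0)"
    unfolding ind by (intro sum.cong refl) auto
  also have "\<dots> = (if 0 < c \<and> c \<le> int (Suc n) then y (t * of_int c / m) else 0)"
    by (cases "0 < c") (auto simp: sum.delta nat_less_iff)
  also have "0 < c \<and> c \<le> int (Suc n) \<longleftrightarrow> 0 < s \<and> s \<le> t"
  proof -
    have "0 < c \<longleftrightarrow> 0 < s" unfolding c_def using t m by (simp add: zero_less_mult_iff zero_less_divide_iff)
    moreover have "s * m / t \<le> m \<longleftrightarrow> s \<le> t"
      using t m by (simp add: pos_divide_le_eq mult.commute[of s m])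
    then have "c \<le> int (Suc n) \<longleftrightarrow> s \<le> t"
      unfolding c_def ceiling_le_iff by (simp add: m_def)
    ultimately show ?thesis by simp
  qed
  finally have "(\<Sum>k<Suc n. y (t * real (Suc k) / m) * indicator {t * real k / m<..t * real (Suc k) / m} s)
      = (if 0 < s \<and> s \<le> t then y (grid_above t n s) else 0)"
    by (simp add: grid_above_def c_def m_def)
  moreover have "s = 0 ==> grid_above t n s = 0" by (simp add: grid_above_def)
  ultimately show ?thesis using t
    by (auto simp: indicator_def m_def)
qed

section \<open>The Stieltjes measure of an increasing function\<close>

locale increasing_function =
  fixes b :: "real \<Rightarrow> real"
  assumes nonneg0: "0 \<le> b 0" and mono_b: "mono_on {0..} b"
    and rc_b: "\<And>t. 0 \<le> t ==> continuous (at_right t) b"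
begin

definition ext :: "real \<Rightarrow> real" where "ext t = (if t < 0 then 0 else b t)"

abbreviation "\<nu> \<equiv> interval_measure ext"

lemma b_mono: "0 \<le> s ==> s \<le> t ==> b s \<le> b t"
  using mono_b by (auto simp: mono_on_def)

lemma b_nonneg: "0 \<le> t ==> 0 \<le> b t"
  using b_mono[of 0 t] nonneg0 by simp

lemma ext_mono: "x \<le> y ==> ext x \<le> ext y"
  using b_mono[of x y] b_nonneg[of y] by (auto simp: ext_def)

lemma ext_rc: "continuous (at_right a) ext"
proof (cases "a < 0")
  case True
  have "\<forall>\<^sub>F x in at_right a. ext x = ext a"
    using eventually_at_right_real[OF True] by eventually_elim (use True in \<open>auto simp: ext_def\<close>)
  then show ?thesis unfolding continuous_within by (rule tendsto_eventually)
next
  case False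
  have "\<forall>\<^sub>F x in at_right a. b x = ext x"
    unfolding eventually_at_filter using False by (intro always_eventually) (auto simp: ext_def)
  moreover have "(b \<longlongrightarrow> ext a) (at_right a)"
    using rc_b[of a] False by (simp add: continuous_within ext_def)
  ultimately show ?thesis unfolding continuous_within by (rule Lim_transform_eventually[rotated])
qed

lemma emeasure_Ioc: "x \<le> y ==> emeasure \<nu> {x<..y} = ennreal (ext y - ext x)"
  by (rule emeasure_interval_measure_Ioc[OF _ ext_mono ext_rc])

text \<open>The intervals (-1/(n+1), 0] shrink to the point 0, and each has mass \<open>b 0\<close>
  because \<open>ext\<close> vanishes on negative times.\<close>

lemma emeasure_0: "emeasure \<nu> {0} = ennreal (b 0)"
proof -
  have "(\<lambda>n. emeasure \<nu> {- 1 / real (Suc n)<..0}) \<longlonglongrightarrow> emeasure \<nu> (\<Inter>n. {- 1 / real (Suc n)<..0})"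
  proof (rule Lim_emeasure_decseq)
    show "decseq (\<lambda>n. {- 1 / real (Suc n)<..0::real})"
      by (rule decseq_SucI) (auto simp: field_simps intro: less_le_trans)
    show "emeasure \<nu> {- 1 / real (Suc i)<..0} \<noteq> \<infinity>" for i by (subst emeasure_Ioc) auto
  qed auto
  also have "(\<Inter>n. {- 1 / real (Suc n)<..0::real}) = {0}"
  proof (intro equalityI subsetI)
    fix x :: real assume x: "x \<in> (\<Inter>n. {- 1 / real (Suc n)<..0})"
    show "x \<in> {0}"
    proof (rule ccontr)
      assume "x \<notin> {0}"
      with x have "0 < - x" by auto
      then obtain n where "1 / real (Suc n) < - x" using nat_approx_posE by blast
      with x show False by (auto dest!: spec[of _ n])
    qed
  qed auto
  also have "(\<lambda>n. emeasure \<nu> {- 1 / real (Suc n)<..0}) = (\<lambda>n. ennreal (b 0))"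
    by (intro ext, subst emeasure_Ioc) (auto simp: ext_def)
  finally show ?thesis using LIMSEQ_unique tendsto_const by blast
qed

lemma measure_Icc: "0 \<le> t ==> measure \<nu> {0..t} = b t" "0 \<le> t ==> emeasure \<nu> {0..t} = ennreal (b t)"
proof -
  assume t: "0 \<le> t"
  have "emeasure \<nu> {0..t} = emeasure \<nu> ({0} \<union> {0<..t})"
    using t by (intro arg_cong[where f = "emeasure \<nu>"]) auto
  also have "\<dots> = emeasure \<nu> {0} + emeasure \<nu> {0<..t}"
    by (subst plus_emeasure) auto
  also have "\<dots> = ennreal (b t)"
    using t b_mono[of 0 t] nonneg0 by (simp add: emeasure_0 emeasure_Ioc ext_def flip: ennreal_plus)
  finally show "emeasure \<nu> {0..t} = ennreal (b t)" .
  then show "measure \<nu> {0..t} = b t" using b_nonneg[OF t] by (simp add: measure_def)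
qed

lemma measure_Ioc: "0 \<le> u ==> u \<le> t ==> measure \<nu> {u<..t} = b t - b u"
  using b_mono[of u t] by (simp add: measure_def emeasure_Ioc ext_def)

lemma integral_step:
  assumes t: "0 < t"
  shows "integrable \<nu> (\<lambda>s. y (grid_above t n s) * indicator {0..t} s)"
    and "(\<integral>s. y (grid_above t n s) * indicator {0..t} s \<partial>\<nu>) = riemann_sum y b t n"
proof -
  have i0: "integrable \<nu> (\<lambda>s. y 0 * indicator {0} s)"
    by (intro integrable_mult_right integrable_real_indicator) (auto simp: emeasure_0)
  have m0: "measure \<nu> {0} = b 0"
    by (simp add: measure_def emeasure_0 nonneg0)
  have pts: "0 \<le> t * real k / real (Suc n)" "t * real k / real (Suc n) \<le> t * real (Suc k) / real (Suc n)" for k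
    using t by (auto simp: divide_right_mono mult_left_mono)
  have ik: "integrable \<nu> (\<lambda>s. y (t * real (Suc k) / real (Suc n)) *
           indicator {t * real k / real (Suc n)<..t * real (Suc k) / real (Suc n)} s)" for k
    by (intro integrable_mult_right integrable_real_indicator) (auto simp: emeasure_Ioc[OF pts(2)] simp del: of_nat_Suc)
  show "integrable \<nu> (\<lambda>s. y (grid_above t n s) * indicator {0..t} s)"
    unfolding step_function_eq[OF t, symmetric]
    by (intro Bochner_Integration.integrable_add Bochner_Integration.integrable_sum i0 ik)
  show "(\<integral>s. y (grid_above t n s) * indicator {0..t} s \<partial>\<nu>) = riemann_sum y b t n"
    unfolding step_function_eq[OF t, symmetric]
    by (simp only: Bochner_Integration.integral_add[OF i0 Bochner_Integration.integrable_sum[OF ik]]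
          Bochner_Integration.integral_sum[OF ik] riemann_sum_def integral_mult_right_zero Bochner_Integration.integral_indicator
          space_interval_measure Int_UNIV_right measure_Ioc[OF pts] m0)
qed

lemma riemann_sum_tendsto:
  assumes t: "0 < t" and rc: "\<And>s. 0 \<le> s ==> continuous (at_right s) y"
    and bd: "\<And>s. 0 \<le> s ==> \<bar>y s\<bar> \<le> c"
  shows "(\<lambda>n. riemann_sum y b t n) \<longlonglongrightarrow> (\<integral>s. y s * indicator {0..t} s \<partial>\<nu>)"
proof -
  have lim: "(\<lambda>n. y (grid_above t n s) * indicator {0..t} s) \<longlonglongrightarrow> y s * indicator {0..t} s" for s
  proof (cases "s \<in> {0..t}")
    case True
    then show ?thesis
      using right_continuous_compose_seq[OF rc grid_above_ge[OF t] grid_above_tendsto[OF t], of s] by simp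
  qed simp
  have meas: "(\<lambda>s. y (grid_above t n s) * indicator {0..t} s) \<in> borel_measurable \<nu>" for n
    using integral_step(1)[OF t] by (rule borel_measurable_integrable)
  have "(\<lambda>n. \<integral>s. y (grid_above t n s) * indicator {0..t} s \<partial>\<nu>) \<longlonglongrightarrow> (\<integral>s. y s * indicator {0..t} s \<partial>\<nu>)"
  proof (rule integral_dominated_convergence[where w = "\<lambda>s. c * indicator {0..t} s"])
    \<comment> \<open>\<open>y\<close> restricted to [0,t] inherits measurability as a pointwise
      limit of step functions.\<close>
    show "(\<lambda>s. y s * indicator {0..t} s) \<in> borel_measurable \<nu>"
      using lim meas by (rule borel_measurable_LIMSEQ_real)
    show "integrable \<nu> (\<lambda>s. c * indicator {0..t} s)"
      using t by (intro integrable_mult_right integrable_real_indicator) (auto simp: measure_Icc)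
    have "norm (y (grid_above t n s) * indicator {0..t} s) \<le> c * indicator {0..t} s" for n s
      using bd[of "grid_above t n s"] grid_above_ge[OF t, of s n] by (auto simp: indicator_def)
    then show "AE s in \<nu>. norm (y (grid_above t n s) * indicator {0..t} s) \<le> c * indicator {0..t} s" for n
      by simp
  qed (use lim meas in auto)
  then show ?thesis by (simp add: integral_step(2)[OF t])
qed

end

section \<open>Filtrations and optional processes\<close>

lemma measurable_process_sigma:
  assumes "X \<in> \<X>"
  shows "(\<lambda>(t, w). X t w) \<in> borel_measurable (process_sigma M \<X>)"
proof (rule measurableI)
  let ?G = "{{(t, w) \<in> {0..} \<times> space M. X t w \<in> B} | X B. X \<in> \<X> \<and> B \<in> sets borel}"
  have G: "?G \<subseteq> Pow ({0..} \<times> space M)" by blast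
  fix B :: "real set" assume B: "B \<in> sets borel"
  have "(\<lambda>(t, w). X t w) -` B \<inter> space (process_sigma M \<X>) = {(t, w) \<in> {0..} \<times> space M. X t w \<in> B}"
    unfolding process_sigma_def space_measure_of[OF G] by auto
  also have "\<dots> \<in> ?G" using assms B by blast
  then have "{(t, w) \<in> {0..} \<times> space M. X t w \<in> B} \<in> sets (process_sigma M \<X>)"
    unfolding process_sigma_def sets_measure_of[OF G] by (rule sigma_sets.Basic)
  finally show "(\<lambda>(t, w). X t w) -` B \<inter> space (process_sigma M \<X>) \<in> sets (process_sigma M \<X>)" .
qed simp

lemma space_process_sigma: "space (process_sigma M \<X>) = {0..} \<times> space M"
  unfolding process_sigma_def by (rule space_measure_of) blast

text \<open>Supplies the elementary cadlag processes, such as the indicator of [v,\<infinity>) x C,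
  out of which optional test processes are made.\<close>

lemma cadlag_switch:
  "cadlag M (\<lambda>t w. if t < v then f w else (g w :: real))"
  unfolding cadlag_def
proof (intro ballI conjI allI impI)
  fix w and t :: real
  have "\<forall>\<^sub>F s in at_right t. (if s < v then f w else g w) = (if t < v then f w else g w)"
  proof (cases "t < v")
    case True
    show ?thesis using eventually_at_right_real[OF True] by eventually_elim (use True in auto)
  next
    case False
    show ?thesis unfolding eventually_at_filter using False by (intro always_eventually) auto
  qed
  then show "continuous (at_right t) (\<lambda>s. if s < v then f w else g w)"
    unfolding continuous_within by (rule tendsto_eventually)
  have "\<forall>\<^sub>F s in at_left t. (if s < v then f w else g w) = (if t \<le> v then f w else g w)"
  proof (cases "t \<le> v")
    case True
    show ?thesis unfolding eventually_at_filter using True by (intro always_eventually) auto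
  next
    case False
    then have "v < t" by simp
    show ?thesis using eventually_at_left_real[OF \<open>v < t\<close>] by eventually_elim (use False in auto)
  qed
  then show "\<exists>l. ((\<lambda>s. if s < v then f w else g w) \<longlongrightarrow> l) (at_left t)"
    by (intro exI tendsto_eventually)
qed

locale usual_filtration = prob_space M for M :: "'a measure" +
  fixes F :: "ennreal \<Rightarrow> 'a measure"
  assumes usual: "usual_conditions M F"
begin

abbreviation "E \<equiv> lebesgue_integral M"

lemma complete: "complete_measure M"
  using usual by (simp add: usual_conditions_def)

lemma subset_null: "A \<subseteq> N ==> N \<in> null_sets M ==> A \<in> null_sets M"
  by (rule complete_measure.complete2[OF complete])

lemma AE_null: "AE w in M. P w ==> {w\<in>space M. \<not> P w} \<in> null_sets M"
  by (elim AE_E3 subset_null[rotated]) blast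

lemma subalg: "subalgebra M (F t)"
  using usual by (simp add: usual_conditions_def)

lemma space_F: "space (F t) = space M"
  using subalg by (auto simp: subalgebra_def)

lemma sets_F_subset: "sets (F t) \<subseteq> sets M"
  using subalg by (auto simp: subalgebra_def)

lemma sets_F_mono: "s \<le> t ==> sets (F s) \<subseteq> sets (F t)"
proof -
  have "filtration (space M) F"
    using usual unfolding usual_conditions_def by (elim conjE)
  then show "s \<le> t ==> sets (F s) \<subseteq> sets (F t)" by (rule filtration.sets_F_mono)
qed

lemma null_in_F: "N \<in> null_sets M ==> N \<in> sets (F t)"
proof -
  have "null_sets M \<subseteq> sets (F 0)"
    using usual unfolding usual_conditions_def by (elim conjE)
  then show "N \<in> null_sets M ==> N \<in> sets (F t)"
    using sets_F_mono[OF zero_le, of t] by (meson subsetD)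
qed

lemma right_cont_F:
  assumes "t < \<infinity>" "\<And>u. t < u ==> A \<in> sets (F u)"
  shows "A \<in> sets (F t)"
proof -
  have "\<forall>t<\<infinity>. sets (F t) = (\<Inter>u\<in>{t<..}. sets (F u))"
    using usual unfolding usual_conditions_def by (elim conjE)
  then have "sets (F t) = (\<Inter>u\<in>{t<..}. sets (F u))" using assms(1) by simp
  then show ?thesis using assms(2) by simp
qed

lemma cond_exp_F: "sigma_finite_subalgebra M (F t)"
proof -
  interpret finite_measure_subalgebra M "F t" by unfold_locales (rule subalg)
  show ?thesis by unfold_locales
qed

lemma meas_F_mono: "f \<in> borel_measurable (F s) ==> s \<le> t ==> f \<in> borel_measurable (F t)"
  using sets_F_mono[of s t] space_F by (auto simp: measurable_def)

lemma meas_F_M: "f \<in> borel_measurable (F s) ==> f \<in> borel_measurable M"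
  by (rule measurable_from_subalg[OF subalg])

lemma adaptedD: "adapted F X ==> 0 \<le> s ==> s \<le> t ==> X s \<in> borel_measurable (F (ennreal t))"
  unfolding adapted_def using meas_F_mono[of "X s" "ennreal s" "ennreal t"] by (simp add: ennreal_leI)

lemma adaptedM: "adapted F X ==> 0 \<le> s ==> X s \<in> borel_measurable M"
  using adaptedD[of X s s] meas_F_M by auto

text \<open>Integrability is asked of the product \<open>y * f\<close> and not of a bounded
  \<open>y\<close>, so that \<open>A t\<close> and the increments of \<open>A\<close> are admissible
  weights.\<close>

lemma cond_exp_test:
  assumes f: "f \<in> borel_measurable M" and y: "y \<in> borel_measurable (F t)" and i: "integrable M (\<lambda>w. y w * f w)"
    and X: "AE w in M. X w = real_cond_exp M (F t) f w" "X \<in> borel_measurable M"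
  shows "integrable M (\<lambda>w. y w * X w)" "E(\<lambda>w. y w * X w) = E(\<lambda>w. y w * f w)"
proof -
  interpret S: sigma_finite_subalgebra M "F t" by (rule cond_exp_F)
  note [measurable] = X(2) meas_F_M[OF y] f
  have e: "AE w in M. y w * real_cond_exp M (F t) f w = y w * X w"
    using X(1) by eventually_elim simp
  show "integrable M (\<lambda>w. y w * X w)"
    by (rule integrable_cong_AE_imp[OF S.real_cond_exp_intg(1)[OF i y f] _ e]) measurable
  show "E(\<lambda>w. y w * X w) = E(\<lambda>w. y w * f w)"
    unfolding S.real_cond_exp_intg(2)[OF i y f, symmetric]
    by (rule integral_cong_AE[symmetric, OF _ _ e]) measurable
qed

lemma cond_exp_eqI:
  assumes f: "integrable M f" and X: "integrable M X" "X \<in> borel_measurable (F t)"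
    and e: "\<And>C. C \<in> sets (F t) ==> E(\<lambda>w. indicator C w * f w) = E(\<lambda>w. indicator C w * X w)"
  shows "AE w in M. real_cond_exp M (F t) f w = X w"
proof -
  interpret S: sigma_finite_subalgebra M "F t" by (rule cond_exp_F)
  show ?thesis
    by (rule S.real_cond_exp_charact) (use assms in \<open>auto simp: set_lebesgue_integral_def\<close>)
qed

lemma martingale_test:
  assumes X: "martingale M F X" and st: "0 \<le> s" "s \<le> t"
    and y: "y \<in> borel_measurable (F (ennreal s))" and i: "integrable M (\<lambda>w. y w * X t w)"
  shows "integrable M (\<lambda>w. y w * X s w)" "E(\<lambda>w. y w * X s w) = E(\<lambda>w. y w * X t w)"
proof -
  have m: "X t \<in> borel_measurable M" "X s \<in> borel_measurable M"
    using X st adaptedM[of X] by (auto simp: martingale_def)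
  have "AE w in M. real_cond_exp M (F (ennreal s)) (X t) w = X s w"
    using X st by (auto simp: martingale_def)
  then have "AE w in M. X s w = real_cond_exp M (F (ennreal s)) (X t) w"
    by eventually_elim simp
  from cond_exp_test[OF m(1) y i this m(2)]
  show "integrable M (\<lambda>w. y w * X s w)" "E(\<lambda>w. y w * X s w) = E(\<lambda>w. y w * X t w)" .
qed

lemma martingale_expectation:
  assumes "martingale M F X" "0 \<le> s" "s \<le> t"
  shows "E(\<lambda>w. X s w) = E(\<lambda>w. X t w)"
  using martingale_test(2)[OF assms, of "\<lambda>_. 1"] assms by (simp add: martingale_def)

lemma martingaleI:
  assumes "adapted F X" "cadlag M X" "\<And>t. 0 \<le> t ==> integrable M (X t)"
    and e: "\<And>s t C. 0 \<le> s ==> s \<le> t ==> C \<in> sets (F (ennreal s)) ==>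
       E(\<lambda>w. indicator C w * X t w) = E(\<lambda>w. indicator C w * X s w)"
  shows "martingale M F X"
  unfolding martingale_def
proof (intro conjI allI impI)
  fix s t :: real assume st: "0 \<le> s" "s \<le> t"
  have t: "0 \<le> t" using st by simp
  show "AE w in M. real_cond_exp M (F (ennreal s)) (X t) w = X s w"
    by (rule cond_exp_eqI[OF assms(3)[OF t] assms(3)[OF st(1)] adaptedD[OF assms(1) st(1) order_refl] e[OF st]])
qed fact+

lemma optional_cadlag: "adapted F X ==> cadlag M X ==> optional_process M F X"
  unfolding optional_process_def by (rule measurable_process_sigma) simp

lemma optional_mult:
  assumes "optional_process M F X" "optional_process M F Y"
  shows "optional_process M F (\<lambda>t w. X t w * Y t w)"
  using borel_measurable_times[OF assms[unfolded optional_process_def]]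
  unfolding optional_process_def by (simp add: split_beta')

lemma optional_limit:
  assumes "\<And>n. optional_process M F (X n)"
    and "\<And>t w. 0 \<le> t ==> w \<in> space M ==> (\<lambda>n. X n t w) \<longlonglongrightarrow> Y t w"
  shows "optional_process M F Y"
  unfolding optional_process_def
  by (rule borel_measurable_LIMSEQ_real[where u = "\<lambda>n (t, w). X n t w"])
     (use assms in \<open>auto simp: optional_process_def space_process_sigma\<close>)

lemma adapted_switch:
  assumes "0 \<le> u" "u \<le> v" "C \<in> sets (F (ennreal u))"
  shows "adapted F (\<lambda>t w. if t < v then 0 else indicator C w)"
  unfolding adapted_def
proof (intro allI impI)
  fix t :: real assume "0 \<le> t"
  have "C \<in> sets (F (ennreal t))" if "v \<le> t"
    using sets_F_mono[of "ennreal u" "ennreal t"] assms that by (auto simp: ennreal_leI)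
  then show "(\<lambda>w. if t < v then 0 else indicator C w) \<in> borel_measurable (F (ennreal t))"
    by (cases "t < v") auto
qed

text \<open>The indicator of (u,\<infinity>) is not right-continuous at \<open>u\<close>; it is the
  limit of cadlag processes that switch on at u + 1/(n+1).\<close>

lemma optional_after:
  assumes "0 \<le> u" "C \<in> sets (F (ennreal u))"
  shows "optional_process M F (\<lambda>t w. indicator {u<..} t * indicator C w)"
proof (rule optional_limit)
  show "optional_process M F (\<lambda>t w. if t < u + 1 / real (Suc n) then 0 else indicator C w)" for n
    using assms by (intro optional_cadlag adapted_switch[of u] cadlag_switch) auto
  fix t w
  have "(\<lambda>n. u + 1 / real (Suc n)) \<longlonglongrightarrow> u + 0"
    by (intro tendsto_add tendsto_const LIMSEQ_Suc[OF lim_const_over_n])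
  then have *: "(\<lambda>n. u + 1 / real (Suc n)) \<longlonglongrightarrow> u" by simp
  have "\<forall>\<^sub>F n in sequentially. (if t < u + 1 / real (Suc n) then 0 else indicator C w) = indicator {u<..} t * (indicator C w :: real)"
  proof (cases "u < t")
    case True
    from order_tendstoD(2)[OF * True] show ?thesis by eventually_elim (use True in auto)
  next
    case False
    have "t < u + 1 / real (Suc n)" for n
    proof -
      have "0 < 1 / real (Suc n)" by simp
      with False show ?thesis by linarith
    qed
    then show ?thesis using False by auto
  qed
  then show "(\<lambda>n. if t < u + 1 / real (Suc n) then 0 else indicator C w) \<longlonglongrightarrow> indicator {u<..} t * (indicator C w :: real)"
    by (rule tendsto_eventually)
qed

lemma optional_until:
  assumes "0 \<le> v"
  shows "optional_process M F (\<lambda>t w. indicator {..v} t)"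
proof -
  let ?S = "process_sigma M {Y. adapted F Y \<and> cadlag M Y}"
  have "space M \<in> sets (F (ennreal v))" using sets.top[of "F (ennreal v)"] by (simp add: space_F)
  from optional_after[OF assms this]
  have "(\<lambda>(t, w). indicator {v<..} t * indicator (space M) w :: real) \<in> borel_measurable ?S"
    by (simp add: optional_process_def)
  from borel_measurable_diff[OF borel_measurable_const[of "1::real"] this]
  have "(\<lambda>p. 1 - (case p of (t, w) \<Rightarrow> (indicator {v<..} t * indicator (space M) w :: real))) \<in> borel_measurable ?S" .
  then show ?thesis
    unfolding optional_process_def
    by (rule measurable_cong[THEN iffD1, rotated]) (auto simp: space_process_sigma indicator_def)
qed

end

section \<open>The dual optional projection\<close>

lemma Fatou_integrable:
  fixes f :: "nat \<Rightarrow> 'a \<Rightarrow> real"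
  assumes i: "\<And>n. integrable M (f n)" and nn: "\<And>n. AE x in M. 0 \<le> f n x" and g: "g \<in> borel_measurable M"
    and lim: "AE x in M. (\<lambda>n. f n x) \<longlonglongrightarrow> g x" and c: "\<And>n. (\<integral>x. f n x \<partial>M) \<le> c"
  shows "integrable M g" "(\<integral>x. g x \<partial>M) \<le> c"
proof -
  have nnall: "AE x in M. \<forall>n. 0 \<le> f n x" using nn by (simp add: AE_all_countable)
  have g0: "AE x in M. 0 \<le> g x"
    using nnall lim by eventually_elim (rule LIMSEQ_le_const, auto)
  have [measurable]: "f n \<in> borel_measurable M" for n using i by auto
  have "(\<integral>\<^sup>+x. ennreal (g x) \<partial>M) = (\<integral>\<^sup>+x. liminf (\<lambda>n. ennreal (f n x)) \<partial>M)"
  proof (rule nn_integral_cong_AE)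
    show "AE x in M. ennreal (g x) = liminf (\<lambda>n. ennreal (f n x))"
      using lim
    proof eventually_elim
      case (elim x)
      then have "(\<lambda>n. ennreal (f n x)) \<longlonglongrightarrow> ennreal (g x)" by (intro tendsto_ennrealI)
      then show ?case by (intro lim_imp_Liminf[symmetric]) auto
    qed
  qed
  also have "\<dots> \<le> liminf (\<lambda>n. \<integral>\<^sup>+x. ennreal (f n x) \<partial>M)"
    by (intro nn_integral_liminf) measurable
  also have "\<dots> = liminf (\<lambda>n. ennreal (\<integral>x. f n x \<partial>M))"
    using i nn by (simp add: nn_integral_eq_integral)
  also have "\<dots> \<le> ennreal c"
    by (rule order_trans[OF Liminf_le_Limsup Limsup_bounded]) (auto intro!: always_eventually ennreal_leI c)
  finally have le: "(\<integral>\<^sup>+x. ennreal (g x) \<partial>M) \<le> ennreal c" .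
  show "integrable M g"
    using g g0 le by (intro integrableI_nonneg) (auto intro: le_less_trans)
  then have "ennreal (\<integral>x. g x \<partial>M) \<le> ennreal c" using g0 le by (simp add: nn_integral_eq_integral)
  \<comment> \<open>\<open>ennreal\<close> sends every negative number to 0, so the inequality
    descends to the reals only once \<open>c\<close> is known to be nonnegative.\<close>
  moreover have "0 \<le> (\<integral>x. f 0 x \<partial>M)" using nn by (rule integral_nonneg_AE)
  then have "0 \<le> c" using c[of 0] by linarith
  ultimately show "(\<integral>x. g x \<partial>M) \<le> c" by simp
qed

section \<open>Elementary inequalities for Riemann sums on uniform grids\<close>

definition grid :: "real \<Rightarrow> nat \<Rightarrow> nat \<Rightarrow> real" where "grid t n k = t * real k / real (Suc n)"

lemma grid_0 [simp]: "grid t n 0 = 0" and grid_last [simp]: "grid t n (Suc n) = t"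
  by (auto simp: grid_def)

lemma grid_mono: "0 \<le> t ==> j \<le> k ==> grid t n j \<le> grid t n k"
  by (auto simp: grid_def divide_right_mono mult_left_mono)

lemma grid_nonneg: "0 \<le> t ==> 0 \<le> grid t n k"
  by (auto simp: grid_def)

lemma grid_le: "0 \<le> t ==> k \<le> Suc n ==> grid t n k \<le> t"
  using grid_mono[of t k "Suc n" n] by simp

lemma riemann_sum_grid:
  "riemann_sum y b t n = y 0 * b 0 + (\<Sum>k<Suc n. y (grid t n (Suc k)) * (b (grid t n (Suc k)) - b (grid t n k)))"
  by (simp only: riemann_sum_def grid_def)

lemma sum_increments: "(b 0 :: real) + (\<Sum>k<Suc n. b (grid t n (Suc k)) - b (grid t n k)) = b t"
  using sum_lessThan_telescope[of "\<lambda>k. b (grid t n k)" "Suc n"] by simp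

lemma riemann_sum_mono:
  assumes "0 \<le> t" "mono_on {0..} b" "0 \<le> b 0" "\<And>s. 0 \<le> s ==> s \<le> t ==> y s \<le> z s"
  shows "riemann_sum y b t n \<le> riemann_sum z b t n"
  unfolding riemann_sum_grid
proof (intro add_mono mult_right_mono sum_mono)
  fix k assume "k \<in> {..<Suc n}"
  then show "y (grid t n (Suc k)) \<le> z (grid t n (Suc k))"
    using assms(1) grid_nonneg[OF assms(1)] grid_le[OF assms(1), of "Suc k" n] by (intro assms(4)) auto
  show "0 \<le> b (grid t n (Suc k)) - b (grid t n k)"
    using assms(1,2) grid_nonneg[OF assms(1)] grid_mono[OF assms(1), of k "Suc k"] by (auto simp: mono_on_def)
qed (use assms in auto)

lemma riemann_sum_const: "riemann_sum (\<lambda>_. c) b t n = c * b t"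
proof -
  have "riemann_sum (\<lambda>_. c) b t n = c * (b 0 + (\<Sum>k<Suc n. b (grid t n (Suc k)) - b (grid t n k)))"
    unfolding riemann_sum_grid by (simp only: sum_distrib_left distrib_left)
  then show ?thesis by (simp only: sum_increments)
qed

lemma riemann_sum_cong:
  assumes "0 \<le> t" "\<And>s. 0 \<le> s ==> s \<le> t ==> y s = z s"
  shows "riemann_sum y b t n = riemann_sum z b t n"
  unfolding riemann_sum_grid
  by (intro arg_cong2[where f = "(+)"] arg_cong2[where f = "(*)"] sum.cong refl assms(2))
     (use assms(1) grid_nonneg[OF assms(1)] grid_le[OF assms(1), of "Suc _" n] in \<open>auto simp del: sum.lessThan_Suc\<close>)

text \<open>With right end points the increment that carries \<open>b\<close> across the level
  \<open>m\<close> is already left out, so the increments collected never add up to more than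
  \<open>m\<close>.\<close>

lemma riemann_sum_below_level:
  assumes t: "0 \<le> t" and b: "mono_on {0..} b" "0 \<le> b 0" and m: "0 \<le> m"
  shows "riemann_sum (\<lambda>s. if b s < m then 1 else 0) b t n \<le> m"
proof -
  have mono: "b (grid t n k) \<le> b (grid t n (Suc k))" for k
    using t b grid_nonneg[OF t] grid_mono[OF t, of k "Suc k"] by (auto simp: mono_on_def)
  have "(if b 0 < m then 1 else 0) * b 0 + (\<Sum>k<N. (if b (grid t n (Suc k)) < m then 1 else 0) *
          (b (grid t n (Suc k)) - b (grid t n k))) \<le> min (b (grid t n N)) m" for N
  proof (induction N)
    case (Suc N)
    then show ?case using mono[of N] by (auto simp: min_def split: if_splits)
  qed (use b m in auto)
  from this[of "Suc n"] show ?thesis unfolding riemann_sum_grid by linarith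
qed

text \<open>A discrete form of \<integral> b db \<ge> b^2 / 2. Right end points give y (y - x) \<ge>
  (y^2 - x^2) / 2, and truncating \<open>b\<close> at \<open>m\<close> only shortens its
  increments.\<close>

lemma riemann_sum_self_ge:
  assumes t: "0 \<le> t" and b: "mono_on {0..} b" "0 \<le> b 0" and m: "0 \<le> m"
  shows "(min (b t) m)\<^sup>2 / 2 \<le> riemann_sum (\<lambda>s. min (b s) m) b t n"
proof -
  have mono: "b (grid t n k) \<le> b (grid t n (Suc k))" for k
    using t b grid_nonneg[OF t] grid_mono[OF t, of k "Suc k"] by (auto simp: mono_on_def)
  have nonneg: "0 \<le> b (grid t n k)" for k
    using mono_onD[OF b(1), of 0 "grid t n k"] b(2) grid_nonneg[OF t] by auto
  have "(min (b (grid t n N)) m)\<^sup>2 / 2 \<le> min (b 0) m * b 0 + (\<Sum>k<N. min (b (grid t n (Suc k))) m *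
          (b (grid t n (Suc k)) - b (grid t n k)))" for N
  proof (induction N)
    case 0
    have "(min (b 0) m)\<^sup>2 \<le> min (b 0) m * b 0"
      unfolding power2_eq_square using b m by (intro mult_left_mono) auto
    moreover have "0 \<le> (min (b 0) m)\<^sup>2" by simp
    ultimately show ?case unfolding sum.lessThan_Suc lessThan_0 sum.empty grid_0 by linarith
  next
    case (Suc N)
    define x where "x = min (b (grid t n N)) m"
    define y where "y = min (b (grid t n (Suc N))) m"
    have "y * (y - x) \<le> y * (b (grid t n (Suc N)) - b (grid t n N))"
      unfolding x_def y_def using mono[of N] nonneg[of "Suc N"] m by (intro mult_left_mono) auto
    moreover have "(y\<^sup>2 - x\<^sup>2) / 2 \<le> y * (y - x)"
      using zero_le_power2[of "y - x"] by (simp add: power2_eq_square field_simps)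
    ultimately show ?case using Suc by (simp add: x_def y_def field_simps)
  qed
  from this[of "Suc n"] show ?thesis unfolding riemann_sum_grid by simp
qed

section \<open>Integrability of the dual projection and its formula on elementary processes\<close>

locale dual_projection = usual_filtration M F for M :: "'a measure" and F +
  fixes \<rho> :: "'a \<Rightarrow> ennreal" and A :: "real \<Rightarrow> 'a \<Rightarrow> real"
  assumes rho_meas: "\<rho> \<in> borel_measurable M"
    and rho_finite: "AE w in M. \<rho> w < \<infinity>"
    and dual: "dual_optional_projection M F \<rho> A"
begin

text \<open>Where \<rho> is infinite this is 0, in agreement with \<open>value_at\<close>; by
  assumption this happens on a null set.\<close>

definition r :: "'a \<Rightarrow> real" where "r w = enn2real (\<rho> w)"

lemma r_meas [measurable]: "r \<in> borel_measurable M"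
  unfolding r_def using rho_meas by measurable

lemma r_nonneg: "0 \<le> r w" by (simp add: r_def)

lemma value_at_rho: "value_at X \<rho> w = X (r w) w"
  by (simp add: value_at_def r_def)

lemma A_adapted: "adapted F A" and A_cadlag: "cadlag M A"
  and A0: "w \<in> space M ==> 0 \<le> A 0 w"
  and A_mono: "w \<in> space M ==> mono_on {0..} (\<lambda>t. A t w)"
  using dual unfolding dual_optional_projection_def by simp_all

lemma A_le: "w \<in> space M ==> 0 \<le> s ==> s \<le> t ==> A s w \<le> A t w"
  using mono_onD[OF A_mono, of w s t] by simp

lemma A_nonneg: "w \<in> space M ==> 0 \<le> t ==> 0 \<le> A t w"
  using A_le[of w 0 t] A0[of w] by simp

lemma A_meas: "0 \<le> t ==> A t \<in> borel_measurable M"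
  by (rule adaptedM[OF A_adapted])

lemma A_incr: "w \<in> space M ==> increasing_function (\<lambda>t. A t w)"
  by unfold_locales (auto intro: A0 A_mono cadlag_rightD[OF A_cadlag])

lemma value_meas:
  assumes "adapted F X" "cadlag M X"
  shows "(\<lambda>w. X (r w) w) \<in> borel_measurable M"
  by (rule measurable_right_continuous_at) (auto intro: adaptedM[OF assms(1)] cadlag_rightD[OF assms(2)] r_nonneg)

lemma stieltjes_eq:
  assumes "w \<in> space M" "\<And>s. 0 \<le> s ==> X s w = y s * indicator {..t} s"
  shows "stieltjes_integral X A w =
    (\<integral>s. y s * indicator {0..t} s \<partial>interval_measure (increasing_function.ext (\<lambda>t. A t w)))"
proof -
  interpret b: increasing_function "\<lambda>t. A t w" by (rule A_incr[OF assms(1)])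
  have "(\<lambda>t. if t < 0 then 0 else A t w) = b.ext" by (auto simp: b.ext_def)
  then show ?thesis
    unfolding stieltjes_integral_def set_lebesgue_integral_def
    by (intro arg_cong2[where f = lebesgue_integral] ext) (auto simp: indicator_def assms(2))
qed

lemma dual_formula:
  assumes "optional_process M F X" "\<And>t w. 0 \<le> t ==> w \<in> space M ==> \<bar>X t w\<bar> \<le> c"
  shows "E(\<lambda>w. X (r w) w) = E(\<lambda>w. stieltjes_integral X A w)"
proof -
  have "E(\<lambda>w. value_at X \<rho> w) = E(\<lambda>w. stieltjes_integral X A w)"
    using dual assms unfolding dual_optional_projection_def by blast
  then show ?thesis by (simp add: value_at_rho)
qed

abbreviation S :: "(real \<Rightarrow> 'a \<Rightarrow> real) \<Rightarrow> real \<Rightarrow> nat \<Rightarrow> 'a \<Rightarrow> real" where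
  "S Y t n w \<equiv> riemann_sum (\<lambda>s. Y s w) (\<lambda>s. A s w) t n"

lemma S_meas:
  assumes "adapted F Y" "0 \<le> t" shows "S Y t n \<in> borel_measurable M"
  unfolding riemann_sum_grid
  by (intro borel_measurable_add borel_measurable_sum borel_measurable_times borel_measurable_diff
      adaptedM[OF assms(1)] A_meas grid_nonneg[OF assms(2)] order_refl)

text \<open>\<open>W\<close> is the Stieltjes integral of \<open>Y\<close> over [0,t]. Later
  arguments use it only as a measurable limit of Riemann sums with the correct mean.\<close>

lemma dual_riemann:
  assumes Y: "adapted F Y" "cadlag M Y" and bd: "\<And>t w. 0 \<le> t ==> w \<in> space M ==> \<bar>Y t w\<bar> \<le> c" and t: "0 < t"
  obtains W where "W \<in> borel_measurable M" "\<And>w. w \<in> space M ==> (\<lambda>n. S Y t n w) \<longlonglongrightarrow> W w"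
    "E(\<lambda>w. Y (r w) w * indicator {..t} (r w)) = E(\<lambda>w. W w)"
proof
  let ?X = "\<lambda>s w. Y s w * indicator {..t} s"
  let ?W = "stieltjes_integral ?X A"
  show lim: "(\<lambda>n. S Y t n w) \<longlonglongrightarrow> ?W w" if "w \<in> space M" for w
  proof -
    interpret b: increasing_function "\<lambda>t. A t w" by (rule A_incr[OF that])
    show ?thesis
      unfolding stieltjes_eq[of w ?X "\<lambda>s. Y s w" t, OF that refl]
      by (rule b.riemann_sum_tendsto[OF t cadlag_rightD[OF Y(2) that] bd[OF _ that]])
  qed
  show "?W \<in> borel_measurable M"
    by (rule borel_measurable_LIMSEQ_real[OF lim S_meas]) (use Y t in auto)
  have "0 \<le> c" using bd[of 0] not_empty by (meson abs_ge_zero all_not_in_conv order_refl order_trans)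
  then have "\<bar>?X s w\<bar> \<le> c" if "0 \<le> s" "w \<in> space M" for s w
    using bd[OF that] by (auto simp: indicator_def)
  then show "E(\<lambda>w. Y (r w) w * indicator {..t} (r w)) = E(\<lambda>w. ?W w)"
    using t by (intro dual_formula optional_mult optional_cadlag[OF Y] optional_until) auto
qed

text \<open>Since \<open>A\<close> is increasing and right-continuous, the times with A < m form an
  initial interval that is open on the right. With \<le> in place of < right continuity could
  fail.\<close>

lemma level_cadlag: "cadlag M (\<lambda>t w. if A t w < m then 1 else (0::real))"
  unfolding cadlag_def
proof (intro ballI conjI allI impI)
  fix w and t :: real assume w: "w \<in> space M"
  { assume t: "0 \<le> t"
    have "\<forall>\<^sub>F s in at_right t. (if A s w < m then 1 else (0::real)) = (if A t w < m then 1 else 0)"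
    proof (cases "A t w < m")
      case True
      have "((\<lambda>s. A s w) \<longlongrightarrow> A t w) (at_right t)"
        using cadlag_rightD[OF A_cadlag w t] by (simp add: continuous_within)
      from order_tendstoD(2)[OF this True] show ?thesis by eventually_elim (use True in auto)
    next
      case False
      have "\<forall>\<^sub>F s in at_right t. t < s" by (simp add: eventually_at_filter)
      then show ?thesis
      proof eventually_elim
        case (elim s) then show ?case using A_le[OF w t, of s] False by auto
      qed
    qed
    then show "continuous (at_right t) (\<lambda>s. if A s w < m then 1 else (0::real))"
      unfolding continuous_within by (rule tendsto_eventually) }
  assume t: "0 < t"
  show "\<exists>l. ((\<lambda>s. if A s w < m then 1 else (0::real)) \<longlongrightarrow> l) (at_left t)"
  proof (cases "\<exists>s0. 0 \<le> s0 \<and> s0 < t \<and> m \<le> A s0 w")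
    case True
    then obtain s0 where s0: "0 \<le> s0" "s0 < t" "m \<le> A s0 w" by blast
    have "\<forall>\<^sub>F s in at_left t. (if A s w < m then 1 else (0::real)) = 0"
      using eventually_at_left_real[OF s0(2)]
    proof eventually_elim
      case (elim s) then show ?case using A_le[OF w s0(1), of s] s0(3) by auto
    qed
    then show ?thesis by (intro exI tendsto_eventually)
  next
    case False
    have "\<forall>\<^sub>F s in at_left t. (if A s w < m then 1 else (0::real)) = 1"
      using eventually_at_left_real[OF t] by eventually_elim (use False in force)
    then show ?thesis by (intro exI tendsto_eventually)
  qed
qed

lemma adapted_compose:
  assumes "adapted F X" "h \<in> borel_measurable borel" shows "adapted F (\<lambda>t w. h (X t w))"
  using assms unfolding adapted_def by (auto intro: measurable_compose)

text \<open>The dual formula says nothing about a non-integrable \<open>A\<^sub>t\<close>, whose Bochner integral is \<open>0\<close>. The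
  integrands \<open>1\<^bsub>A < m\<^esub>\<close> avoid this trap, their Stieltjes integrals being at most \<open>m\<close>.\<close>

lemma A_integrable_pos:
  assumes t: "0 < t" shows "integrable M (A t)" "E(\<lambda>w. A t w) \<le> 1"
proof -
  let ?Y = "\<lambda>m s w. if A s w < real m then 1 else (0::real)"
  let ?P = "\<lambda>m W. W \<in> borel_measurable M \<and> (\<forall>w\<in>space M. (\<lambda>n. S (?Y m) t n w) \<longlonglongrightarrow> W w) \<and>
    E(\<lambda>w. ?Y m (r w) w * indicator {..t} (r w)) = E(\<lambda>w. W w)"
  have ex: "\<exists>W. ?P m W" for m
  proof -
    have "adapted F (?Y m)"
      by (rule adapted_compose[OF A_adapted, where h = "\<lambda>x. if x < real m then 1 else 0"]) measurable
    then show ?thesis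
      by (rule dual_riemann[OF _ level_cadlag[of "real m"], of 1 t]) (use t in auto)
  qed
  define W where "W m = (SOME W. ?P m W)" for m
  have P: "?P m (W m)" for m
    unfolding W_def by (rule someI_ex[OF ex])
  have W: "\<And>m. W m \<in> borel_measurable M" "\<And>m w. w \<in> space M ==> (\<lambda>n. S (?Y m) t n w) \<longlonglongrightarrow> W m w"
    "\<And>m. E(\<lambda>w. ?Y m (r w) w * indicator {..t} (r w)) = E(\<lambda>w. W m w)"
    using P by blast+
  have t0: "0 \<le> t" using t by simp
  have bd: "0 \<le> W m w" "W m w \<le> real m" if w: "w \<in> space M" for m w
  proof -
    have "0 \<le> S (?Y m) t n w" for n
      using riemann_sum_mono[OF t0 A_mono[OF w] A0[OF w], of "\<lambda>_. 0" "\<lambda>s. ?Y m s w" n]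
      by (simp add: riemann_sum_const)
    then show "0 \<le> W m w" by (intro LIMSEQ_le_const[OF W(2)[OF w]] exI allI impI)
    show "W m w \<le> real m"
      by (intro LIMSEQ_le_const2[OF W(2)[OF w]] exI allI impI
            riemann_sum_below_level[OF t0 A_mono[OF w] A0[OF w]]) simp
  qed
  have "(\<lambda>m. W m w) \<longlonglongrightarrow> A t w" if w: "w \<in> space M" for w
  proof (rule tendsto_eventually)
    obtain m0 :: nat where m0: "A t w < real m0" using reals_Archimedean2 by blast
    show "\<forall>\<^sub>F m in sequentially. W m w = A t w"
      using eventually_ge_at_top[of m0]
    proof eventually_elim
      case (elim m)
      have "S (?Y m) t n w = A t w" for n
      proof -
        have "S (?Y m) t n w = riemann_sum (\<lambda>_. 1) (\<lambda>s. A s w) t n"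
        proof (rule riemann_sum_cong[OF t0])
          fix s assume "0 \<le> s" "s \<le> t"
          then have "A s w < real m" using A_le[OF w, of s t] m0 elim by linarith
          then show "?Y m s w = 1" by simp
        qed
        then show ?thesis by (simp add: riemann_sum_const)
      qed
      then show ?case using W(2)[OF w, of m] LIMSEQ_unique[OF _ tendsto_const] by simp
    qed
  qed
  then have lim: "AE w in M. (\<lambda>m. W m w) \<longlonglongrightarrow> A t w" by (intro AE_I2)
  have Wi: "integrable M (W m)" for m
    by (rule integrable_const_bound[where B = "real m"]) (use W(1) bd in \<open>auto intro!: AE_I2\<close>)
  have le1: "E(\<lambda>w. W m w) \<le> 1" for m
    unfolding W(3)[symmetric]
  proof (rule integral_le_const)
    have [measurable]: "(\<lambda>w. ?Y m (r w) w) \<in> borel_measurable M"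
      using value_meas[OF adapted_compose[OF A_adapted, where h = "\<lambda>x. if x < real m then 1 else 0"] level_cadlag[of "real m"]]
      by measurable
    show "integrable M (\<lambda>w. ?Y m (r w) w * indicator {..t} (r w))"
      by (rule integrable_const_bound[where B = 1]) (auto simp: indicator_def)
  qed (auto simp: indicator_def)
  note Fatou_integrable[of M W "A t" 1, OF Wi AE_I2[OF bd(1)] A_meas[OF t0] lim le1]
  then show "integrable M (A t)" "E(\<lambda>w. A t w) \<le> 1" by auto
qed

lemma A_integrable: assumes t: "0 \<le> t" shows "integrable M (A t)" "E(\<lambda>w. A t w) \<le> 1"
proof -
  \<comment> \<open>Riemann sums need a positive horizon, so time 0 is reached by comparison with a
    later time.\<close>
  have *: "AE w in M. A t w \<le> A (t + 1) w" using A_le t by (intro AE_I2) auto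
  show i: "integrable M (A t)"
    by (rule Bochner_Integration.integrable_bound[OF A_integrable_pos(1)[of "t + 1"] A_meas[OF t]])
       (use t A_le A_nonneg in \<open>auto intro!: AE_I2\<close>)
  show "E(\<lambda>w. A t w) \<le> 1"
    using integral_mono_AE[OF i A_integrable_pos(1) *] A_integrable_pos(2)[of "t + 1"] t by simp
qed

lemma dual_interval:
  assumes "0 \<le> u" "u \<le> v" "C \<in> sets (F (ennreal u))"
  shows "E(\<lambda>w. indicator C w * indicator {u<..v} (r w)) = E(\<lambda>w. indicator C w * (A v w - A u w))"
proof -
  let ?X = "\<lambda>s w. (indicator {u<..} s * indicator C w) * indicator {..v} s :: real"
  have "E(\<lambda>w. ?X (r w) w) = E(\<lambda>w. stieltjes_integral ?X A w)"
    using assms by (intro dual_formula[where c = 1] optional_mult optional_after optional_until) (auto simp: indicator_def)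
  also have "\<dots> = E(\<lambda>w. indicator C w * (A v w - A u w))"
  proof (rule Bochner_Integration.integral_cong[OF refl])
    fix w assume w: "w \<in> space M"
    interpret b: increasing_function "\<lambda>t. A t w" by (rule A_incr[OF w])
    have "stieltjes_integral ?X A w = (\<integral>s. (indicator {u<..} s * indicator C w) * indicator {0..v} s \<partial>b.\<nu>)"
      by (rule stieltjes_eq[OF w]) simp
    also have "\<dots> = (\<integral>s. indicator C w * indicator {u<..v} s \<partial>b.\<nu>)"
      using assms by (intro Bochner_Integration.integral_cong refl) (auto simp: indicator_def)
    also have "\<dots> = indicator C w * (A v w - A u w)"
      using b.measure_Ioc[OF assms(1,2)] by simp
    finally show "stieltjes_integral ?X A w = indicator C w * (A v w - A u w)" .
  qed
  also have "E(\<lambda>w. ?X (r w) w) = E(\<lambda>w. indicator C w * indicator {u<..v} (r w))"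
    by (intro Bochner_Integration.integral_cong refl) (auto simp: indicator_def)
  finally show ?thesis .
qed

text \<open>The intervals (u,v] miss the atom of \<open>dA\<close> at 0. The interval [0,v] that
  contains it can be combined with events of F_0.\<close>

lemma dual_initial:
  assumes "0 \<le> v" "C \<in> sets (F 0)"
  shows "E(\<lambda>w. indicator C w * indicator {..v} (r w)) = E(\<lambda>w. indicator C w * A v w)"
proof -
  \<comment> \<open>Constant in time for s \<ge> 0; written as a switch at time 0 so that
    \<open>adapted_switch\<close> and \<open>cadlag_switch\<close> apply.\<close>
  let ?X = "\<lambda>s w. (if s < 0 then 0 else indicator C w) * indicator {..v} s :: real"
  have "E(\<lambda>w. ?X (r w) w) = E(\<lambda>w. stieltjes_integral ?X A w)"
    using assms by (intro dual_formula[where c = 1] optional_mult optional_until optional_cadlag adapted_switch[of 0] cadlag_switch) (auto simp: indicator_def)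
  also have "\<dots> = E(\<lambda>w. indicator C w * A v w)"
  proof (rule Bochner_Integration.integral_cong[OF refl])
    fix w assume w: "w \<in> space M"
    interpret b: increasing_function "\<lambda>t. A t w" by (rule A_incr[OF w])
    have "stieltjes_integral ?X A w = (\<integral>s. indicator C w * indicator {0..v} s \<partial>b.\<nu>)"
      by (rule stieltjes_eq[OF w]) simp
    also have "\<dots> = indicator C w * A v w"
      using b.measure_Icc(1)[OF assms(1)] by simp
    finally show "stieltjes_integral ?X A w = indicator C w * A v w" .
  qed
  also have "E(\<lambda>w. ?X (r w) w) = E(\<lambda>w. indicator C w * indicator {..v} (r w))"
    by (intro Bochner_Integration.integral_cong refl) (simp add: r_nonneg linorder_not_less[THEN iffD2])
  finally show ?thesis .
qed

end

section \<open>The terminal value of the dual projection\<close>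

lemma convex_on_excess: "convex_on UNIV (\<lambda>x::real. max 0 (\<bar>x\<bar> - K))"
proof (rule convex_onI)
  fix a x y :: real assume a: "0 < a" "a < 1"
  define p where "p = max 0 (\<bar>x\<bar> - K)"
  define q where "q = max 0 (\<bar>y\<bar> - K)"
  have "(1 - a) * (\<bar>x\<bar> - K) \<le> (1 - a) * p" "a * (\<bar>y\<bar> - K) \<le> a * q"
    using a by (auto simp: p_def q_def intro!: mult_left_mono)
  moreover have "\<bar>(1 - a) * x + a * y\<bar> \<le> (1 - a) * \<bar>x\<bar> + a * \<bar>y\<bar>"
    using a abs_triangle_ineq[of "(1 - a) * x" "a * y"] by (simp add: abs_mult)
  moreover have "0 \<le> (1 - a) * p" "0 \<le> a * q" using a by (auto simp: p_def q_def)
  ultimately show "max 0 (\<bar>(1 - a) *\<^sub>R x + a *\<^sub>R y\<bar> - K) \<le> (1 - a) * max 0 (\<bar>x\<bar> - K) + a * max 0 (\<bar>y\<bar> - K)"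
    unfolding p_def[symmetric] q_def[symmetric] by (simp add: algebra_simps)
qed simp

lemma riemann_sum_add: "riemann_sum (\<lambda>s. y s + z s) b t n = riemann_sum y b t n + riemann_sum z b t n"
  unfolding riemann_sum_grid by (simp add: distrib_right sum.distrib del: sum.lessThan_Suc)

lemma riemann_sum_uminus: "riemann_sum (\<lambda>s. - y s) b t n = - riemann_sum y b t n"
  unfolding riemann_sum_grid by (simp add: sum_negf del: sum.lessThan_Suc)

context dual_projection begin

text \<open>\<open>enn2real\<close> sends \<infinity> to 0; by \<open>terminal_finite\<close> this
  default value is taken on a null set only.\<close>

definition Ainf :: "'a \<Rightarrow> real" where "Ainf w = enn2real (terminal_value A w)"

lemma terminal_value_SUP:
  assumes w: "w \<in> space M" shows "terminal_value A w = (SUP n. ennreal (A (real n) w))"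
proof -
  let ?s = "SUP n. ennreal (A (real n) w)"
  have "((\<lambda>t. ennreal (A t w)) \<longlongrightarrow> ?s) at_top"
  proof (rule order_tendstoI)
    fix a assume "a < ?s"
    then obtain n where n: "a < ennreal (A (real n) w)" by (auto simp: less_SUP_iff)
    show "\<forall>\<^sub>F t in at_top. a < ennreal (A t w)"
      using eventually_ge_at_top[of "real n"]
    proof eventually_elim
      case (elim t)
      have "ennreal (A (real n) w) \<le> ennreal (A t w)" using A_le[OF w _ elim] by (intro ennreal_leI) simp
      with n show ?case by (rule less_le_trans)
    qed
  next
    fix a assume a: "?s < a"
    show "\<forall>\<^sub>F t in at_top. ennreal (A t w) < a"
      using eventually_ge_at_top[of 0]
    proof eventually_elim
      case (elim t)
      obtain n :: nat where "t \<le> real n" using real_arch_simple by blast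
      then have "ennreal (A t w) \<le> ennreal (A (real n) w)" using A_le[OF w elim] by (intro ennreal_leI)
      also have "\<dots> \<le> ?s" by (rule SUP_upper) simp
      finally show ?case using a by (rule le_less_trans)
    qed
  qed
  then show ?thesis unfolding terminal_value_def by (intro tendsto_Lim) auto
qed

lemma terminal_meas [measurable]: "terminal_value A \<in> borel_measurable M"
proof -
  have [measurable]: "A (real n) \<in> borel_measurable M" for n by (intro A_meas) simp
  have "(\<lambda>w. SUP n. ennreal (A (real n) w)) \<in> borel_measurable M" by measurable
  then show ?thesis by (rule measurable_cong[THEN iffD1, rotated]) (rule terminal_value_SUP[symmetric])
qed

lemma Ainf_meas [measurable]: "Ainf \<in> borel_measurable M"
  unfolding Ainf_def by measurable

lemma Ainf_nonneg: "0 \<le> Ainf w" by (simp add: Ainf_def)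

lemma terminal_finite: "AE w in M. terminal_value A w \<noteq> \<infinity>"
proof (rule nn_integral_PInf_AE)
  have [measurable]: "A (real n) \<in> borel_measurable M" for n by (intro A_meas) simp
  have "(\<integral>\<^sup>+w. terminal_value A w \<partial>M) = (\<integral>\<^sup>+w. (SUP n. ennreal (A (real n) w)) \<partial>M)"
    by (rule nn_integral_cong) (rule terminal_value_SUP)
  also have "\<dots> = (SUP n. \<integral>\<^sup>+w. ennreal (A (real n) w) \<partial>M)"
    by (rule nn_integral_monotone_convergence_SUP_AE) (auto intro!: AE_I2 ennreal_leI A_le)
  also have "\<dots> \<le> 1"
  proof (rule SUP_least)
    fix n
    have "(\<integral>\<^sup>+w. ennreal (A (real n) w) \<partial>M) = ennreal (E(\<lambda>w. A (real n) w))"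
      by (rule nn_integral_eq_integral) (auto intro!: A_integrable AE_I2 A_nonneg)
    also have "\<dots> \<le> ennreal 1" by (intro ennreal_leI A_integrable) simp
    finally show "(\<integral>\<^sup>+w. ennreal (A (real n) w) \<partial>M) \<le> 1" by simp
  qed
  finally show "(\<integral>\<^sup>+w. terminal_value A w \<partial>M) \<noteq> \<infinity>" by (auto simp: top_unique)
qed measurable

lemma A_le_Ainf: "AE w in M. \<forall>t\<ge>0. A t w \<le> Ainf w"
  using terminal_finite AE_space
proof eventually_elim
  case (elim w)
  then have e: "ennreal (Ainf w) = (SUP n. ennreal (A (real n) w))"
    by (simp add: Ainf_def terminal_value_SUP[symmetric] less_top)
  show ?case
  proof (intro allI impI)
    fix t :: real assume t: "0 \<le> t"
    obtain n :: nat where n: "t \<le> real n" using real_arch_simple by blast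
    have "ennreal (A (real n) w) \<le> ennreal (Ainf w)" unfolding e by (rule SUP_upper) simp
    then have "A (real n) w \<le> Ainf w" using Ainf_nonneg by simp
    with A_le[OF elim(2) t n] show "A t w \<le> Ainf w" by simp
  qed
qed

lemma A_tendsto: "AE w in M. (\<lambda>n. A (real n) w) \<longlonglongrightarrow> Ainf w"
  using terminal_finite AE_space
proof eventually_elim
  case (elim w)
  then have e: "ennreal (Ainf w) = (SUP n. ennreal (A (real n) w))"
    by (simp add: Ainf_def terminal_value_SUP[symmetric] less_top)
  have "incseq (\<lambda>n. ennreal (A (real n) w))"
    by (intro incseq_SucI ennreal_leI A_le[OF elim(2)]) auto
  then have "(\<lambda>n. ennreal (A (real n) w)) \<longlonglongrightarrow> ennreal (Ainf w)"
    unfolding e by (rule LIMSEQ_SUP)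
  then show ?case
    by (rule tendsto_ennrealD) (auto simp: Ainf_nonneg A_nonneg[OF elim(2)] intro!: always_eventually)
qed

lemma Ainf_integrable: "integrable M Ainf"
  by (rule Fatou_integrable(1)[of M "\<lambda>n. A (real n)" Ainf 1, OF _ _ Ainf_meas A_tendsto])
     (auto intro: A_integrable A_nonneg intro!: AE_I2)

lemma A_test_tendsto:
  assumes C: "C \<in> sets M"
  shows "(\<lambda>n. E(\<lambda>w. indicator C w * A (real n) w)) \<longlonglongrightarrow> E(\<lambda>w. indicator C w * Ainf w)"
proof (rule integral_dominated_convergence[where w = Ainf])
  have [measurable]: "A (real n) \<in> borel_measurable M" for n by (intro A_meas) simp
  note C[measurable]
  show "(\<lambda>w. indicator C w * Ainf w) \<in> borel_measurable M"
    "(\<lambda>w. indicator C w * A (real n) w) \<in> borel_measurable M" for n by measurable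
  show "AE w in M. (\<lambda>n. indicator C w * A (real n) w) \<longlonglongrightarrow> indicator C w * Ainf w"
    using A_tendsto by eventually_elim (rule tendsto_mult_left)
  show "AE w in M. norm (indicator C w * A (real n) w) \<le> Ainf w" for n
    using A_le_Ainf AE_space
  proof eventually_elim
    case (elim w) then show ?case using A_nonneg[OF elim(2), of "real n"] Ainf_nonneg[of w] by (auto simp: indicator_def)
  qed
qed (rule Ainf_integrable)

lemma r_test_tendsto:
  assumes C: "C \<in> sets M"
  shows "(\<lambda>n. E(\<lambda>w. indicator C w * indicator {u<..real n} (r w))) \<longlonglongrightarrow>
    (E(\<lambda>w. indicator C w * indicator {u<..} (r w)) :: real)"
proof (rule integral_dominated_convergence[where w = "\<lambda>_. 1"])
  note C[measurable]
  show "(\<lambda>w. indicator C w * indicator {u<..} (r w) :: real) \<in> borel_measurable M"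
    "(\<lambda>w. indicator C w * indicator {u<..real n} (r w) :: real) \<in> borel_measurable M" for n by measurable
  have "(\<lambda>n. indicator C w * indicator {u<..real n} (r w)) \<longlonglongrightarrow> (indicator C w * indicator {u<..} (r w) :: real)" for w
  proof (rule tendsto_eventually)
    obtain m :: nat where m: "r w \<le> real m" using real_arch_simple by blast
    show "\<forall>\<^sub>F n in sequentially. indicator C w * indicator {u<..real n} (r w) = (indicator C w * indicator {u<..} (r w) :: real)"
      using eventually_ge_at_top[of m] by eventually_elim (use m in \<open>auto simp: indicator_def\<close>)
  qed
  then show "AE w in M. (\<lambda>n. indicator C w * indicator {u<..real n} (r w)) \<longlonglongrightarrow> (indicator C w * indicator {u<..} (r w) :: real)"
    by simp
qed (auto simp: indicator_def)

text \<open>Given F_0, the total mass of \<open>dA\<close> has mean P(\<rho> < \<infinity> | F_0) =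
  1. The case of the whole space gives E[A_\<infinity>] = 1, general events of F_0 give \<mu>_0 =
  1.\<close>

lemma Ainf_initial:
  assumes C: "C \<in> sets (F 0)"
  shows "E(\<lambda>w. indicator C w * Ainf w) = E(\<lambda>w. indicator C w)"
proof -
  have CM: "C \<in> sets M" using C sets_F_subset by blast
  \<comment> \<open>As \<open>r\<close> is nonnegative, any negative left end point turns [0,n] into
    a left-open interval, the form treated by \<open>r_test_tendsto\<close>.\<close>
  have e: "E(\<lambda>w. indicator C w * A (real n) w) = E(\<lambda>w. indicator C w * indicator {-1<..real n} (r w))" for n
  proof -
    have "indicator {..real n} (r w) = (indicator {-1<..real n} (r w) :: real)" for w
      using r_nonneg[of w] by (simp add: indicator_def)
    then show ?thesis using dual_initial[of "real n", OF _ C] by simp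
  qed
  have "indicator {-1<..} (r w) = (1 :: real)" for w
    using r_nonneg[of w] by (simp add: indicator_def)
  then have "(\<lambda>n. E(\<lambda>w. indicator C w * A (real n) w)) \<longlonglongrightarrow> E(\<lambda>w. indicator C w)"
    using r_test_tendsto[OF CM, of "-1"] by (simp add: e)
  then show ?thesis using A_test_tendsto[OF CM] LIMSEQ_unique by blast
qed

lemma Ainf_expectation: "E(\<lambda>w. Ainf w) = 1"
proof -
  have "space M \<in> sets (F 0)" using sets.top[of "F 0"] by (simp add: space_F)
  from Ainf_initial[OF this] have "E(\<lambda>w. indicator (space M) w * Ainf w) = 1" by (simp add: prob_space)
  moreover have "E(\<lambda>w. indicator (space M) w * Ainf w) = E(\<lambda>w. Ainf w)"
    by (intro Bochner_Integration.integral_cong) auto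
  ultimately show ?thesis by simp
qed

lemma adapted_value_bounded:
  assumes Y: "adapted F Y" "cadlag M Y" and bd: "\<And>t w. 0 \<le> t ==> w \<in> space M ==> \<bar>Y t w\<bar> \<le> c"
  shows "integrable M (\<lambda>w. Y (r w) w * indicator {..t} (r w))"
proof (rule integrable_const_bound[where B = "\<bar>c\<bar>"])
  have [measurable]: "(\<lambda>w. Y (r w) w) \<in> borel_measurable M" by (rule value_meas[OF Y])
  show "(\<lambda>w. Y (r w) w * indicator {..t} (r w)) \<in> borel_measurable M" by measurable
  show "AE w in M. norm (Y (r w) w * indicator {..t} (r w)) \<le> \<bar>c\<bar>"
  proof (rule AE_I2)
    fix w assume "w \<in> space M"
    then have "\<bar>Y (r w) w\<bar> \<le> \<bar>c\<bar>" using bd[OF r_nonneg[of w]] abs_ge_self order_trans by blast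
    then show "norm (Y (r w) w * indicator {..t} (r w)) \<le> \<bar>c\<bar>"
      by (simp add: indicator_def)
  qed
qed

lemma S_bound:
  assumes w: "w \<in> space M" and t: "0 \<le> t" and bd: "\<And>s. 0 \<le> s ==> \<bar>Y s w\<bar> \<le> c"
  shows "\<bar>S Y t n w\<bar> \<le> c * A t w"
proof -
  have "Y s w \<le> c" "- c \<le> Y s w" if "0 \<le> s" for s using bd[OF that] by linarith+
  then have "S Y t n w \<le> riemann_sum (\<lambda>_. c) (\<lambda>s. A s w) t n" "riemann_sum (\<lambda>_. - c) (\<lambda>s. A s w) t n \<le> S Y t n w"
    by (intro riemann_sum_mono[OF t A_mono[OF w] A0[OF w]]; simp)+
  then show ?thesis by (simp add: riemann_sum_const)
qed

text \<open>By \<open>\<integral>(A \<and> m) dA \<ge> (A\<^sub>t \<and> m)\<^sup>2 / 2\<close> and \<open>E[A\<^sub>\<rho> 1\<^bsub>\<rho> \<le> t\<^esub>] \<le> E[A\<^sub>t] \<le> 1\<close>.\<close>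

lemma min_A_square_le:
  assumes t: "0 < t" and m: "0 \<le> m"
  shows "E(\<lambda>w. (min (A t w) m)\<^sup>2) \<le> 2"
proof -
  have t0: "0 \<le> t" using t by simp
  have Am [measurable]: "A t \<in> borel_measurable M" by (rule A_meas[OF t0])
  let ?Y = "\<lambda>s w. min (A s w) m"
  have Y: "adapted F ?Y" "cadlag M ?Y"
    by (rule adapted_compose[OF A_adapted, where h = "\<lambda>x. min x m"], measurable)
       (rule cadlag_fun[OF A_cadlag, where h = "\<lambda>x. min x m"], intro continuous_intros)
  have bd: "\<bar>?Y s w\<bar> \<le> m" if "0 \<le> s" "w \<in> space M" for s w
    using A_nonneg[OF that(2,1)] m by auto
  obtain W where W: "W \<in> borel_measurable M" "\<And>w. w \<in> space M ==> (\<lambda>n. S ?Y t n w) \<longlonglongrightarrow> W w"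
    "E(\<lambda>w. ?Y (r w) w * indicator {..t} (r w)) = E(\<lambda>w. W w)"
    by (rule dual_riemann[OF Y bd t]) auto
  have lo: "(min (A t w) m)\<^sup>2 / 2 \<le> W w" if w: "w \<in> space M" for w
    by (intro LIMSEQ_le_const[OF W(2)[OF w]] exI allI impI riemann_sum_self_ge[OF t0 A_mono[OF w] A0[OF w] m])
  have hi: "\<bar>W w\<bar> \<le> m * A t w" if w: "w \<in> space M" for w
    by (intro LIMSEQ_le_const2[OF tendsto_rabs[OF W(2)[OF w]]] exI allI impI S_bound[OF w t0] bd w)
  have Wi: "integrable M W"
    by (rule Bochner_Integration.integrable_bound[OF integrable_mult_right[OF A_integrable(1)[OF t0], of m] W(1)])
       (use hi in \<open>auto intro!: AE_I2 order_trans[OF hi] abs_ge_self\<close>)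
  have sqi: "integrable M (\<lambda>w. (min (A t w) m)\<^sup>2 / 2)"
  proof (rule integrable_const_bound[where B = "m\<^sup>2 / 2"])
    show "AE w in M. norm ((min (A t w) m)\<^sup>2 / 2) \<le> m\<^sup>2 / 2"
      by (rule AE_I2) (use A_nonneg[OF _ t0] m in \<open>auto intro!: power_mono\<close>)
  qed measurable
  have "E(\<lambda>w. (min (A t w) m)\<^sup>2 / 2) \<le> E(\<lambda>w. W w)"
    by (rule integral_mono_AE[OF sqi Wi]) (use lo in auto)
  also have "\<dots> = E(\<lambda>w. ?Y (r w) w * indicator {..t} (r w))" by (rule W(3)[symmetric])
  also have "\<dots> \<le> E(\<lambda>w. A t w)"
  proof (rule integral_mono_AE[OF adapted_value_bounded[OF Y bd] A_integrable(1)[OF t0]])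
    show "AE w in M. ?Y (r w) w * indicator {..t} (r w) \<le> A t w"
    proof (rule AE_I2)
      fix w assume w: "w \<in> space M"
      show "?Y (r w) w * indicator {..t} (r w) \<le> A t w"
        using A_le[OF w r_nonneg, of w t] A_nonneg[OF w t0] by (auto simp: indicator_def)
    qed
  qed auto
  also have "\<dots> \<le> 1" by (rule A_integrable(2)[OF t0])
  finally show ?thesis by simp
qed

text \<open>Fatou's lemma with horizon and truncation level growing together: once the level exceeds
  \<open>Ainf w\<close>, the truncation is inactive. \<open>Suc n\<close> keeps the horizon
  positive.\<close>

lemma Ainf_square_integrable: "integrable M (\<lambda>w. (Ainf w)\<^sup>2)"
proof (rule Fatou_integrable(1)[of M "\<lambda>n w. (min (A (real (Suc n)) w) (real (Suc n)))\<^sup>2" _ 2])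
  have Am [measurable]: "A (real (Suc n)) \<in> borel_measurable M" for n by (rule A_meas) simp
  show "integrable M (\<lambda>w. (min (A (real (Suc n)) w) (real (Suc n)))\<^sup>2)" for n
  proof (rule integrable_const_bound[where B = "(real (Suc n))\<^sup>2"])
    show "AE w in M. norm ((min (A (real (Suc n)) w) (real (Suc n)))\<^sup>2) \<le> (real (Suc n))\<^sup>2"
    proof (rule AE_I2)
      fix w assume w: "w \<in> space M"
      have "0 \<le> A (real (Suc n)) w" by (rule A_nonneg[OF w]) simp
      then have "(min (A (real (Suc n)) w) (real (Suc n)))\<^sup>2 \<le> (real (Suc n))\<^sup>2" by (intro power_mono) auto
      then show "norm ((min (A (real (Suc n)) w) (real (Suc n)))\<^sup>2) \<le> (real (Suc n))\<^sup>2" by (simp del: of_nat_Suc)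
    qed
  qed measurable
  show "AE w in M. (\<lambda>n. (min (A (real (Suc n)) w) (real (Suc n)))\<^sup>2) \<longlonglongrightarrow> (Ainf w)\<^sup>2"
    using A_tendsto A_le_Ainf
  proof eventually_elim
    case (elim w)
    have "\<forall>\<^sub>F n in sequentially. A (real (Suc n)) w = min (A (real (Suc n)) w) (real (Suc n))"
    proof -
      obtain m :: nat where m: "Ainf w \<le> real m" using real_arch_simple by blast
      show ?thesis
        using eventually_ge_at_top[of m]
      proof eventually_elim
        case (elim n)
        have "A (real (Suc n)) w \<le> Ainf w" using \<open>\<forall>t\<ge>0. A t w \<le> Ainf w\<close> by simp
        then show ?case using m elim by simp
      qed
    qed
    from Lim_transform_eventually[OF LIMSEQ_Suc[OF elim(1)] this] show ?case by (rule tendsto_power)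
  qed
qed (auto simp del: of_nat_Suc intro!: min_A_square_le)

end

section \<open>Martingales evaluated at the random time\<close>

text \<open>The case K = 0 is the absolute value, so one estimate serves both for integrability at
  the random time (K = 0) and for the error made by clipping (K large).\<close>

definition excess :: "real \<Rightarrow> real \<Rightarrow> real" where "excess K x = max 0 (\<bar>x\<bar> - K)"

definition clip :: "real \<Rightarrow> real \<Rightarrow> real" where "clip K x = max (- K) (min K x)"

lemma excess_nonneg: "0 \<le> excess K x" by (simp add: excess_def)

lemma excess_0: "excess 0 x = \<bar>x\<bar>" by (simp add: excess_def)

lemma excess_meas [measurable]: "excess K \<in> borel_measurable borel"
  unfolding excess_def[abs_def] by measurable

lemma clip_meas [measurable]: "clip K \<in> borel_measurable borel"
  unfolding clip_def[abs_def] by measurable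

lemma excess_cont: "continuous_on UNIV (excess K)"
  unfolding excess_def[abs_def] by (intro continuous_intros)

lemma clip_cont: "continuous_on UNIV (clip K)"
  unfolding clip_def[abs_def] by (intro continuous_intros)

lemma clip_bound: "0 \<le> K ==> \<bar>clip K x\<bar> \<le> K" by (auto simp: clip_def)

lemma clip_excess: "0 \<le> K ==> \<bar>x - clip K x\<bar> = excess K x"
  by (auto simp: clip_def excess_def)

context usual_filtration begin

text \<open>Conditional Jensen inequality for the convex function \<open>excess K\<close>,
  multiplied by a nonnegative weight known at time \<open>u\<close>. The weights will be increments
  of \<open>A\<close>, which are unbounded in general.\<close>

lemma excess_submartingale:
  assumes X: "martingale M F X" and ut: "0 \<le> u" "u \<le> t"
    and y: "y \<in> borel_measurable (F (ennreal u))" "\<And>w. w \<in> space M ==> 0 \<le> y w"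
    and K: "0 \<le> K" and i: "integrable M (\<lambda>w. y w * excess K (X t w))"
  shows "integrable M (\<lambda>w. y w * excess K (X u w))"
    "E(\<lambda>w. y w * excess K (X u w)) \<le> E(\<lambda>w. y w * excess K (X t w))"
proof -
  interpret S: sigma_finite_subalgebra M "F (ennreal u)" by (rule cond_exp_F)
  have t0: "0 \<le> t" using ut by simp
  have Xi: "integrable M (X t)" using X t0 by (simp add: martingale_def)
  have ad: "adapted F X" using X by (simp add: martingale_def)
  note [measurable] = adaptedM[OF ad t0] adaptedM[OF ad ut(1)] meas_F_M[OF y(1)]
  have qi: "integrable M (\<lambda>w. excess K (X t w))"
    by (rule Bochner_Integration.integrable_bound[OF Xi]) (use K in \<open>auto simp: excess_def\<close>)
  have "AE w in M. excess K (real_cond_exp M (F (ennreal u)) (X t) w) \<le>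
      real_cond_exp M (F (ennreal u)) (\<lambda>w. excess K (X t w)) w"
    by (rule S.real_cond_exp_jensens_inequality(2)[OF Xi, of UNIV _ _ "excess K"])
       (use qi convex_on_excess[of K] in \<open>auto simp: excess_def[abs_def]\<close>)
  moreover have "AE w in M. real_cond_exp M (F (ennreal u)) (X t) w = X u w"
    using X ut by (simp add: martingale_def)
  ultimately have le: "AE w in M. y w * excess K (X u w) \<le> y w * real_cond_exp M (F (ennreal u)) (\<lambda>w. excess K (X t w)) w"
    using AE_space by eventually_elim (auto intro!: mult_left_mono y(2))
  have m: "(\<lambda>w. excess K (X t w)) \<in> borel_measurable M" by measurable
  note I = S.real_cond_exp_intg[OF i y(1) m]
  show i2: "integrable M (\<lambda>w. y w * excess K (X u w))"
  proof (rule Bochner_Integration.integrable_bound[OF I(1)])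
    show "AE w in M. norm (y w * excess K (X u w)) \<le> norm (y w * real_cond_exp M (F (ennreal u)) (\<lambda>w. excess K (X t w)) w)"
      using le AE_space
    proof eventually_elim
      case (elim w)
      have "0 \<le> y w * excess K (X u w)" using y(2)[OF elim(2)] excess_nonneg by simp
      then show ?case using elim(1) by simp
    qed
  qed measurable
  show "E(\<lambda>w. y w * excess K (X u w)) \<le> E(\<lambda>w. y w * excess K (X t w))"
    using integral_mono_AE[OF i2 I(1) le] I(2) by simp
qed

lemma martingale_uminus:
  assumes X: "martingale M F X" shows "martingale M F (\<lambda>t w. - X t w)"
proof (rule martingaleI)
  have a: "adapted F X" and c: "cadlag M X" and i: "\<And>t. 0 \<le> t ==> integrable M (X t)"
    using X by (auto simp: martingale_def)
  show "adapted F (\<lambda>t w. - X t w)" using a by (auto simp: adapted_def)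
  show "cadlag M (\<lambda>t w. - X t w)"
    by (rule cadlag_fun[OF c, where h = uminus]) (intro continuous_intros)
  show "integrable M (\<lambda>w. - X t w)" if "0 \<le> t" for t using i[OF that] by simp
  fix s t C assume st: "(0::real) \<le> s" "s \<le> t" and C: "C \<in> sets (F (ennreal s))"
  have "C \<in> sets M" using C sets_F_subset by blast
  then have "integrable M (\<lambda>w. indicator C w * X t w)"
    using integrable_mult_indicator[of C M "X t"] i[of t] st by simp
  from martingale_test(2)[OF X st _ this] C
  show "E(\<lambda>w. indicator C w * - X t w) = E(\<lambda>w. indicator C w * - X s w)"
    by simp
qed

end

section \<open>Riemann sums of martingales against the dual projection\<close>

context dual_projection begin

text \<open>Each increment of \<open>A\<close> is known at the right end point where
  \<open>V\<close> is evaluated, so \<open>V\<close> may be moved forward to time \<open>t\<close>;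
  the increments then telescope to \<open>A t\<close>. The hypothesis on \<open>V\<close> is kept
  abstract to cover both martingales and their excess.\<close>

lemma S_expectation_le:
  assumes t: "0 \<le> t"
    and V: "\<And>u y. 0 \<le> u ==> u \<le> t ==> y \<in> borel_measurable (F (ennreal u)) ==>
      (\<And>w. w \<in> space M ==> 0 \<le> y w \<and> y w \<le> A t w) ==>
      integrable M (\<lambda>w. y w * V u w) \<and> E(\<lambda>w. y w * V u w) \<le> E(\<lambda>w. y w * V t w)"
  shows "integrable M (S V t n)" "E(\<lambda>w. S V t n w) \<le> E(\<lambda>w. A t w * V t w)"
proof -
  define g where "g = grid t n"
  define D where "D k w = A (g (Suc k)) w - A (g k) w" for k w
  have g: "0 \<le> g k" "g k \<le> g (Suc k)" for k
    unfolding g_def using grid_nonneg[OF t] grid_mono[OF t] by auto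
  have gt: "g (Suc k) \<le> t" if "k \<in> {..<Suc n}" for k
    unfolding g_def using that by (intro grid_le[OF t]) auto
  have D0: "0 \<le> D k w \<and> D k w \<le> A t w" if "k \<in> {..<Suc n}" "w \<in> space M" for k w
    unfolding D_def using A_le[OF that(2) g[of k]] A_le[OF that(2) g(1) gt[OF that(1)]] A_nonneg[OF that(2) g(1)[of k]] by auto
  have Dm: "D k \<in> borel_measurable (F (ennreal s))" if "g (Suc k) \<le> s" for k s
    unfolding D_def using that g[of k] g(1)[of "Suc k"]
    by (intro borel_measurable_diff adaptedD[OF A_adapted]) auto
  have A0m: "A 0 \<in> borel_measurable (F (ennreal s))" if "0 \<le> s" for s
    using that by (intro adaptedD[OF A_adapted]) auto
  have A0b: "0 \<le> A 0 w \<and> A 0 w \<le> A t w" if "w \<in> space M" for w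
    using A0[OF that] A_le[OF that _ t] by simp
  have I0: "integrable M (\<lambda>w. A 0 w * V 0 w)" "E(\<lambda>w. A 0 w * V 0 w) \<le> E(\<lambda>w. A 0 w * V t w)"
    using V[of 0 "A 0", OF _ t A0m A0b] by auto
  have I0t: "integrable M (\<lambda>w. A 0 w * V t w)"
    using V[of t "A 0", OF t order_refl A0m[OF t] A0b] by auto
  have Ik: "integrable M (\<lambda>w. D k w * V (g (Suc k)) w)"
     "E(\<lambda>w. D k w * V (g (Suc k)) w) \<le> E(\<lambda>w. D k w * V t w)"
     "integrable M (\<lambda>w. D k w * V t w)" if k: "k \<in> {..<Suc n}" for k
    using V[of "g (Suc k)" "D k", OF g(1) gt[OF k] Dm[OF order_refl] D0[OF k]]
      V[of t "D k", OF t order_refl Dm[OF gt[OF k]] D0[OF k]] by auto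
  have Seq: "S V t n = (\<lambda>w. A 0 w * V 0 w + (\<Sum>k<Suc n. D k w * V (g (Suc k)) w))"
    unfolding riemann_sum_grid D_def g_def by (simp add: mult.commute del: sum.lessThan_Suc)
  show "integrable M (S V t n)"
    unfolding Seq by (intro Bochner_Integration.integrable_add I0 Bochner_Integration.integrable_sum Ik)
  have "E(\<lambda>w. S V t n w) = E(\<lambda>w. A 0 w * V 0 w) + (\<Sum>k<Suc n. E(\<lambda>w. D k w * V (g (Suc k)) w))"
    unfolding Seq by (simp only: Bochner_Integration.integral_add[OF I0(1) Bochner_Integration.integrable_sum[OF Ik(1)]] Bochner_Integration.integral_sum[OF Ik(1)])
  also have "\<dots> \<le> E(\<lambda>w. A 0 w * V t w) + (\<Sum>k<Suc n. E(\<lambda>w. D k w * V t w))"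
    by (intro add_mono sum_mono I0 Ik)
  also have "\<dots> = E(\<lambda>w. A 0 w * V t w + (\<Sum>k<Suc n. D k w * V t w))"
    by (simp only: Bochner_Integration.integral_add[OF I0t Bochner_Integration.integrable_sum[OF Ik(3)]] Bochner_Integration.integral_sum[OF Ik(3)])
  also have "(\<lambda>w. A 0 w * V t w + (\<Sum>k<Suc n. D k w * V t w)) = (\<lambda>w. A t w * V t w)"
  proof
    fix w
    have "A 0 w * V t w + (\<Sum>k<Suc n. D k w * V t w) = (A 0 w + (\<Sum>k<Suc n. D k w)) * V t w"
      by (simp only: sum_distrib_right distrib_right)
    then show "A 0 w * V t w + (\<Sum>k<Suc n. D k w * V t w) = A t w * V t w"
      unfolding D_def g_def using sum_increments[of "\<lambda>s. A s w" t n] by simp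
  qed
  finally show "E(\<lambda>w. S V t n w) \<le> E(\<lambda>w. A t w * V t w)" .
qed

lemma weighted_integrable:
  assumes t: "0 \<le> t" and f: "f \<in> borel_measurable M" "integrable M (\<lambda>w. A t w * f w)"
    and y: "y \<in> borel_measurable M" "\<And>w. w \<in> space M ==> 0 \<le> y w \<and> y w \<le> A t w"
  shows "integrable M (\<lambda>w. y w * f w)"
proof (rule Bochner_Integration.integrable_bound[OF f(2)])
  show "AE w in M. norm (y w * f w) \<le> norm (A t w * f w)"
    using y(2) by (intro AE_I2) (auto simp: abs_mult intro!: mult_right_mono intro: order_trans[OF _ abs_ge_self])
qed (use f y in measurable)

lemma S_martingale:
  assumes X: "martingale M F X" and t: "0 \<le> t" and i: "integrable M (\<lambda>w. A t w * X t w)"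
  shows "integrable M (S X t n)" "E(\<lambda>w. S X t n w) = E(\<lambda>w. A t w * X t w)"
proof -
  have *: "integrable M (S Y t n) \<and> E(\<lambda>w. S Y t n w) \<le> E(\<lambda>w. A t w * Y t w)"
    if Y: "martingale M F Y" and iY: "integrable M (\<lambda>w. A t w * Y t w)" for Y
  proof -
    have V: "integrable M (\<lambda>w. y w * Y u w) \<and> E(\<lambda>w. y w * Y u w) \<le> E(\<lambda>w. y w * Y t w)"
      if u: "0 \<le> u" "u \<le> t" and y: "y \<in> borel_measurable (F (ennreal u))"
      "\<And>w. w \<in> space M ==> 0 \<le> y w \<and> y w \<le> A t w" for u y
    proof -
      have Ym: "Y t \<in> borel_measurable M" using Y t by (intro adaptedM) (simp_all add: martingale_def)
      note martingale_test[OF Y u y(1) weighted_integrable[OF t Ym iY meas_F_M[OF y(1)] y(2)]]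
      then show ?thesis by simp
    qed
    show ?thesis
    proof
      show "integrable M (S Y t n)" by (rule S_expectation_le(1)[OF t]) (rule V)
      show "E(\<lambda>w. S Y t n w) \<le> E(\<lambda>w. A t w * Y t w)" by (rule S_expectation_le(2)[OF t]) (rule V)
    qed
  qed
  show "integrable M (S X t n)" using *[OF X i] by simp
  \<comment> \<open>The inequality applied to both \<open>X\<close> and \<open>-X\<close> gives
    equality.\<close>
  have "integrable M (\<lambda>w. A t w * - X t w)" using i by simp
  from *[OF X i] *[OF martingale_uminus[OF X] this]
  show "E(\<lambda>w. S X t n w) = E(\<lambda>w. A t w * X t w)"
    by (simp add: riemann_sum_uminus)
qed

lemma S_excess:
  assumes X: "martingale M F X" and t: "0 \<le> t" and i: "integrable M (\<lambda>w. A t w * X t w)" and K: "0 \<le> K"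
  shows "integrable M (\<lambda>w. A t w * excess K (X t w))"
    and "integrable M (S (\<lambda>s w. excess K (X s w)) t n)"
    and "E(\<lambda>w. S (\<lambda>s w. excess K (X s w)) t n w) \<le> E(\<lambda>w. A t w * excess K (X t w))"
proof -
  have [measurable]: "X t \<in> borel_measurable M" using X t by (intro adaptedM) (simp_all add: martingale_def)
  have [measurable]: "A t \<in> borel_measurable M" by (rule A_meas[OF t])
  show iE: "integrable M (\<lambda>w. A t w * excess K (X t w))"
    by (rule Bochner_Integration.integrable_bound[OF i])
       (use K in \<open>auto intro!: AE_I2 mult_left_mono simp: abs_mult excess_def\<close>)
  have *: "integrable M (\<lambda>w. y w * excess K (X u w)) \<and> E(\<lambda>w. y w * excess K (X u w)) \<le> E(\<lambda>w. y w * excess K (X t w))"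
    if u: "0 \<le> u" "u \<le> t" and y: "y \<in> borel_measurable (F (ennreal u))"
      "\<And>w. w \<in> space M ==> 0 \<le> y w \<and> y w \<le> A t w" for u y
  proof -
    have "(\<lambda>w. excess K (X t w)) \<in> borel_measurable M" by measurable
    from weighted_integrable[OF t this iE meas_F_M[OF y(1)] y(2)]
    show ?thesis using excess_submartingale[OF X u y(1) _ K] y(2) by blast
  qed
  show "integrable M (S (\<lambda>s w. excess K (X s w)) t n)"
    by (rule S_expectation_le(1)[OF t]) (rule *)
  show "E(\<lambda>w. S (\<lambda>s w. excess K (X s w)) t n w) \<le> E(\<lambda>w. A t w * excess K (X t w))"
    by (rule S_expectation_le(2)[OF t]) (rule *)
qed

text \<open>Fatou's lemma is used twice: along the Riemann sums of the bounded process min (excess K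
  X) m, then as m grows. An inequality is enough, since these quantities only bound errors.\<close>

lemma excess_value:
  assumes X: "martingale M F X" and t: "0 < t" and i: "integrable M (\<lambda>w. A t w * X t w)" and K: "0 \<le> K"
  shows "integrable M (\<lambda>w. excess K (X (r w) w) * indicator {..t} (r w))"
    and "E(\<lambda>w. excess K (X (r w) w) * indicator {..t} (r w)) \<le> E(\<lambda>w. A t w * excess K (X t w))"
proof -
  have t0: "0 \<le> t" using t by simp
  have ad: "adapted F X" and cX: "cadlag M X" using X by (auto simp: martingale_def)
  let ?h = "\<lambda>m x. min (excess K x) (real m)"
  let ?Y = "\<lambda>m s w. ?h m (X s w)"
  have Y: "adapted F (?Y m)" "cadlag M (?Y m)" for m
    by (rule adapted_compose[OF ad, where h = "?h m"], measurable)
       (rule cadlag_fun[OF cX, where h = "?h m"], intro continuous_intros excess_cont)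
  have bd: "\<bar>?Y m s w\<bar> \<le> real m" for m s w using excess_nonneg[of K "X s w"] by auto
  have le: "E(\<lambda>w. ?Y m (r w) w * indicator {..t} (r w)) \<le> E(\<lambda>w. A t w * excess K (X t w))" for m
  proof -
    obtain W where W: "W \<in> borel_measurable M" "\<And>w. w \<in> space M ==> (\<lambda>n. S (?Y m) t n w) \<longlonglongrightarrow> W w"
      "E(\<lambda>w. ?Y m (r w) w * indicator {..t} (r w)) = E(\<lambda>w. W w)"
      by (rule dual_riemann[OF Y bd t]) auto
    have Si: "integrable M (S (?Y m) t n)" for n
      by (rule Bochner_Integration.integrable_bound[OF integrable_mult_right[OF A_integrable(1)[OF t0], of "real m"] S_meas[OF Y(1) t0]])
         (use S_bound[OF _ t0, of _ "?Y m" "real m" n] bd in \<open>auto intro!: AE_I2 order_trans[OF S_bound[OF _ t0, of _ "?Y m" "real m" n]] abs_ge_self simp del: abs_mult\<close>)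
    have S0: "0 \<le> S (?Y m) t n w" if w: "w \<in> space M" for n w
      using riemann_sum_mono[OF t0 A_mono[OF w] A0[OF w], of "\<lambda>_. 0" "\<lambda>s. ?Y m s w" n] excess_nonneg
      by (simp add: riemann_sum_const)
    have "E(\<lambda>w. S (?Y m) t n w) \<le> E(\<lambda>w. A t w * excess K (X t w))" for n
    proof -
      have "E(\<lambda>w. S (?Y m) t n w) \<le> E(\<lambda>w. S (\<lambda>s w. excess K (X s w)) t n w)"
        by (rule integral_mono[OF Si S_excess(2)[OF X t0 i K]]) (intro riemann_sum_mono[OF t0 A_mono A0], auto)
      also note S_excess(3)[OF X t0 i K]
      finally show ?thesis .
    qed
    from Fatou_integrable(2)[OF Si AE_I2[OF S0] W(1) AE_I2[OF W(2)] this] show ?thesis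
      unfolding W(3) by simp
  qed
  have m: "(\<lambda>w. excess K (X (r w) w) * indicator {..t} (r w)) \<in> borel_measurable M"
    using value_meas[OF ad cX] by measurable
  have lim: "(\<lambda>m. ?Y m (r w) w * indicator {..t} (r w)) \<longlonglongrightarrow> excess K (X (r w) w) * indicator {..t} (r w)" for w
  proof (rule tendsto_eventually)
    obtain m0 :: nat where m0: "excess K (X (r w) w) \<le> real m0" using real_arch_simple by blast
    show "\<forall>\<^sub>F m in sequentially. ?Y m (r w) w * indicator {..t} (r w) = excess K (X (r w) w) * indicator {..t} (r w)"
      using eventually_ge_at_top[of m0] by eventually_elim (use m0 in auto)
  qed
  have nn: "0 \<le> ?Y m (r w) w * indicator {..t} (r w)" for m w
    using excess_nonneg by simp
  note Fatou_integrable[OF adapted_value_bounded[OF Y bd] AE_I2[OF nn] m AE_I2[OF lim] le]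
  then show "integrable M (\<lambda>w. excess K (X (r w) w) * indicator {..t} (r w))"
    and "E(\<lambda>w. excess K (X (r w) w) * indicator {..t} (r w)) \<le> E(\<lambda>w. A t w * excess K (X t w))" by auto
qed

text \<open>Clipping \<open>X\<close> at level \<open>K\<close> changes \<open>X\<^sub>\<rho>\<close> and, uniformly in the mesh, the Riemann sums by at most
  \<open>E[A\<^sub>t (\<bar>X\<^sub>t\<bar> - K)\<^sup>+]\<close> in mean, which replaces uniform integrability.\<close>

lemma martingale_value:
  assumes X: "martingale M F X" and t: "0 < t" and i: "integrable M (\<lambda>w. A t w * X t w)"
  shows "integrable M (\<lambda>w. X (r w) w * indicator {..t} (r w))"
    and "E(\<lambda>w. X (r w) w * indicator {..t} (r w)) = E(\<lambda>w. A t w * X t w)"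
proof -
  have t0: "0 \<le> t" using t by simp
  have ad: "adapted F X" and cX: "cadlag M X" using X by (auto simp: martingale_def)
  have [measurable]: "X t \<in> borel_measurable M" "A t \<in> borel_measurable M" by (rule adaptedM[OF ad t0], rule A_meas[OF t0])
  have m: "(\<lambda>w. X (r w) w * indicator {..t} (r w)) \<in> borel_measurable M"
    using value_meas[OF ad cX] by measurable
  show iX: "integrable M (\<lambda>w. X (r w) w * indicator {..t} (r w))"
    by (rule Bochner_Integration.integrable_bound[OF excess_value(1)[OF X t i order_refl] m])
       (auto simp: excess_0 abs_mult)
  define e where "e k = E(\<lambda>w. A t w * excess (real k) (X t w))" for k :: nat
  have e0: "e \<longlonglongrightarrow> E(\<lambda>w. 0)"
    unfolding e_def
  proof (rule integral_dominated_convergence[where w = "\<lambda>w. \<bar>A t w * X t w\<bar>"])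
    have "(\<lambda>k. A t w * excess (real k) (X t w)) \<longlonglongrightarrow> 0" for w
    proof (rule tendsto_eventually)
      obtain m0 :: nat where m0: "\<bar>X t w\<bar> \<le> real m0" using real_arch_simple by blast
      show "\<forall>\<^sub>F k in sequentially. A t w * excess (real k) (X t w) = 0"
        using eventually_ge_at_top[of m0] by eventually_elim (use m0 in \<open>auto simp: excess_def\<close>)
    qed
    then show "AE w in M. (\<lambda>k. A t w * excess (real k) (X t w)) \<longlonglongrightarrow> 0" by simp
    show "AE w in M. norm (A t w * excess (real k) (X t w)) \<le> \<bar>A t w * X t w\<bar>" for k
      by (intro AE_I2) (auto simp: abs_mult excess_def intro!: mult_left_mono)
  qed (use i in auto)
  let ?E = "E(\<lambda>w. X (r w) w * indicator {..t} (r w))"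
  let ?R = "E(\<lambda>w. A t w * X t w)"
  \<comment> \<open>One \<open>e k\<close> pays for clipping in the Riemann sums, the other for
    clipping at the random time.\<close>
  have "\<bar>?E - ?R\<bar> \<le> 2 * e k" for k
  proof -
    define K where "K = real k"
    have K: "0 \<le> K" by (simp add: K_def)
    let ?Y = "\<lambda>s w. clip K (X s w)"
    have Y: "adapted F ?Y" "cadlag M ?Y"
      by (rule adapted_compose[OF ad], measurable) (rule cadlag_fun[OF cX clip_cont])
    have bd: "\<bar>?Y s w\<bar> \<le> K" for s w by (rule clip_bound[OF K])
    obtain W where W: "W \<in> borel_measurable M" "\<And>w. w \<in> space M ==> (\<lambda>n. S ?Y t n w) \<longlonglongrightarrow> W w"
      "E(\<lambda>w. ?Y (r w) w * indicator {..t} (r w)) = E(\<lambda>w. W w)"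
      by (rule dual_riemann[OF Y bd t]) auto
    have Sb: "AE w in M. norm (S ?Y t n w) \<le> K * A t w" for n
      by (rule AE_I2) (use S_bound[OF _ t0 bd] in simp)
    have KA: "integrable M (\<lambda>w. K * A t w)" by (rule integrable_mult_right[OF A_integrable(1)[OF t0]])
    have lim: "(\<lambda>n. E(\<lambda>w. S ?Y t n w)) \<longlonglongrightarrow> E(\<lambda>w. W w)"
      by (rule integral_dominated_convergence[OF W(1) S_meas[OF Y(1) t0] KA AE_I2[OF W(2)] Sb])
    have Si: "integrable M (S ?Y t n)" for n
    proof (rule Bochner_Integration.integrable_bound[OF KA S_meas[OF Y(1) t0]])
      show "AE w in M. norm (S ?Y t n w) \<le> norm (K * A t w)"
        using Sb[of n] by eventually_elim simp
    qed
    have close: "\<bar>E(\<lambda>w. S ?Y t n w) - ?R\<bar> \<le> e k" for n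
    proof -
      note SX = S_martingale[OF X t0 i, of n]
      note SE = S_excess(2,3)[OF X t0 i K, of n]
      have b: "S ?Y t n w \<le> S X t n w + S (\<lambda>s w. excess K (X s w)) t n w"
        "S X t n w \<le> S ?Y t n w + S (\<lambda>s w. excess K (X s w)) t n w" if w: "w \<in> space M" for w
      proof -
        have "clip K x \<le> x + excess K x" "x \<le> clip K x + excess K x" for x
          using clip_excess[OF K, of x] by linarith+
        then show "S ?Y t n w \<le> S X t n w + S (\<lambda>s w. excess K (X s w)) t n w"
          "S X t n w \<le> S ?Y t n w + S (\<lambda>s w. excess K (X s w)) t n w"
          unfolding riemann_sum_add[symmetric] by (intro riemann_sum_mono[OF t0 A_mono[OF w] A0[OF w]]; simp)+
      qed
      have "E(\<lambda>w. S ?Y t n w) \<le> E(\<lambda>w. S X t n w + S (\<lambda>s w. excess K (X s w)) t n w)"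
        by (rule integral_mono[OF Si Bochner_Integration.integrable_add[OF SX(1) SE(1)]]) (rule b)
      moreover have "E(\<lambda>w. S X t n w) \<le> E(\<lambda>w. S ?Y t n w + S (\<lambda>s w. excess K (X s w)) t n w)"
        by (rule integral_mono[OF SX(1) Bochner_Integration.integrable_add[OF Si SE(1)]]) (rule b)
      ultimately show ?thesis
        using SE(2) SX(2) Bochner_Integration.integral_add[OF SX(1) SE(1)] Bochner_Integration.integral_add[OF Si[of n] SE(1)]
        unfolding e_def K_def[symmetric] by linarith
    qed
    have "\<bar>E(\<lambda>w. W w) - ?R\<bar> \<le> e k"
      by (intro LIMSEQ_le_const2[OF tendsto_rabs[OF tendsto_diff[OF lim tendsto_const]]] exI allI impI close)
    moreover have "\<bar>?E - E(\<lambda>w. W w)\<bar> \<le> e k"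
    proof -
      note iY = adapted_value_bounded[OF Y bd, of t]
      have "\<bar>?E - E(\<lambda>w. W w)\<bar> = \<bar>E(\<lambda>w. X (r w) w * indicator {..t} (r w) - ?Y (r w) w * indicator {..t} (r w))\<bar>"
        using Bochner_Integration.integral_diff[OF iX iY] W(3) by simp
      also have "\<dots> \<le> E(\<lambda>w. \<bar>X (r w) w * indicator {..t} (r w) - ?Y (r w) w * indicator {..t} (r w)\<bar>)"
        by (rule integral_abs_bound)
      also have "\<dots> = E(\<lambda>w. excess K (X (r w) w) * indicator {..t} (r w))"
        by (intro Bochner_Integration.integral_cong refl) (auto simp: indicator_def clip_excess[OF K])
      also have "\<dots> \<le> e k"
        unfolding e_def K_def[symmetric] by (rule excess_value(2)[OF X t i K])
      finally show ?thesis .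
    qed
    ultimately show ?thesis by linarith
  qed
  moreover have "(\<lambda>k. 2 * e k) \<longlonglongrightarrow> 0" using tendsto_mult_left[OF e0, of 2] by simp
  ultimately have "\<bar>?E - ?R\<bar> \<le> 0" by (intro LIMSEQ_le_const[of "\<lambda>k. 2 * e k"]) auto
  then show "?E = ?R" by simp
qed

end

section \<open>Pseudo-stopping times and the terminal value\<close>

context usual_filtration begin

lemma projection_test:
  assumes p: "cadlag_projection M F V X" and t: "0 \<le> t" and V: "V t \<in> borel_measurable M"
    and y: "y \<in> borel_measurable (F (ennreal t))" and i: "integrable M (\<lambda>w. y w * V t w)"
  shows "integrable M (\<lambda>w. y w * X t w)" "E(\<lambda>w. y w * X t w) = E(\<lambda>w. y w * V t w)"
proof -
  have a: "X t \<in> borel_measurable M" using p t by (intro adaptedM) (simp_all add: cadlag_projection_def)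
  have "AE w in M. X t w = real_cond_exp M (F (ennreal t)) (V t) w"
    using p t by (simp add: cadlag_projection_def)
  from cond_exp_test[OF V y i this a]
  show "integrable M (\<lambda>w. y w * X t w)" "E(\<lambda>w. y w * X t w) = E(\<lambda>w. y w * V t w)" .
qed

lemma projection_martingale:
  assumes p: "cadlag_projection M F (\<lambda>_. f) X" and f: "integrable M f"
  shows "martingale M F X"
proof (rule martingaleI)
  show "adapted F X" "cadlag M X" using p by (auto simp: cadlag_projection_def)
  show "integrable M (X t)" if "0 \<le> t" for t
    using projection_test(1)[OF p that, of "\<lambda>_. 1"] f by simp
  fix s t C assume st: "(0::real) \<le> s" "s \<le> t" and C: "C \<in> sets (F (ennreal s))"
  have CM: "C \<in> sets M" using C sets_F_subset by blast
  have Ct: "C \<in> sets (F (ennreal t))" using C st sets_F_mono[of "ennreal s" "ennreal t"] by (auto simp: ennreal_leI)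
  have i: "integrable M (\<lambda>w. indicator C w * f w)"
    using integrable_mult_indicator[OF CM f] by simp
  have t: "0 \<le> t" using st by simp
  show "E(\<lambda>w. indicator C w * X t w) = E(\<lambda>w. indicator C w * X s w)"
    using projection_test(2)[OF p t _ _ i] projection_test(2)[OF p st(1) _ _ i] C Ct f by simp
qed

end

locale azema = dual_projection M F \<rho> A for M :: "'a measure" and F \<rho> A +
  fixes Z \<mu> :: "real \<Rightarrow> 'a \<Rightarrow> real"
  assumes Z_proj: "azema_supermartingale M F \<rho> Z"
    and mu_proj: "mu_martingale M F A \<mu>"
begin

lemma mu_cp: "cadlag_projection M F (\<lambda>_. Ainf) \<mu>"
  using mu_proj by (simp add: mu_martingale_def Ainf_def[abs_def])

lemma mu_martingale: "martingale M F \<mu>"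
  by (rule projection_martingale[OF mu_cp Ainf_integrable])

lemma Z_adapted: "adapted F Z" and Z_cadlag: "cadlag M Z"
  using Z_proj by (auto simp: azema_supermartingale_def cadlag_projection_def)

lemma mu_adapted: "adapted F \<mu>" and mu_cadlag: "cadlag M \<mu>"
  using mu_cp by (auto simp: cadlag_projection_def)

lemma after_meas: "{w\<in>space M. ennreal t < \<rho> w} \<in> sets M"
  using rho_meas by measurable

lemma after_eq: "0 \<le> t ==> AE w in M. indicator {w\<in>space M. ennreal t < \<rho> w} w = (indicator {t<..} (r w) :: real)"
  using rho_finite AE_space
proof eventually_elim
  case (elim w)
  then have "\<rho> w = ennreal (r w)" by (simp add: r_def)
  then have "ennreal t < \<rho> w \<longleftrightarrow> t < r w" using elim by (simp add: ennreal_less_iff)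
  then show ?case using elim by (simp add: indicator_def)
qed

lemma Z_test:
  assumes t: "0 \<le> t" and y: "y \<in> borel_measurable (F (ennreal t))" and i: "integrable M y"
  shows "integrable M (\<lambda>w. y w * Z t w)" "E(\<lambda>w. y w * Z t w) = E(\<lambda>w. y w * indicator {t<..} (r w))"
proof -
  note [measurable] = after_meas meas_F_M[OF y]
  have i': "integrable M (\<lambda>w. y w * indicator {w\<in>space M. ennreal t < \<rho> w} w)"
    by (rule Bochner_Integration.integrable_bound[OF i]) (auto simp: indicator_def)
  note T = projection_test[OF Z_proj[unfolded azema_supermartingale_def] t _ y i']
  show "integrable M (\<lambda>w. y w * Z t w)" by (rule T(1)) measurable
  have "E(\<lambda>w. y w * Z t w) = E(\<lambda>w. y w * indicator {w\<in>space M. ennreal t < \<rho> w} w)"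
    by (rule T(2)) measurable
  also have "\<dots> = E(\<lambda>w. y w * indicator {t<..} (r w))"
  proof (rule integral_cong_AE)
    show "AE w in M. y w * indicator {w\<in>space M. ennreal t < \<rho> w} w = y w * indicator {t<..} (r w)"
      using after_eq[OF t] by eventually_elim simp
  qed measurable
  finally show "E(\<lambda>w. y w * Z t w) = E(\<lambda>w. y w * indicator {t<..} (r w))" .
qed

lemma Z_integrable: assumes t: "0 \<le> t" shows "integrable M (Z t)"
proof -
  have "integrable M (\<lambda>w. 1 * Z t w)" by (rule Z_test(1)[OF t]) simp_all
  then show ?thesis by simp
qed

lemma Z_bounds: "AE w in M. \<forall>t\<ge>0. 0 \<le> Z t w \<and> Z t w \<le> 1"
proof -
  have *: "AE w in M. 0 \<le> Z t w \<and> Z t w \<le> 1" if t: "0 \<le> t" for t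
  proof -
    interpret S: sigma_finite_subalgebra M "F (ennreal t)" by (rule cond_exp_F)
    let ?f = "indicator {w\<in>space M. ennreal t < \<rho> w} :: 'a \<Rightarrow> real"
    note [measurable] = after_meas
    have "AE w in M. 0 \<le> real_cond_exp M (F (ennreal t)) ?f w"
      by (rule S.real_cond_exp_pos) auto
    moreover have "AE w in M. real_cond_exp M (F (ennreal t)) ?f w \<le> real_cond_exp M (F (ennreal t)) (\<lambda>_. 1) w"
    proof (rule S.real_cond_exp_mono)
      show "integrable M ?f"
        by (rule integrable_const_bound[where B = 1]) (auto simp: indicator_def)
    qed (auto simp: indicator_def)
    moreover have "AE w in M. real_cond_exp M (F (ennreal t)) (\<lambda>_. 1) w = 1"
      by (rule S.real_cond_exp_F_meas) auto
    moreover have "AE w in M. Z t w = real_cond_exp M (F (ennreal t)) ?f w"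
      using Z_proj t by (simp add: azema_supermartingale_def cadlag_projection_def)
    ultimately show ?thesis by eventually_elim simp
  qed
  have 1: "AE w in M. (0::real) \<le> Z t w" and 2: "AE w in M. Z t w \<le> 1" if "0 \<le> t" for t
    using *[OF that] by (eventually_elim, simp)+
  have "AE w in M. \<forall>t\<ge>0. 0 \<le> Z t w" using cadlag_const[of M "\<lambda>_. 0"] Z_cadlag 1 by (rule AE_all_le)
  moreover have "AE w in M. \<forall>t\<ge>0. Z t w \<le> 1" using Z_cadlag cadlag_const[of M "\<lambda>_. 1"] 2 by (rule AE_all_le)
  ultimately show ?thesis by eventually_elim simp
qed

text \<open>Letting v grow in \<open>dual_interval\<close> gives E[1_C 1_{\<rho> > t}] =
  E[1_C (A_\<infinity> - A_t)] for C in F_t, that is, Z_t = E[A_\<infinity> | F_t] - A_t.\<close>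

lemma mu_eq: "AE w in M. \<forall>t\<ge>0. \<mu> t w = A t w + Z t w"
proof (rule AE_all_eq[OF mu_cadlag cadlag_add[OF A_cadlag Z_cadlag]])
  fix t :: real assume t: "0 \<le> t"
  have "AE w in M. real_cond_exp M (F (ennreal t)) Ainf w = A t w + Z t w"
  proof (rule cond_exp_eqI[OF Ainf_integrable Bochner_Integration.integrable_add[OF A_integrable(1)[OF t] Z_integrable[OF t]]])
    show "(\<lambda>w. A t w + Z t w) \<in> borel_measurable (F (ennreal t))"
      by (intro borel_measurable_add adaptedD[OF A_adapted] adaptedD[OF Z_adapted] t order_refl)
    fix C assume C: "C \<in> sets (F (ennreal t))"
    have CM: "C \<in> sets M" using C sets_F_subset by blast
    have iA: "integrable M (\<lambda>w. indicator C w * A s w)" if "0 \<le> s" for s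
      using integrable_mult_indicator[OF CM A_integrable(1)[OF that]] by simp
    have yC: "(indicator C :: 'a \<Rightarrow> real) \<in> borel_measurable (F (ennreal t))" using C by measurable
    have iC: "integrable M (indicator C :: 'a \<Rightarrow> real)"
      by (rule integrable_const_bound[where B = 1]) (use CM in \<open>auto simp: indicator_def\<close>)
    note ZT = Z_test[OF t yC iC]
    have e: "E(\<lambda>w. indicator C w * indicator {t<..real n} (r w)) = E(\<lambda>w. indicator C w * A (real n) w) - E(\<lambda>w. indicator C w * A t w)"
      if "t \<le> real n" for n
      using dual_interval[OF t that C] Bochner_Integration.integral_diff[OF iA[of "real n"] iA[OF t]] by (simp add: right_diff_distrib)
    have "(\<lambda>n. E(\<lambda>w. indicator C w * A (real n) w) - E(\<lambda>w. indicator C w * A t w))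
        \<longlonglongrightarrow> E(\<lambda>w. indicator C w * Ainf w) - E(\<lambda>w. indicator C w * A t w)"
      by (intro tendsto_diff tendsto_const A_test_tendsto CM)
    moreover have "\<forall>\<^sub>F n in sequentially. E(\<lambda>w. indicator C w * A (real n) w) - E(\<lambda>w. indicator C w * A t w)
       = E(\<lambda>w. indicator C w * indicator {t<..real n} (r w))"
    proof -
      obtain m :: nat where m: "t \<le> real m" using real_arch_simple by blast
      show ?thesis using eventually_ge_at_top[of m]
      proof eventually_elim
        case (elim n) then have "t \<le> real n" using m by simp
        from e[OF this] show ?case by simp
      qed
    qed
    ultimately have "(\<lambda>n. E(\<lambda>w. indicator C w * indicator {t<..real n} (r w)))
       \<longlonglongrightarrow> E(\<lambda>w. indicator C w * Ainf w) - E(\<lambda>w. indicator C w * A t w)"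
      by (rule Lim_transform_eventually)
    from LIMSEQ_unique[OF this r_test_tendsto[OF CM]] ZT(2)
    have "E(\<lambda>w. indicator C w * Ainf w) = E(\<lambda>w. indicator C w * A t w) + E(\<lambda>w. indicator C w * Z t w)"
      by simp
    then show "E(\<lambda>w. indicator C w * Ainf w) = E(\<lambda>w. indicator C w * (A t w + Z t w))"
      using Bochner_Integration.integral_add[OF iA[OF t] ZT(1)] by (simp add: distrib_left)
  qed
  moreover have "AE w in M. \<mu> t w = real_cond_exp M (F (ennreal t)) Ainf w"
    using mu_cp t by (simp add: cadlag_projection_def)
  ultimately show "AE w in M. \<mu> t w = A t w + Z t w" by eventually_elim simp
qed

lemma mu_bounds: "AE w in M. \<forall>t\<ge>0. \<bar>\<mu> t w\<bar> \<le> 1 + Ainf w"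
  using mu_eq Z_bounds A_le_Ainf AE_space
proof eventually_elim
  case (elim w)
  show ?case
  proof (intro allI impI)
    fix t :: real assume t: "0 \<le> t"
    with elim A_nonneg[OF elim(4) t] have "\<mu> t w = A t w + Z t w" "0 \<le> Z t w" "Z t w \<le> 1" "A t w \<le> Ainf w" "0 \<le> A t w"
      by auto
    then show "\<bar>\<mu> t w\<bar> \<le> 1 + Ainf w" by simp
  qed
qed

lemma mu_H1: "H1_martingale M F \<mu>"
  unfolding H1_martingale_def
proof
  have "(\<integral>\<^sup>+w. (SUP t\<in>{0..}. ennreal \<bar>\<mu> t w\<bar>) \<partial>M) \<le> (\<integral>\<^sup>+w. ennreal (1 + Ainf w) \<partial>M)"
  proof (rule nn_integral_mono_AE)
    show "AE w in M. (SUP t\<in>{0..}. ennreal \<bar>\<mu> t w\<bar>) \<le> ennreal (1 + Ainf w)"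
      using mu_bounds by eventually_elim (auto intro!: SUP_least ennreal_leI)
  qed
  also have "\<dots> = ennreal (E(\<lambda>w. 1 + Ainf w))"
    by (rule nn_integral_eq_integral) (use Ainf_integrable Ainf_nonneg in \<open>auto intro!: AE_I2 add_nonneg_nonneg\<close>)
  also have "\<dots> < \<infinity>" by simp
  finally show "(\<integral>\<^sup>+w. (SUP t\<in>{0..}. ennreal \<bar>\<mu> t w\<bar>) \<partial>M) < \<infinity>" .
qed (rule mu_martingale)

lemma mu_initial: "AE w in M. \<mu> 0 w = 1"
proof -
  have "AE w in M. real_cond_exp M (F 0) Ainf w = 1"
  proof (rule cond_exp_eqI[OF Ainf_integrable])
    fix C assume "C \<in> sets (F 0)"
    from Ainf_initial[OF this] show "E(\<lambda>w. indicator C w * Ainf w) = E(\<lambda>w. indicator C w * 1)" by simp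
  qed auto
  moreover have "AE w in M. \<mu> 0 w = real_cond_exp M (F 0) Ainf w"
    using mu_cp by (auto simp: cadlag_projection_def dest: spec[of _ 0])
  ultimately show ?thesis by eventually_elim simp
qed

lemma dominating: "integrable M (\<lambda>w. Ainf w * (1 + Ainf w))"
  using Bochner_Integration.integrable_add[OF Ainf_integrable Ainf_square_integrable]
  by (simp add: distrib_left power2_eq_square)

lemma A_mult_integrable:
  assumes t: "0 \<le> t" shows "integrable M (\<lambda>w. A t w * Ainf w)" "integrable M (\<lambda>w. A t w * \<mu> t w)"
proof -
  note [measurable] = A_meas[OF t] adaptedM[OF mu_adapted t]
  have b: "AE w in M. norm (A t w * f w) \<le> norm (Ainf w * (1 + Ainf w))"
    if "AE w in M. \<bar>f w\<bar> \<le> 1 + Ainf w" for f :: "'a \<Rightarrow> real"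
    using that A_le_Ainf AE_space
  proof eventually_elim
    case (elim w)
    have "norm (A t w * f w) = A t w * \<bar>f w\<bar>" using A_nonneg[OF elim(3) t] by (simp add: abs_mult)
    also have "\<dots> \<le> Ainf w * (1 + Ainf w)"
      using elim t A_nonneg[OF elim(3) t] Ainf_nonneg by (intro mult_mono) auto
    finally show ?case by simp
  qed
  show "integrable M (\<lambda>w. A t w * Ainf w)"
    by (rule Bochner_Integration.integrable_bound[OF dominating _ b]) (auto simp: Ainf_nonneg intro!: AE_I2)
  have "AE w in M. \<bar>\<mu> t w\<bar> \<le> 1 + Ainf w" using mu_bounds by eventually_elim (use t in auto)
  from b[OF this] show "integrable M (\<lambda>w. A t w * \<mu> t w)"
    by (rule Bochner_Integration.integrable_bound[OF dominating, rotated]) measurable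
qed

lemma A_mu_expectation: "0 \<le> t ==> E(\<lambda>w. A t w * \<mu> t w) = E(\<lambda>w. A t w * Ainf w)"
  using projection_test(2)[OF mu_cp _ Ainf_meas adaptedD[OF A_adapted] A_mult_integrable(1)] by simp

lemma A_Ainf_tendsto: "(\<lambda>n. E(\<lambda>w. A (real n) w * Ainf w)) \<longlonglongrightarrow> E(\<lambda>w. (Ainf w)\<^sup>2)"
proof (rule integral_dominated_convergence[OF _ _ Ainf_square_integrable])
  have [measurable]: "A (real n) \<in> borel_measurable M" for n by (intro A_meas) simp
  show "(\<lambda>w. (Ainf w)\<^sup>2) \<in> borel_measurable M" "(\<lambda>w. A (real n) w * Ainf w) \<in> borel_measurable M" for n by measurable
  show "AE w in M. (\<lambda>n. A (real n) w * Ainf w) \<longlonglongrightarrow> (Ainf w)\<^sup>2"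
    using A_tendsto by eventually_elim (auto simp: power2_eq_square intro: tendsto_mult_right)
  show "AE w in M. norm (A (real n) w * Ainf w) \<le> (Ainf w)\<^sup>2" for n
    using A_le_Ainf AE_space
  proof eventually_elim
    case (elim w)
    have "0 \<le> A (real n) w" using A_nonneg[OF elim(2)] by simp
    then show ?case using elim Ainf_nonneg[of w] by (auto simp: power2_eq_square abs_mult intro!: mult_right_mono)
  qed
qed

text \<open>Since E[A_\<infinity>] = 1, a second moment equal to 1 means that the variance is
  0.\<close>

lemma terminal_one_if_square:
  assumes "E(\<lambda>w. (Ainf w)\<^sup>2) = 1"
  shows "AE w in M. terminal_value A w = 1"
proof -
  have i: "integrable M (\<lambda>w. (Ainf w - 1)\<^sup>2)"
    using Ainf_integrable Ainf_square_integrable by (simp add: power2_diff)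
  have "E(\<lambda>w. (Ainf w - 1)\<^sup>2) = 0"
    using Ainf_integrable Ainf_square_integrable assms Ainf_expectation by (simp add: power2_diff prob_space)
  then have "AE w in M. (Ainf w - 1)\<^sup>2 = 0"
    using integral_nonneg_eq_0_iff_AE[OF i] by simp
  then show ?thesis using terminal_finite
  proof eventually_elim
    case (elim w)
    then have "ennreal (Ainf w) = terminal_value A w" by (simp add: Ainf_def less_top)
    then show ?case using elim by simp
  qed
qed

lemma pseudo_imp_terminal:
  assumes "pseudo_stopping_time M F \<rho>"
  shows "AE w in M. terminal_value A w = 1"
proof (rule terminal_one_if_square)
  have "E(\<lambda>w. \<mu> (r w) w) = E(\<lambda>w. \<mu> 0 w)"
    using assms mu_H1 by (auto simp: pseudo_stopping_time_def value_at_rho)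
  also have "\<dots> = E(\<lambda>w. 1)"
    by (rule integral_cong_AE) (use mu_initial adaptedM[OF mu_adapted, of 0] in auto)
  finally have one: "E(\<lambda>w. \<mu> (r w) w) = 1" by (simp add: prob_space)
  have [measurable]: "(\<lambda>w. \<mu> (r w) w) \<in> borel_measurable M" by (rule value_meas[OF mu_adapted mu_cadlag])
  \<comment> \<open>\<open>martingale_value\<close> works up to a finite positive horizon;
    domination by 1 + A_\<infinity> lets the horizon tend to infinity.\<close>
  have "(\<lambda>n. E(\<lambda>w. \<mu> (r w) w * indicator {..real (Suc n)} (r w))) \<longlonglongrightarrow> E(\<lambda>w. \<mu> (r w) w)"
  proof (rule integral_dominated_convergence[where w = "\<lambda>w. 1 + Ainf w"])
    have "(\<lambda>n. \<mu> (r w) w * indicator {..real (Suc n)} (r w)) \<longlonglongrightarrow> \<mu> (r w) w" for w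
    proof (rule tendsto_eventually)
      obtain m :: nat where m: "r w \<le> real m" using real_arch_simple by blast
      show "\<forall>\<^sub>F n in sequentially. \<mu> (r w) w * indicator {..real (Suc n)} (r w) = \<mu> (r w) w"
        using eventually_ge_at_top[of m] by eventually_elim (use m in auto)
    qed
    then show "AE w in M. (\<lambda>n. \<mu> (r w) w * indicator {..real (Suc n)} (r w)) \<longlonglongrightarrow> \<mu> (r w) w" by simp
    show "AE w in M. norm (\<mu> (r w) w * indicator {..real (Suc n)} (r w)) \<le> 1 + Ainf w" for n
      using mu_bounds
    proof eventually_elim
      case (elim w)
      then have "\<bar>\<mu> (r w) w\<bar> \<le> 1 + Ainf w" using r_nonneg by blast
      then show ?case using Ainf_nonneg[of w] by (simp add: indicator_def)
    qed
    show "integrable M (\<lambda>w. 1 + Ainf w)" using Ainf_integrable by simp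
  qed measurable
  moreover have "E(\<lambda>w. \<mu> (r w) w * indicator {..real (Suc n)} (r w)) = E(\<lambda>w. A (real (Suc n)) w * Ainf w)" for n
    using martingale_value(2)[OF mu_martingale, of "real (Suc n)"] A_mult_integrable(2)[of "real (Suc n)"]
      A_mu_expectation[of "real (Suc n)"] by (simp del: of_nat_Suc)
  ultimately have "(\<lambda>n. E(\<lambda>w. A (real (Suc n)) w * Ainf w)) \<longlonglongrightarrow> 1" using one by (simp del: of_nat_Suc)
  from LIMSEQ_unique[OF this LIMSEQ_Suc[OF A_Ainf_tendsto]] show "E(\<lambda>w. (Ainf w)\<^sup>2) = 1" by simp
qed

text \<open>Weighting by A_n gives E[A_n A_\<infinity>] = E[A_n \<mu>_n] = E[A_n]; in the limit
  E[A_\<infinity>^2] = E[A_\<infinity>] = 1.\<close>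

lemma mu_one_imp_terminal:
  assumes "AE w in M. \<forall>t\<ge>0. \<mu> t w = 1"
  shows "AE w in M. terminal_value A w = 1"
proof (rule terminal_one_if_square)
  have "E(\<lambda>w. A (real n) w * Ainf w) = E(\<lambda>w. indicator (space M) w * A (real n) w)" for n
  proof -
    have "E(\<lambda>w. A (real n) w * Ainf w) = E(\<lambda>w. A (real n) w * \<mu> (real n) w)"
      by (simp add: A_mu_expectation)
    also have "\<dots> = E(\<lambda>w. indicator (space M) w * A (real n) w)"
    proof (rule integral_cong_AE)
      show "AE w in M. A (real n) w * \<mu> (real n) w = indicator (space M) w * A (real n) w"
        using assms AE_space by eventually_elim simp
    qed (auto intro!: borel_measurable_times A_meas adaptedM[OF mu_adapted])
    finally show ?thesis .
  qed
  then have "E(\<lambda>w. (Ainf w)\<^sup>2) = E(\<lambda>w. indicator (space M) w * Ainf w)"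
    using A_Ainf_tendsto A_test_tendsto[OF sets.top] LIMSEQ_unique by auto
  also have "\<dots> = E(\<lambda>w. Ainf w)" by (intro Bochner_Integration.integral_cong) auto
  finally show "E(\<lambda>w. (Ainf w)\<^sup>2) = 1" by (simp add: Ainf_expectation)
qed

lemma terminal_imp_mu_one:
  assumes "AE w in M. terminal_value A w = 1"
  shows "AE w in M. \<forall>t\<ge>0. \<mu> t w = 1"
proof (rule AE_all_eq[OF mu_cadlag cadlag_const])
  fix t :: real assume t: "0 \<le> t"
  have A1: "AE w in M. Ainf w = 1" using assms by eventually_elim (simp add: Ainf_def)
  have "AE w in M. real_cond_exp M (F (ennreal t)) Ainf w = 1"
  proof (rule cond_exp_eqI[OF Ainf_integrable])
    fix C assume C: "C \<in> sets (F (ennreal t))"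
    then have [measurable]: "C \<in> sets M" using sets_F_subset by blast
    show "E(\<lambda>w. indicator C w * Ainf w) = E(\<lambda>w. indicator C w * 1)"
      by (rule integral_cong_AE) (use A1 in auto)
  qed auto
  moreover have "AE w in M. \<mu> t w = real_cond_exp M (F (ennreal t)) Ainf w"
    using mu_cp t by (simp add: cadlag_projection_def)
  ultimately show "AE w in M. \<mu> t w = 1" by eventually_elim simp
qed

end

section \<open>Stopped martingales in the enlarged filtration\<close>

lemma cadlag_stopped:
  assumes X: "cadlag M X" shows "cadlag M (stopped X T)"
  unfolding cadlag_def stopped_def
proof (intro ballI conjI allI impI)
  fix w and t :: real assume w: "w \<in> space M"
  { assume t: "0 \<le> t"
    show "continuous (at_right t) (\<lambda>s. X (enn2real (min (ennreal s) (T w))) w)"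
    proof (cases "ennreal t < T w")
      case True
      obtain u where u: "t < u" "ennreal u \<le> T w"
      proof (cases "T w")
        case (real c) with True t show ?thesis by (intro that[of c]) (auto simp: ennreal_less_iff)
      next
        case top then show ?thesis by (intro that[of "t + 1"]) auto
      qed
      have e: "enn2real (min (ennreal s) (T w)) = s" if "0 \<le> s" "s < u" for s
        using that order_trans[OF ennreal_leI[of s u] u(2)] by (simp add: min_absorb1)
      have "\<forall>\<^sub>F s in at_right t. X s w = X (enn2real (min (ennreal s) (T w))) w"
        using eventually_at_right_real[OF u(1)] by eventually_elim (use t in \<open>auto simp: e\<close>)
      moreover have "((\<lambda>s. X s w) \<longlongrightarrow> X t w) (at_right t)"
        using cadlag_rightD[OF X w t] by (simp add: continuous_within)
      ultimately show ?thesis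
        unfolding continuous_within e[OF t u(1)] by (rule Lim_transform_eventually[rotated])
    next
      case False
      have "min (ennreal s) (T w) = T w" if "t \<le> s" for s
        using False ennreal_leI[OF that] by (simp add: min_absorb2 not_less)
      then have "\<forall>\<^sub>F s in at_right t. X (enn2real (min (ennreal s) (T w))) w = X (enn2real (min (ennreal t) (T w))) w"
        unfolding eventually_at_filter by (intro always_eventually) simp
      then show ?thesis unfolding continuous_within by (rule tendsto_eventually)
    qed }
  assume t: "0 < t"
  show "\<exists>l. ((\<lambda>s. X (enn2real (min (ennreal s) (T w))) w) \<longlongrightarrow> l) (at_left t)"
  proof (cases "ennreal t \<le> T w")
    case True
    have "\<forall>\<^sub>F s in at_left t. X s w = X (enn2real (min (ennreal s) (T w))) w"
      using eventually_at_left_real[OF t]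
    proof eventually_elim
      case (elim s)
      then have "ennreal s \<le> T w" by (intro order_trans[OF ennreal_leI True]) simp
      then show ?case using elim by (simp add: min_absorb1)
    qed
    moreover obtain l where "((\<lambda>s. X s w) \<longlongrightarrow> l) (at_left t)"
      using X w t unfolding cadlag_def by blast
    ultimately show ?thesis by (blast intro: Lim_transform_eventually)
  next
    case False
    then obtain c where c: "T w = ennreal c" "0 \<le> c" "c < t"
      by (cases "T w") (auto simp: not_le ennreal_less_iff)
    have "\<forall>\<^sub>F s in at_left t. X (enn2real (min (ennreal s) (T w))) w = X c w"
      using eventually_at_left_real[OF c(3)]
    proof eventually_elim
      case (elim s)
      then have "ennreal c \<le> ennreal s" by (intro ennreal_leI) auto
      then show ?case using c by (simp add: min_absorb2)
    qed
    then show ?thesis by (intro exI tendsto_eventually)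
  qed
qed

lemma (in usual_filtration) restart_martingale:
  assumes X: "martingale M F X" and s: "0 \<le> s" and C: "C \<in> sets (F (ennreal s))"
  shows "martingale M F (\<lambda>t w. indicator C w * (X (max t s) w - X s w))"
proof (rule martingaleI)
  have ad: "adapted F X" and cX: "cadlag M X" and Xi: "\<And>t. 0 \<le> t ==> integrable M (X t)"
    using X by (auto simp: martingale_def)
  have CM: "C \<in> sets M" using C sets_F_subset by blast
  show "adapted F (\<lambda>t w. indicator C w * (X (max t s) w - X s w))"
    unfolding adapted_def
  proof (intro allI impI)
    fix t :: real assume t: "0 \<le> t"
    show "(\<lambda>w. indicator C w * (X (max t s) w - X s w)) \<in> borel_measurable (F (ennreal t))"
    proof (cases "t \<le> s")
      case False
      then have "C \<in> sets (F (ennreal t))" using C sets_F_mono[of "ennreal s" "ennreal t"] by (auto simp: ennreal_leI)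
      then show ?thesis using adaptedD[OF ad, of t t] adaptedD[OF ad s, of t] t False by (simp add: max_def)
    qed (simp add: max_def)
  qed
  \<comment> \<open>For t \<ge> 0 the increment X (max t s) - X s equals X t - X (min t s), and the
    second form is a difference of \<open>X\<close> and a stopped process.\<close>
  have "cadlag M (\<lambda>t w. indicator C w * (X t w - stopped X (\<lambda>_. ennreal s) t w))"
    by (rule cadlag_mult[OF cadlag_const cadlag_diff[OF cX cadlag_stopped[OF cX]]])
  then show "cadlag M (\<lambda>t w. indicator C w * (X (max t s) w - X s w))"
  proof (rule cadlag_cong)
    show "indicator C w * (X t w - stopped X (\<lambda>_. ennreal s) t w) = indicator C w * (X (max t s) w - X s w)"
      if "0 \<le> t" for t w
      using that s by (auto simp: stopped_def min_def max_def ennreal_le_iff2)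
  qed
  have iD: "integrable M (\<lambda>w. indicator D w * X t w)" if "0 \<le> t" "D \<in> sets M" for D t
    using integrable_mult_indicator[OF that(2) Xi[OF that(1)]] by simp
  show "integrable M (\<lambda>w. indicator C w * (X (max t s) w - X s w))" if "0 \<le> t" for t
    unfolding right_diff_distrib using s CM that by (intro Bochner_Integration.integrable_diff iD) auto
  fix a b :: real and D assume ab: "0 \<le> a" "a \<le> b" and D: "D \<in> sets (F (ennreal a))"
  have a': "0 \<le> max a s" "max a s \<le> max b s" using ab s by auto
  have DC: "D \<inter> C \<in> sets (F (ennreal (max a s)))"
    using C D sets_F_mono[of "ennreal s" "ennreal (max a s)"] sets_F_mono[of "ennreal a" "ennreal (max a s)"]
    by (intro sets.Int) (auto simp: ennreal_leI)
  then have DCM: "D \<inter> C \<in> sets M" using sets_F_subset by blast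
  have e: "E(\<lambda>w. indicator D w * (indicator C w * (X u w - X s w)))
     = E(\<lambda>w. indicator (D \<inter> C) w * X u w) - E(\<lambda>w. indicator (D \<inter> C) w * X s w)" if "0 \<le> u" for u
  proof -
    have "E(\<lambda>w. indicator D w * (indicator C w * (X u w - X s w)))
      = E(\<lambda>w. indicator (D \<inter> C) w * X u w - indicator (D \<inter> C) w * X s w)"
      by (intro Bochner_Integration.integral_cong refl) (simp add: indicator_def)
    then show ?thesis using Bochner_Integration.integral_diff[OF iD[OF that DCM] iD[OF s DCM]] by simp
  qed
  have "(indicator (D \<inter> C) :: 'a \<Rightarrow> real) \<in> borel_measurable (F (ennreal (max a s)))" using DC by measurable
  from martingale_test(2)[OF X a' this iD[OF _ DCM]] a'
  have "E(\<lambda>w. indicator (D \<inter> C) w * X (max b s) w) = E(\<lambda>w. indicator (D \<inter> C) w * X (max a s) w)" by simp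
  then show "E(\<lambda>w. indicator D w * (indicator C w * (X (max b s) w - X s w)))
     = E(\<lambda>w. indicator D w * (indicator C w * (X (max a s) w - X s w)))"
    using a' by (simp add: e)
qed

section \<open>An explicit enlargement that bounds the progressive one\<close>

lemma not_less_infinity: "\<not> t < \<infinity> ==> t = (\<infinity> :: ennreal)"
  by (cases t) auto

text \<open>The events that agree on \<open>{t < \<rho>}\<close> with an event of \<open>F\<^sub>t\<close> form an enlargement of \<open>F\<close>, hence contain
  the minimal one.\<close>

definition trace_sets :: "'a measure \<Rightarrow> (ennreal \<Rightarrow> 'a measure) \<Rightarrow> ('a \<Rightarrow> ennreal) \<Rightarrow> ennreal \<Rightarrow> 'a set set" where
  "trace_sets M F \<rho> t = {B \<in> sets M. \<exists>C\<in>sets (F t). \<forall>w\<in>space M. t < \<rho> w \<longrightarrow> (w \<in> B \<longleftrightarrow> w \<in> C)}"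

text \<open>At \<infinity> the condition defining \<open>trace_sets\<close> is vacuous and would
  give all of \<open>sets M\<close>; the usual conditions ask instead for the \<sigma>-algebra
  generated by the finite times.\<close>

definition trace_filtration :: "'a measure \<Rightarrow> (ennreal \<Rightarrow> 'a measure) \<Rightarrow> ('a \<Rightarrow> ennreal) \<Rightarrow> ennreal \<Rightarrow> 'a measure" where
  "trace_filtration M F \<rho> t = sigma (space M) (if t < \<infinity> then trace_sets M F \<rho> t else (\<Union>u\<in>{..<\<infinity>}. trace_sets M F \<rho> u))"

context dual_projection begin

abbreviation "TS \<equiv> trace_sets M F \<rho>"
abbreviation "TF \<equiv> trace_filtration M F \<rho>"

lemma TS_subset: "TS t \<subseteq> sets M" by (auto simp: trace_sets_def)

lemma TS_sigma: "sigma_algebra (space M) (TS t)"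
  unfolding sigma_algebra_iff2
proof (intro conjI ballI allI impI)
  show "TS t \<subseteq> Pow (space M)" using TS_subset sets.space_closed by (rule order_trans)
  show "{} \<in> TS t" unfolding trace_sets_def by (auto intro!: bexI[of _ "{}"])
  fix B assume "B \<in> TS t"
  then obtain C where "B \<in> sets M" "C \<in> sets (F t)" "\<forall>w\<in>space M. t < \<rho> w \<longrightarrow> (w \<in> B \<longleftrightarrow> w \<in> C)"
    by (auto simp: trace_sets_def)
  moreover from this have "space M - C \<in> sets (F t)" using sets.compl_sets[of C "F t"] by (simp add: space_F)
  ultimately show "space M - B \<in> TS t"
    unfolding trace_sets_def by (intro CollectI conjI bexI[of _ "space M - C"]) auto
next
  fix B :: "nat \<Rightarrow> 'a set" assume B: "range B \<subseteq> TS t"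
  have "\<forall>n. \<exists>C. C \<in> sets (F t) \<and> (\<forall>w\<in>space M. t < \<rho> w \<longrightarrow> (w \<in> B n \<longleftrightarrow> w \<in> C))"
    using B unfolding trace_sets_def by blast
  from choice[OF this] obtain C where C: "\<forall>n. C n \<in> sets (F t) \<and> (\<forall>w\<in>space M. t < \<rho> w \<longrightarrow> (w \<in> B n \<longleftrightarrow> w \<in> C n))" ..
  have "(\<Union>n. B n) \<in> sets M" using B TS_subset by blast
  moreover have "(\<Union>n. C n) \<in> sets (F t)" using C by blast
  ultimately show "(\<Union>n. B n) \<in> TS t"
    unfolding trace_sets_def using C by (intro CollectI conjI bexI[of _ "\<Union>n. C n"]) auto
qed

lemma TS_Pow: "TS t \<subseteq> Pow (space M)"
  using TS_subset sets.space_closed by (rule order_trans)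

lemma space_TF: "space (TF t) = space M"
proof -
  have "(if t < \<infinity> then TS t else (\<Union>u\<in>{..<\<infinity>}. TS u)) \<subseteq> Pow (space M)"
    using TS_Pow by (simp add: UN_least)
  then show ?thesis unfolding trace_filtration_def by (rule space_measure_of)
qed

lemma sets_TF: "t < \<infinity> ==> sets (TF t) = TS t"
  unfolding trace_filtration_def using sigma_algebra.sets_measure_of_eq[OF TS_sigma] by simp

lemma sets_TF_inf: "sets (TF \<infinity>) = sigma_sets (space M) (\<Union>u\<in>{..<\<infinity>}. TS u)"
proof -
  have "(\<Union>u\<in>{..<\<infinity>}. TS u) \<subseteq> Pow (space M)" using TS_Pow by (simp add: UN_least)
  from sets_measure_of[OF this] show ?thesis unfolding trace_filtration_def by simp
qed

lemma TS_mono: assumes st: "s \<le> t" shows "TS s \<subseteq> TS t"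
proof
  fix B assume "B \<in> TS s"
  then obtain C where C: "B \<in> sets M" "C \<in> sets (F s)" "\<forall>w\<in>space M. s < \<rho> w \<longrightarrow> (w \<in> B \<longleftrightarrow> w \<in> C)"
    unfolding trace_sets_def by blast
  have "C \<in> sets (F t)" using C(2) sets_F_mono[OF st] by (rule rev_subsetD)
  moreover have "\<forall>w\<in>space M. t < \<rho> w \<longrightarrow> (w \<in> B \<longleftrightarrow> w \<in> C)"
    using C(3) le_less_trans[OF st] by simp
  ultimately show "B \<in> TS t" unfolding trace_sets_def using C(1) by (intro CollectI conjI bexI)
qed

lemma TF_mono: assumes st: "s \<le> t" shows "sets (TF s) \<subseteq> sets (TF t)"
proof (cases "t < \<infinity>")
  case True
  then show ?thesis unfolding sets_TF[OF True] sets_TF[OF le_less_trans[OF st True]] by (intro TS_mono[OF st])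
next
  case False
  then have t: "t = \<infinity>" by (rule not_less_infinity)
  show ?thesis
  proof (cases "s < \<infinity>")
    case True
    then show ?thesis unfolding t sets_TF_inf sets_TF[OF True] by (auto intro!: sigma_sets.Basic)
  next
    case False
    then have "s = \<infinity>" by (rule not_less_infinity)
    then show ?thesis using t by simp
  qed
qed

text \<open>For u_n decreasing to t choose C_n in F(u_n) that agrees with B on {u_n < \<rho>}. The
  upper limit of the C_n belongs to F(v) for every v > t, hence to F(t), and at each point of {t <
  \<rho>} membership in B and in C_n agree for all large n.\<close>

lemma TF_right_cont:
  assumes t: "t < \<infinity>" and B: "\<And>u. t < u ==> B \<in> sets (TF u)"
  shows "B \<in> sets (TF t)"
proof -
  obtain s where s: "t = ennreal s" "0 \<le> s" using t by (cases t) auto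
  define u where "u n = ennreal (s + 1 / real (Suc n))" for n
  have u: "t < u n" "u n < \<infinity>" for n
  proof -
    have "s < s + 1 / real (Suc n)" by simp
    then show "t < u n" "u n < \<infinity>" using s by (auto simp: u_def ennreal_less_iff)
  qed
  have "(\<lambda>n. s + 1 / real (Suc n)) \<longlonglongrightarrow> s + 0"
    by (intro tendsto_add tendsto_const LIMSEQ_Suc[OF lim_const_over_n])
  then have ulim: "u \<longlonglongrightarrow> t" unfolding u_def s by (intro tendsto_ennrealI) simp
  have "\<forall>n. \<exists>C. C \<in> sets (F (u n)) \<and> (\<forall>w\<in>space M. u n < \<rho> w \<longrightarrow> (w \<in> B \<longleftrightarrow> w \<in> C))"
    using B[OF u(1)] unfolding sets_TF[OF u(2)] trace_sets_def by blast
  from choice[OF this] obtain C where C: "\<forall>n. C n \<in> sets (F (u n)) \<and> (\<forall>w\<in>space M. u n < \<rho> w \<longrightarrow> (w \<in> B \<longleftrightarrow> w \<in> C n))" ..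
  define L where "L = (\<Inter>m. \<Union>n\<in>{m..}. C n)"
  have "L \<in> sets (F t)"
  proof (rule right_cont_F[OF t])
    fix v assume "t < v"
    then obtain m0 where m0: "\<And>n. m0 \<le> n ==> u n < v"
      using order_tendstoD(2)[OF ulim] unfolding eventually_sequentially by blast
    have "C n \<in> sets (F v)" if "m0 \<le> n" for n
      using C sets_F_mono[of "u n" v] less_imp_le[OF m0[OF that]] by blast
    \<comment> \<open>Dropping the first \<open>m0\<close> sets leaves the upper limit unchanged,
      and all remaining ones lie in \<open>F v\<close>.\<close>
    then have "(\<Inter>m. \<Union>n\<in>{m0 + m..}. C n) \<in> sets (F v)"
      by (intro sets.countable_INT' sets.countable_UN') auto
    also have "(\<Inter>m. \<Union>n\<in>{m0 + m..}. C n) = L"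
    proof (intro equalityI subsetI)
      fix x assume x: "x \<in> (\<Inter>m. \<Union>n\<in>{m0 + m..}. C n)"
      show "x \<in> L" unfolding L_def
      proof
        fix m
        from x obtain n where "m0 + m \<le> n" "x \<in> C n" by auto
        then show "x \<in> (\<Union>n\<in>{m..}. C n)" by (auto intro!: bexI[of _ n])
      qed
    qed (auto simp: L_def)
    finally show "L \<in> sets (F v)" .
  qed
  moreover have "w \<in> B \<longleftrightarrow> w \<in> L" if w: "w \<in> space M" "t < \<rho> w" for w
  proof -
    obtain m0 where m0: "\<And>n. m0 \<le> n ==> u n < \<rho> w"
      using order_tendstoD(2)[OF ulim w(2)] unfolding eventually_sequentially by blast
    have *: "w \<in> B \<longleftrightarrow> w \<in> C n" if "m0 \<le> n" for n using C w(1) m0[OF that] by blast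
    show ?thesis
    proof
      assume "w \<in> B"
      then have "w \<in> C (max m0 m)" for m using * by simp
      then show "w \<in> L" unfolding L_def by (meson INT_I UN_I atLeast_iff max.cobounded2)
    next
      assume "w \<in> L"
      then obtain n where "m0 \<le> n" "w \<in> C n" unfolding L_def by blast
      then show "w \<in> B" using * by blast
    qed
  qed
  moreover have "B \<in> sets M" using B[OF u(1)[of 0]] sets_TF[OF u(2)[of 0]] TS_subset by blast
  ultimately show ?thesis unfolding sets_TF[OF t] trace_sets_def by blast
qed

lemma F_subset_TF: "sets (F t) \<subseteq> sets (TF t)"
proof (cases "t < \<infinity>")
  case True
  then show ?thesis unfolding sets_TF[OF True] trace_sets_def using sets_F_subset by blast
next
  case False
  then have t: "t = \<infinity>" by (rule not_less_infinity)
  have "sets (F \<infinity>) = sigma_sets (space M) (\<Union>t\<in>{..<\<infinity>}. sets (F t))"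
    using usual unfolding usual_conditions_def by (elim conjE)
  also have "\<dots> \<subseteq> sets (TF \<infinity>)"
    unfolding sets_TF_inf
    by (rule sigma_sets_mono') (use sets_F_subset in \<open>unfold trace_sets_def, blast\<close>)
  finally show ?thesis using t by simp
qed

lemma TF_enlargement: "enlargement M F \<rho> TF"
  unfolding enlargement_def usual_conditions_def
proof (intro conjI allI impI)
  show "complete_measure M" by (rule complete)
  show "filtration (space M) TF" by unfold_locales (rule space_TF, rule TF_mono)
  show "subalgebra M (TF t)" for t
    unfolding subalgebra_def
  proof
    show "sets (TF t) \<subseteq> sets M"
    proof (cases "t < \<infinity>")
      case True then show ?thesis using sets_TF TS_subset by simp
    next
      case False
      then have "t = \<infinity>" by (rule not_less_infinity)
      then show ?thesis using sets_TF_inf TS_subset sets.sigma_sets_subset[of "\<Union>u\<in>{..<\<infinity>}. TS u" M] by auto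
    qed
  qed (rule space_TF)
  show "null_sets M \<subseteq> sets (TF 0)" using null_in_F F_subset_TF by blast
  show "sets (TF t) = (\<Inter>u\<in>{t<..}. sets (TF u))" if "t < \<infinity>" for t
  proof (intro equalityI subsetI)
    fix B assume "B \<in> sets (TF t)"
    then show "B \<in> (\<Inter>u\<in>{t<..}. sets (TF u))" using TF_mono[OF less_imp_le] by blast
  next
    fix B assume "B \<in> (\<Inter>u\<in>{t<..}. sets (TF u))"
    then show "B \<in> sets (TF t)" by (intro TF_right_cont[OF that]) blast
  qed
  show "sets (TF \<infinity>) = sigma_sets (space M) (\<Union>t\<in>{..<\<infinity>}. sets (TF t))"
    unfolding sets_TF_inf by (intro arg_cong2[where f = sigma_sets] refl SUP_cong) (simp add: sets_TF)
  show "sets (F t) \<subseteq> sets (TF t)" for t by (rule F_subset_TF)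
  show "stopping_time TF \<rho>"
    unfolding stopping_time_def pred_def
  proof
    fix t :: ennreal
    show "{w \<in> space (TF t). \<rho> w \<le> t} \<in> sets (TF t)"
    proof (cases "t < \<infinity>")
      case True
      have "{w \<in> space M. \<rho> w \<le> t} \<in> sets M" using rho_meas by measurable
      \<comment> \<open>No point of {t < \<rho>} satisfies \<rho> \<le> t, so the empty set is the
        required trace.\<close>
      then show ?thesis unfolding sets_TF[OF True] space_TF trace_sets_def
        by (intro CollectI conjI bexI[of _ "{}"]) auto
    next
      case False
      then have "t = \<infinity>" by (rule not_less_infinity)
      then have "{w \<in> space (TF t). \<rho> w \<le> t} = space (TF t)" by auto
      then show ?thesis by simp
    qed
  qed
qed

end

section \<open>Integrable majorants and trivial localization\<close>

lemma SUP_dyadics: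
  fixes f :: "real \<Rightarrow> real"
  assumes rc: "\<And>t. 0 \<le> t ==> continuous (at_right t) f"
  shows "(SUP t\<in>{0..}. ennreal \<bar>f t\<bar>) = (SUP t\<in>dyadics. ennreal \<bar>f t\<bar>)"
proof (rule antisym)
  show "(SUP t\<in>{0..}. ennreal \<bar>f t\<bar>) \<le> (SUP t\<in>dyadics. ennreal \<bar>f t\<bar>)"
  proof (rule SUP_least)
    fix t :: real assume "t \<in> {0..}"
    then have t: "0 \<le> t" by simp
    have "(\<lambda>n. ennreal \<bar>f (dyadic_above n t)\<bar>) \<longlonglongrightarrow> ennreal \<bar>f t\<bar>"
      by (intro tendsto_ennrealI tendsto_rabs right_continuous_dyadic_seq[OF t] rc t)
    then show "ennreal \<bar>f t\<bar> \<le> (SUP t\<in>dyadics. ennreal \<bar>f t\<bar>)"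
      by (rule LIMSEQ_le_const2) (auto intro!: exI[of _ 0] SUP_upper dyadic_above_in)
  qed
  show "(SUP t\<in>dyadics. ennreal \<bar>f t\<bar>) \<le> (SUP t\<in>{0..}. ennreal \<bar>f t\<bar>)"
    by (rule SUP_subset_mono) (auto dest: dyadics_nonneg)
qed

context usual_filtration begin

text \<open>The majorant is the supremum of the path; it is measurable because right continuity
  reduces it to the dyadic times.\<close>

lemma H1_dominated:
  assumes X: "H1_martingale M F X"
  obtains D where "integrable M D" "AE w in M. \<forall>t\<ge>0. \<bar>X t w\<bar> \<le> D w"
proof
  have ad: "adapted F X" and cX: "cadlag M X" using X by (auto simp: H1_martingale_def martingale_def)
  define s where "s w = (SUP t\<in>{0..}. ennreal \<bar>X t w\<bar>)" for w
  have fin: "(\<integral>\<^sup>+w. s w \<partial>M) < \<infinity>" using X by (simp add: H1_martingale_def s_def)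
  have sm [measurable]: "s \<in> borel_measurable M"
  proof -
    have "(\<lambda>w. SUP t\<in>dyadics. ennreal \<bar>X t w\<bar>) \<in> borel_measurable M"
      by (intro borel_measurable_SUP countable_dyadics)
         (use adaptedM[OF ad dyadics_nonneg] in \<open>auto intro!: measurable_compose[OF _ measurable_ennreal] borel_measurable_abs\<close>)
    then show ?thesis
      by (rule measurable_cong[THEN iffD1, rotated])
         (simp add: s_def SUP_dyadics[OF cadlag_rightD[OF cX]])
  qed
  have sfin: "AE w in M. s w \<noteq> \<infinity>"
    by (rule nn_integral_PInf_AE) (use fin in auto)
  have e: "AE w in M. ennreal (enn2real (s w)) = s w"
    using sfin by eventually_elim (simp add: less_top)
  show "integrable M (\<lambda>w. enn2real (s w))"
  proof (rule integrableI_nonneg)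
    have "(\<integral>\<^sup>+w. ennreal (enn2real (s w)) \<partial>M) = (\<integral>\<^sup>+w. s w \<partial>M)"
      by (rule nn_integral_cong_AE[OF e])
    then show "(\<integral>\<^sup>+w. ennreal (enn2real (s w)) \<partial>M) < \<infinity>" using fin by simp
  qed auto
  show "AE w in M. \<forall>t\<ge>0. \<bar>X t w\<bar> \<le> enn2real (s w)"
    using e
  proof eventually_elim
    case (elim w)
    have "ennreal \<bar>X t w\<bar> \<le> s w" if "0 \<le> t" for t
      unfolding s_def by (rule SUP_upper) (use that in simp)
    then have "ennreal \<bar>X t w\<bar> \<le> ennreal (enn2real (s w))" if "0 \<le> t" for t
      using that by (simp only: elim)
    then show ?case by simp
  qed
qed

lemma martingale_imp_local:
  assumes X: "martingale M F X" shows "local_martingale M F X"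
  unfolding local_martingale_def
proof (intro conjI exI[of _ "\<lambda>_ _. \<infinity>"] allI)
  have ad: "adapted F X" and cX: "cadlag M X" and Xi: "\<And>t. 0 \<le> t ==> integrable M (X t)"
    using X by (auto simp: martingale_def)
  show "adapted F X" "cadlag M X" by fact+
  show "stopping_time F (\<lambda>_. \<infinity>)" by (rule stopping_time_const)
  show "AE w in M. incseq (\<lambda>_. \<infinity> :: ennreal) \<and> (\<lambda>_. \<infinity> :: ennreal) \<longlonglongrightarrow> \<infinity>" by (simp add: incseq_def)
  have e: "stopped X (\<lambda>_. \<infinity>) t w = X t w" if "0 \<le> t" for t w
    using that by (simp add: stopped_def)
  show "martingale M F (\<lambda>t w. stopped X (\<lambda>_. \<infinity>) t w - X 0 w)"
  proof (rule martingaleI)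
    show "adapted F (\<lambda>t w. stopped X (\<lambda>_. \<infinity>) t w - X 0 w)"
      unfolding adapted_def
    proof (intro allI impI)
      fix t :: real assume t: "0 \<le> t"
      show "(\<lambda>w. stopped X (\<lambda>_. \<infinity>) t w - X 0 w) \<in> borel_measurable (F (ennreal t))"
        unfolding e[OF t] by (intro borel_measurable_diff adaptedD[OF ad] t order_refl)
    qed
    show "cadlag M (\<lambda>t w. stopped X (\<lambda>_. \<infinity>) t w - X 0 w)"
      by (rule cadlag_diff[OF cadlag_stopped[OF cX] cadlag_const])
    show "integrable M (\<lambda>w. stopped X (\<lambda>_. \<infinity>) t w - X 0 w)" if "0 \<le> t" for t
      unfolding e[OF that] by (intro Bochner_Integration.integrable_diff Xi that order_refl)
    fix s t :: real and C assume st: "0 \<le> s" "s \<le> t" and C: "C \<in> sets (F (ennreal s))"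
    have CM: "C \<in> sets M" using C sets_F_subset by blast
    have i: "integrable M (\<lambda>w. indicator C w * X u w)" if "0 \<le> u" for u
      using integrable_mult_indicator[OF CM Xi[OF that]] by simp
    have t: "0 \<le> t" using st by simp
    have "E(\<lambda>w. indicator C w * X s w) = E(\<lambda>w. indicator C w * X t w)"
      by (rule martingale_test(2)[OF X st _ i[OF t]]) (use C in measurable)
    then show "E(\<lambda>w. indicator C w * (stopped X (\<lambda>_. \<infinity>) t w - X 0 w)) =
      E(\<lambda>w. indicator C w * (stopped X (\<lambda>_. \<infinity>) s w - X 0 w))"
      using Bochner_Integration.integral_diff[OF i[OF t] i[of 0]] Bochner_Integration.integral_diff[OF i[OF st(1)] i[of 0]]
      unfolding e[OF st(1)] e[OF t] by (simp add: right_diff_distrib)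
  qed
qed

end

section \<open>Stopping at the random time in the progressive enlargement\<close>

locale enlarged = azema M F \<rho> A Z \<mu> for M :: "'a measure" and F \<rho> A Z \<mu> +
  fixes G :: "ennreal \<Rightarrow> 'a measure"
  assumes enl: "progressive_enlargement M F \<rho> G"
begin

sublocale G: usual_filtration M G
  using enl by unfold_locales (simp add: progressive_enlargement_def enlargement_def)

lemma F_subset_G: "sets (F t) \<subseteq> sets (G t)"
  using enl unfolding progressive_enlargement_def enlargement_def by blast

lemma rho_stopping: "stopping_time G \<rho>"
  using enl unfolding progressive_enlargement_def enlargement_def by blast

lemma G_trace:
  assumes "B \<in> sets (G (ennreal s))"
  obtains C where "C \<in> sets (F (ennreal s))" "\<And>w. w \<in> space M ==> ennreal s < \<rho> w ==> w \<in> B \<longleftrightarrow> w \<in> C"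
proof -
  have "sets (G (ennreal s)) \<subseteq> sets (TF (ennreal s))"
    using enl TF_enlargement unfolding progressive_enlargement_def by blast
  with assms have "B \<in> TS (ennreal s)" using sets_TF[of "ennreal s"] by auto
  then show ?thesis using that unfolding trace_sets_def by blast
qed

lemma G_adapted: "adapted F X ==> adapted G X"
  unfolding adapted_def using F_subset_G space_F G.space_F by (simp add: measurable_def) blast

lemma stopped_adapted:
  assumes ad: "adapted F X" and cX: "cadlag M X" shows "adapted G (stopped X \<rho>)"
  unfolding adapted_def
proof (intro allI impI)
  fix t :: real assume t: "0 \<le> t"
  let ?T = "\<lambda>w. enn2real (min (ennreal t) (\<rho> w))"
  have T: "?T w \<le> t" for w by (rule enn2real_leI) (use t in auto)
  have m: "(\<lambda>w. min (ennreal t) (\<rho> w)) \<in> borel_measurable (G (ennreal t))"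
  proof (rule borel_measurableI_le)
    fix a :: ennreal
    show "{w \<in> space (G (ennreal t)). min (ennreal t) (\<rho> w) \<le> a} \<in> sets (G (ennreal t))"
    proof (cases "ennreal t \<le> a")
      case True
      then have "{w \<in> space (G (ennreal t)). min (ennreal t) (\<rho> w) \<le> a} = space (G (ennreal t))"
        by (auto simp: min_le_iff_disj)
      then show ?thesis by simp
    next
      case False
      then have a: "a \<le> ennreal t" by simp
      have "{w \<in> space (G (ennreal t)). min (ennreal t) (\<rho> w) \<le> a} = {w \<in> space (G a). \<rho> w \<le> a}"
        using False by (auto simp: min_le_iff_disj G.space_F)
      also have "\<dots> \<in> sets (G a)" using rho_stopping by (simp add: stopping_time_def pred_def)
      finally show ?thesis using G.sets_F_mono[OF a] by blast
    qed
  qed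
  \<comment> \<open>The approximating times lie to the right of \<open>?T\<close> and may exceed
    \<open>t\<close>; freezing \<open>X\<close> at time \<open>t\<close> keeps every variable
    measurable at \<open>t\<close>.\<close>
  have "(\<lambda>w. X (min (?T w) t) w) \<in> borel_measurable (G (ennreal t))"
  proof (rule measurable_right_continuous_at[where X = "\<lambda>s. X (min s t)"])
    show "X (min s t) \<in> borel_measurable (G (ennreal t))" if "0 \<le> s" for s
      using that t by (intro G.adaptedD G_adapted ad) auto
    show "continuous (at_right s) (\<lambda>s. X (min s t) w)" if "w \<in> space (G (ennreal t))" "0 \<le> s" for s w
    proof -
      have "continuous (at_right s) (\<lambda>s. stopped X (\<lambda>_. ennreal t) s w)"
        using that cadlag_stopped[OF cX] by (intro cadlag_rightD) (auto simp: G.space_F)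
      moreover have "\<forall>\<^sub>F u in at_right s. stopped X (\<lambda>_. ennreal t) u w = X (min u t) w"
        unfolding eventually_at_filter using that(2) t
        by (intro always_eventually) (auto simp: stopped_def min_def ennreal_le_iff2)
      moreover have "stopped X (\<lambda>_. ennreal t) s w = X (min s t) w"
        using that(2) t by (auto simp: stopped_def min_def ennreal_le_iff2)
      ultimately show ?thesis
        unfolding continuous_within using Lim_transform_eventually by force
    qed
    show "?T \<in> borel_measurable (G (ennreal t))" using m by measurable
  qed simp
  then show "stopped X \<rho> t \<in> borel_measurable (G (ennreal t))"
    using T by (simp add: stopped_def[abs_def] min_absorb1)
qed

lemma stopped_AE: "0 \<le> t ==> AE w in M. stopped X \<rho> t w = X (min t (r w)) w"
  using rho_finite
proof eventually_elim
  case (elim w)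
  then have "\<rho> w = ennreal (r w)" by (simp add: r_def)
  then show ?case using elim by (auto simp: stopped_def min_def ennreal_le_iff2 r_nonneg)
qed

context
  assumes T1: "AE w in M. terminal_value A w = 1"
begin

text \<open>When A_\<infinity> = 1 the weight \<open>A t\<close> is at most 1, so
  \<open>A t * X t\<close> is integrable for every martingale and \<open>martingale_value\<close>
  applies. The part after \<open>t\<close> is weighted by \<open>Z t\<close>, and the two weights
  add up to 1.\<close>

lemma stopped_expectation:
  assumes X: "martingale M F X" and t: "0 \<le> t"
  shows "integrable M (\<lambda>w. X (min t (r w)) w)" "E(\<lambda>w. X (min t (r w)) w) = E(\<lambda>w. X 0 w)"
proof -
  have ad: "adapted F X" and cX: "cadlag M X" and Xi: "\<And>t. 0 \<le> t ==> integrable M (X t)"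
    using X by (auto simp: martingale_def)
  have "integrable M (\<lambda>w. X (min t (r w)) w) \<and> E(\<lambda>w. X (min t (r w)) w) = E(\<lambda>w. X 0 w)"
  proof (cases "t = 0")
    case True
    have "min t (r w) = 0" for w using True r_nonneg by simp
    then show ?thesis using Xi[of 0] by simp
  next
    case False
    with t have t': "0 < t" by simp
    note [measurable] = adaptedM[OF ad t] A_meas[OF t]
    have A1: "AE w in M. 0 \<le> A t w \<and> A t w \<le> 1"
      using T1 A_le_Ainf AE_space
    proof eventually_elim
      case (elim w)
      then have "Ainf w = 1" by (simp add: Ainf_def)
      then show ?case using elim A_nonneg[OF elim(3) t] t by auto
    qed
    have iA: "integrable M (\<lambda>w. A t w * X t w)"
    proof (rule Bochner_Integration.integrable_bound[OF Xi[OF t]])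
      show "AE w in M. norm (A t w * X t w) \<le> norm (X t w)"
        using A1 by eventually_elim (auto simp: abs_mult intro!: mult_left_le_one_le)
    qed measurable
    note V = martingale_value[OF X t' iA]
    note ZT = Z_test[OF t adaptedD[OF ad t order_refl] Xi[OF t]]
    have i2: "integrable M (\<lambda>w. X t w * indicator {t<..} (r w))"
      by (rule Bochner_Integration.integrable_bound[OF Xi[OF t]]) (auto simp: indicator_def)
    have e: "X (min t (r w)) w = X (r w) w * indicator {..t} (r w) + X t w * indicator {t<..} (r w)" for w
      by (auto simp: min_def indicator_def)
    have "E(\<lambda>w. X (min t (r w)) w) = E(\<lambda>w. A t w * X t w) + E(\<lambda>w. X t w * Z t w)"
      unfolding e Bochner_Integration.integral_add[OF V(1) i2] V(2) ZT(2) ..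
    also have "\<dots> = E(\<lambda>w. A t w * X t w + X t w * Z t w)"
      by (rule Bochner_Integration.integral_add[OF iA ZT(1), symmetric])
    also have "\<dots> = E(\<lambda>w. X t w)"
    proof (rule integral_cong_AE)
      show "AE w in M. A t w * X t w + X t w * Z t w = X t w"
        using mu_eq terminal_imp_mu_one[OF T1]
      proof eventually_elim
        case (elim w)
        then have "A t w + Z t w = 1" using t by auto
        then have "X t w * (A t w + Z t w) = X t w" by simp
        then show ?case by (simp add: distrib_left mult.commute)
      qed
    qed (use adaptedM[OF Z_adapted t] in measurable)
    also have "\<dots> = E(\<lambda>w. X 0 w)" by (rule martingale_expectation[OF X _ t, symmetric]) simp
    finally show ?thesis using Bochner_Integration.integrable_add[OF V(1) i2] by (simp only: e)
  qed
  then show "integrable M (\<lambda>w. X (min t (r w)) w)" "E(\<lambda>w. X (min t (r w)) w) = E(\<lambda>w. X 0 w)" by auto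
qed

lemma stopped_martingale:
  assumes X: "martingale M F X" shows "martingale M G (stopped X \<rho>)"
proof (rule G.martingaleI)
  have ad: "adapted F X" and cX: "cadlag M X" and Xi: "\<And>t. 0 \<le> t ==> integrable M (X t)"
    using X by (auto simp: martingale_def)
  show aG: "adapted G (stopped X \<rho>)" by (rule stopped_adapted[OF ad cX])
  show "cadlag M (stopped X \<rho>)" by (rule cadlag_stopped[OF cX])
  show iS: "integrable M (stopped X \<rho> t)" if "0 \<le> t" for t
  proof (rule integrable_cong_AE_imp[OF stopped_expectation(1)[OF X that] G.adaptedM[OF aG that]])
    show "AE w in M. X (min t (r w)) w = stopped X \<rho> t w"
      using stopped_AE[OF that, of X] by eventually_elim simp
  qed
  fix s t :: real and B assume st: "0 \<le> s" "s \<le> t" and B: "B \<in> sets (G (ennreal s))"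
  have t: "0 \<le> t" using st by simp
  have BM [measurable]: "B \<in> sets M" using B G.sets_F_subset by blast
  obtain C where C: "C \<in> sets (F (ennreal s))" "\<And>w. w \<in> space M ==> ennreal s < \<rho> w ==> w \<in> B \<longleftrightarrow> w \<in> C"
    by (rule G_trace[OF B]) blast
  let ?X = "\<lambda>u w. indicator C w * (X (max u s) w - X s w)"
  note X' = stopped_expectation[OF restart_martingale[OF X st(1) C(1)] t]
  have i: "integrable M (\<lambda>w. indicator B w * stopped X \<rho> u w)" if "0 \<le> u" for u
    using integrable_mult_indicator[OF BM iS[OF that]] by simp
  have "E(\<lambda>w. indicator B w * stopped X \<rho> t w) - E(\<lambda>w. indicator B w * stopped X \<rho> s w)
     = E(\<lambda>w. indicator B w * stopped X \<rho> t w - indicator B w * stopped X \<rho> s w)"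
    by (rule Bochner_Integration.integral_diff[OF i[OF t] i[OF st(1)], symmetric])
  also have "\<dots> = E(\<lambda>w. ?X (min t (r w)) w)"
  proof (rule integral_cong_AE)
    \<comment> \<open>On {s < \<rho>} the events \<open>B\<close> and \<open>C\<close> agree. On
      {\<rho> \<le> s} the stopped process has ceased to move and both sides are 0, whatever
      \<open>B\<close> is there.\<close>
    show "AE w in M. indicator B w * stopped X \<rho> t w - indicator B w * stopped X \<rho> s w = ?X (min t (r w)) w"
      using stopped_AE[OF t, of X] stopped_AE[OF st(1), of X] rho_finite AE_space
    proof eventually_elim
      case (elim w)
      then have rho: "\<rho> w = ennreal (r w)" by (simp add: r_def)
      show ?case
      proof (cases "s < r w")
        case True
        then have "ennreal s < \<rho> w" unfolding rho using st(1) by (simp add: ennreal_less_iff)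
        then have "indicator B w = (indicator C w :: real)" using C(2) elim(4) by (simp add: indicator_def)
        then show ?thesis using True st by (simp add: elim right_diff_distrib max_def min_def)
      next
        case False
        then have "min t (r w) = r w" "min s (r w) = r w" "max (r w) s = s" using st by auto
        then show ?thesis by (simp add: elim)
      qed
    qed
  qed (use i[OF t] i[OF st(1)] X'(1) in auto)
  also have "\<dots> = 0" using X'(2) st(1) by (simp add: max_def)
  finally show "E(\<lambda>w. indicator B w * stopped X \<rho> t w) = E(\<lambda>w. indicator B w * stopped X \<rho> s w)" by simp
qed

lemma stopped_local_martingale:
  assumes X: "local_martingale M F X" shows "local_martingale M G (stopped X \<rho>)"
proof -
  obtain \<tau> :: "nat \<Rightarrow> 'a \<Rightarrow> ennreal" where \<tau>: "\<And>n. stopping_time F (\<tau> n)"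
    "AE w in M. incseq (\<lambda>n. \<tau> n w) \<and> (\<lambda>n. \<tau> n w) \<longlonglongrightarrow> \<infinity>"
    "\<And>n. martingale M F (\<lambda>t w. stopped X (\<tau> n) t w - X 0 w)"
    using X unfolding local_martingale_def by blast
  have ad: "adapted F X" and cX: "cadlag M X" using X by (auto simp: local_martingale_def)
  show ?thesis
    unfolding local_martingale_def
  proof (intro conjI exI[of _ \<tau>] allI)
    show "adapted G (stopped X \<rho>)" by (rule stopped_adapted[OF ad cX])
    show "cadlag M (stopped X \<rho>)" by (rule cadlag_stopped[OF cX])
    show "stopping_time G (\<tau> n)" for n
      using \<tau>(1)[of n] F_subset_G unfolding stopping_time_def pred_def space_F G.space_F by blast
    show "AE w in M. incseq (\<lambda>n. \<tau> n w) \<and> (\<lambda>n. \<tau> n w) \<longlonglongrightarrow> \<infinity>" by (rule \<tau>(2))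
    fix n
    have fin: "ennreal (enn2real (min (ennreal t) x)) = min (ennreal t) x" for t x
      by (simp add: min_less_iff_disj)
    \<comment> \<open>Stopping at \<rho> and stopping at \<open>\<tau> n\<close> commute;
      \<open>fin\<close> removes the passage through the reals between them.\<close>
    have "stopped (\<lambda>t w. stopped X (\<tau> n) t w - X 0 w) \<rho> = (\<lambda>t w. stopped (stopped X \<rho>) (\<tau> n) t w - stopped X \<rho> 0 w)"
      by (intro ext) (simp add: stopped_def fin min.assoc min.commute[of "\<rho> _"])
    then show "martingale M G (\<lambda>t w. stopped (stopped X \<rho>) (\<tau> n) t w - stopped X \<rho> 0 w)"
      using stopped_martingale[OF \<tau>(3)[of n]] by simp
  qed
qed

end

text \<open>The stopped and localized process has constant mean, which gives the identity at the
  times n \<and> \<tau>_n \<and> \<rho>, here \<open>k n\<close>. Almost surely they equal \<rho>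
  from some n on, and the integrable majorant of \<open>X\<close> allows passage to the
  limit.\<close>

lemma local_imp_pseudo:
  assumes loc: "\<And>X. local_martingale M F X ==> local_martingale M G (stopped X \<rho>)"
  shows "pseudo_stopping_time M F \<rho>"
  unfolding pseudo_stopping_time_def value_at_rho
proof (intro allI impI)
  fix X assume H: "H1_martingale M F X"
  then have X: "martingale M F X" by (simp add: H1_martingale_def)
  have ad: "adapted F X" and cX: "cadlag M X" and Xi: "\<And>t. 0 \<le> t ==> integrable M (X t)"
    using X by (auto simp: martingale_def)
  obtain D where D: "integrable M D" "AE w in M. \<forall>t\<ge>0. \<bar>X t w\<bar> \<le> D w"
    by (rule H1_dominated[OF H])
  obtain \<tau> :: "nat \<Rightarrow> 'a \<Rightarrow> ennreal" where \<tau>: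
    "AE w in M. incseq (\<lambda>n. \<tau> n w) \<and> (\<lambda>n. \<tau> n w) \<longlonglongrightarrow> \<infinity>"
    "\<And>n. martingale M G (\<lambda>t w. stopped (stopped X \<rho>) (\<tau> n) t w - stopped X \<rho> 0 w)"
    using loc[OF martingale_imp_local[OF X]] unfolding local_martingale_def by blast
  define k where "k n w = enn2real (min (ennreal (enn2real (min (ennreal (real n)) (\<tau> n w)))) (\<rho> w))" for n w
  have N: "integrable M (\<lambda>w. X (k n w) w - X 0 w)" "E(\<lambda>w. X (k n w) w - X 0 w) = 0" for n
  proof -
    have e0: "stopped X \<rho> 0 w = X 0 w" for w by (simp add: stopped_def)
    have en: "stopped (stopped X \<rho>) (\<tau> n) (real n) w = X (k n w) w" for w
      by (simp add: stopped_def k_def)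
    show "integrable M (\<lambda>w. X (k n w) w - X 0 w)"
      using \<tau>(2)[of n] by (auto simp: martingale_def en e0 dest: spec[of _ "real n"])
    have "stopped (stopped X \<rho>) (\<tau> n) 0 w = X 0 w" for w by (simp add: stopped_def)
    then show "E(\<lambda>w. X (k n w) w - X 0 w) = 0"
      using G.martingale_expectation[OF \<tau>(2)[of n], of 0 "real n"] by (simp add: en e0)
  qed
  have rm: "(\<lambda>w. X (r w) w) \<in> borel_measurable M" by (rule value_meas[OF ad cX])
  have "(\<lambda>n. E(\<lambda>w. X (k n w) w - X 0 w)) \<longlonglongrightarrow> E(\<lambda>w. X (r w) w - X 0 w)"
  proof (rule integral_dominated_convergence[where w = "\<lambda>w. 2 * D w"])
    show "(\<lambda>w. X (r w) w - X 0 w) \<in> borel_measurable M"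
      using rm adaptedM[OF ad, of 0] by measurable
    show "(\<lambda>w. X (k n w) w - X 0 w) \<in> borel_measurable M" for n using N(1) by (rule borel_measurable_integrable)
    show "integrable M (\<lambda>w. 2 * D w)" using D(1) by simp
    show "AE w in M. norm (X (k n w) w - X 0 w) \<le> 2 * D w" for n
      using D(2)
    proof eventually_elim
      case (elim w)
      have "\<bar>X (k n w) w\<bar> \<le> D w" "\<bar>X 0 w\<bar> \<le> D w" using elim by (auto simp: k_def)
      then show ?case by simp
    qed
    show "AE w in M. (\<lambda>n. X (k n w) w - X 0 w) \<longlonglongrightarrow> X (r w) w - X 0 w"
      using \<tau>(1) rho_finite
    proof eventually_elim
      case (elim w)
      have "\<forall>\<^sub>F n in sequentially. \<rho> w < \<tau> n w"
        using order_tendstoD(1)[of "\<lambda>n. \<tau> n w" \<infinity> sequentially "\<rho> w"] elim by simp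
      moreover obtain m :: nat where m: "r w \<le> real m" using real_arch_simple by blast
      have "\<forall>\<^sub>F n in sequentially. \<rho> w \<le> ennreal (real n)"
        using eventually_ge_at_top[of m]
      proof eventually_elim
        case (elim n)
        have "\<rho> w = ennreal (r w)" using \<open>\<rho> w < \<infinity>\<close> by (simp add: r_def)
        then show ?case using m elim by (auto intro!: ennreal_leI)
      qed
      ultimately have "\<forall>\<^sub>F n in sequentially. X (k n w) w - X 0 w = X (r w) w - X 0 w"
      proof eventually_elim
        case (elim n)
        have "ennreal (enn2real (min (ennreal (real n)) (\<tau> n w))) = min (ennreal (real n)) (\<tau> n w)"
          by (simp add: min_less_iff_disj)
        then have "k n w = r w" using elim by (simp add: k_def r_def min_absorb2)
        then show ?case by simp
      qed
      then show ?case by (rule tendsto_eventually)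
    qed
  qed
  then have "E(\<lambda>w. X (r w) w - X 0 w) = 0" using LIMSEQ_unique[OF _ tendsto_const] by (simp add: N(2))
  moreover have "integrable M (\<lambda>w. X (r w) w)"
  proof (rule Bochner_Integration.integrable_bound[OF D(1) rm])
    show "AE w in M. norm (X (r w) w) \<le> norm (D w)"
      using D(2)
    proof eventually_elim
      case (elim w)
      then have "\<bar>X (r w) w\<bar> \<le> D w" using r_nonneg by blast
      then show ?case by simp
    qed
  qed
  ultimately show "E(\<lambda>w. X (r w) w) = E(\<lambda>w. X 0 w)"
    using Bochner_Integration.integral_diff[of M "\<lambda>w. X (r w) w" "X 0"] Xi[of 0] by simp
qed

end

section \<open>Continuous martingales of finite variation\<close>

text \<open>The sum of squares is at most the largest increment of \<open>f\<close> times the total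
  increase of \<open>g\<close>. Uniform continuity makes the first factor small; bounding it by the
  total increase of \<open>g\<close> instead gives the majorant.\<close>

lemma quadratic_variation_bounds:
  fixes f g :: "real \<Rightarrow> real"
  assumes T: "0 \<le> T" and cont: "continuous_on {0..T} f"
    and le: "\<And>u v. 0 \<le> u ==> u \<le> v ==> v \<le> T ==> \<bar>f v - f u\<bar> \<le> g v - g u"
  defines "Q \<equiv> \<lambda>n. \<Sum>k<Suc n. (f (grid T n (Suc k)) - f (grid T n k))\<^sup>2"
  shows "Q \<longlonglongrightarrow> 0" and "Q n \<le> (g T - g 0)\<^sup>2"
proof -
  have gr: "0 \<le> grid T n k" "grid T n k \<le> grid T n (Suc k)" for n k
    using grid_nonneg[OF T] grid_mono[OF T] by auto
  have grT: "grid T n (Suc k) \<le> T" if "k < Suc n" for n k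
    using that by (intro grid_le[OF T]) simp
  have V: "(\<Sum>k<Suc n. g (grid T n (Suc k)) - g (grid T n k)) = g T - g 0" for n
    using sum_increments[of g T n] by simp
  have bd: "Q n \<le> e * (g T - g 0)"
    if e: "\<And>k. k < Suc n ==> \<bar>f (grid T n (Suc k)) - f (grid T n k)\<bar> \<le> e" for n e
  proof -
    have "Q n \<le> (\<Sum>k<Suc n. e * (g (grid T n (Suc k)) - g (grid T n k)))"
      unfolding Q_def
    proof (rule sum_mono)
      fix k assume k: "k \<in> {..<Suc n}"
      define d where "d = \<bar>f (grid T n (Suc k)) - f (grid T n k)\<bar>"
      have "(f (grid T n (Suc k)) - f (grid T n k))\<^sup>2 = d * d" by (simp add: d_def power2_eq_square)
      also have "\<dots> \<le> e * (g (grid T n (Suc k)) - g (grid T n k))"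
      proof (rule mult_mono)
        show "d \<le> e" using e k by (simp add: d_def)
        show "d \<le> g (grid T n (Suc k)) - g (grid T n k)" unfolding d_def using le[OF gr grT] k by simp
        show "0 \<le> e" using \<open>d \<le> e\<close> by (auto simp: d_def)
      qed (simp add: d_def)
      finally show "(f (grid T n (Suc k)) - f (grid T n k))\<^sup>2 \<le> e * (g (grid T n (Suc k)) - g (grid T n k))" .
    qed
    then show ?thesis by (simp only: sum_distrib_left[symmetric] V)
  qed
  have g: "g u \<le> g v" if "0 \<le> u" "u \<le> v" "v \<le> T" for u v
    using le[OF that] by linarith
  show "Q n \<le> (g T - g 0)\<^sup>2"
    unfolding power2_eq_square
  proof (rule bd)
    fix k assume k: "k < Suc n"
    have "g 0 \<le> g (grid T n k)" "g (grid T n (Suc k)) \<le> g T"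
      using gr gr(1)[of n "Suc k"] grT[OF k] order_trans[OF gr(2) grT[OF k]] T by (intro g; simp)+
    then show "\<bar>f (grid T n (Suc k)) - f (grid T n k)\<bar> \<le> g T - g 0"
      using le[OF gr grT[OF k]] by linarith
  qed
  have Q0: "0 \<le> Q n" for n unfolding Q_def by (intro sum_nonneg) simp
  have V0: "0 \<le> g T - g 0" using g[of 0 T] T by simp
  show "Q \<longlonglongrightarrow> 0"
  proof (rule LIMSEQ_I)
    fix e :: real assume e: "0 < e"
    define e' where "e' = e / (g T - g 0 + 1)"
    have e': "0 < e'" using e V0 by (simp add: e'_def)
    have "uniformly_continuous_on {0..T} f" by (rule compact_uniformly_continuous[OF cont]) simp
    then obtain d where d: "0 < d" "\<And>x y. x \<in> {0..T} ==> y \<in> {0..T} ==> dist y x < d ==> dist (f y) (f x) < e'"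
      using e' unfolding uniformly_continuous_on_def by blast
    obtain n0 :: nat where n0: "T / d < real n0" using reals_Archimedean2 by blast
    show "\<exists>no. \<forall>n\<ge>no. norm (Q n - 0) < e"
    proof (intro exI allI impI)
      fix n assume n: "n0 \<le> n"
      have "Q n \<le> e' * (g T - g 0)"
      proof (rule bd)
        fix k assume k: "k < Suc n"
        have "T / d < real (Suc n)" using n0 n by simp
        then have "T / real (Suc n) < d" using d(1) by (simp add: field_simps)
        moreover have "grid T n (Suc k) - grid T n k = T / real (Suc n)"
          unfolding grid_def diff_divide_distrib[symmetric] right_diff_distrib[symmetric] by simp
        ultimately have "dist (grid T n (Suc k)) (grid T n k) < d" using T by (simp add: dist_real_def)
        then have "dist (f (grid T n (Suc k))) (f (grid T n k)) < e'"
          using gr gr(1)[of n "Suc k"] grT[OF k] order_trans[OF gr(2) grT[OF k]] by (intro d(2)) auto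
        then show "\<bar>f (grid T n (Suc k)) - f (grid T n k)\<bar> \<le> e'" by (simp add: dist_real_def)
      qed
      also have "\<dots> < e" using e V0 by (simp add: e'_def field_simps)
      finally show "norm (Q n - 0) < e" using Q0[of n] by simp
    qed
  qed
qed

context azema begin

lemma mu_mult_integrable:
  assumes "0 \<le> s" "0 \<le> t" shows "integrable M (\<lambda>w. \<mu> s w * \<mu> t w)"
proof -
  have i: "integrable M (\<lambda>w. (1 + Ainf w)\<^sup>2)"
    using Ainf_integrable Ainf_square_integrable by (simp add: power2_sum)
  note [measurable] = adaptedM[OF mu_adapted assms(1)] adaptedM[OF mu_adapted assms(2)]
  show ?thesis
  proof (rule Bochner_Integration.integrable_bound[OF i])
    show "AE w in M. norm (\<mu> s w * \<mu> t w) \<le> norm ((1 + Ainf w)\<^sup>2)"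
      using mu_bounds
    proof eventually_elim
      case (elim w)
      then have "\<bar>\<mu> s w\<bar> * \<bar>\<mu> t w\<bar> \<le> (1 + Ainf w) * (1 + Ainf w)"
        using assms Ainf_nonneg[of w] by (intro mult_mono) auto
      then show ?case by (simp add: abs_mult power2_eq_square)
    qed
  qed measurable
qed

lemma mu_increment_square:
  assumes st: "0 \<le> s" "s \<le> t"
  shows "integrable M (\<lambda>w. (\<mu> t w - \<mu> s w)\<^sup>2)"
    "E(\<lambda>w. (\<mu> t w - \<mu> s w)\<^sup>2) = E(\<lambda>w. (\<mu> t w)\<^sup>2) - E(\<lambda>w. (\<mu> s w)\<^sup>2)"
proof -
  have t: "0 \<le> t" using st by simp
  note i = mu_mult_integrable[OF t t] mu_mult_integrable[OF st(1) t] mu_mult_integrable[OF st(1) st(1)]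
  have e: "(\<mu> t w - \<mu> s w)\<^sup>2 = \<mu> t w * \<mu> t w - 2 * (\<mu> s w * \<mu> t w) + \<mu> s w * \<mu> s w" for w
    by (simp add: power2_eq_square algebra_simps)
  show "integrable M (\<lambda>w. (\<mu> t w - \<mu> s w)\<^sup>2)" unfolding e using i by simp
  have "E(\<lambda>w. \<mu> s w * \<mu> s w) = E(\<lambda>w. \<mu> s w * \<mu> t w)"
    by (rule martingale_test(2)[OF mu_martingale st adaptedD[OF mu_adapted st(1) order_refl] i(2)])
  then show "E(\<lambda>w. (\<mu> t w - \<mu> s w)\<^sup>2) = E(\<lambda>w. (\<mu> t w)\<^sup>2) - E(\<lambda>w. (\<mu> s w)\<^sup>2)"
    unfolding e using i by (simp add: power2_eq_square)
qed

lemma decreasing_imp_mu_one: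
  assumes cont: "AE w in M. continuous_on {0..} (\<lambda>t. \<mu> t w)" and dec: "decreasing_process M Z"
  shows "AE w in M. \<forall>t\<ge>0. \<mu> t w = 1"
proof (rule AE_all_eq[OF mu_cadlag cadlag_const])
  fix T :: real assume T: "0 \<le> T"
  define Q where "Q n w = (\<Sum>k<Suc n. (\<mu> (grid T n (Suc k)) w - \<mu> (grid T n k) w)\<^sup>2)" for n w
  have gr: "0 \<le> grid T n k" "grid T n k \<le> grid T n (Suc k)" for n k
    using grid_nonneg[OF T] grid_mono[OF T] by auto
  \<comment> \<open>Increments of a square integrable martingale are orthogonal, so the expected
    quadratic variation is the same for every grid.\<close>
  have EQ: "E(\<lambda>w. Q n w) = E(\<lambda>w. (\<mu> T w - \<mu> 0 w)\<^sup>2)" for n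
  proof -
    have "E(\<lambda>w. Q n w) = (\<Sum>k<Suc n. E(\<lambda>w. (\<mu> (grid T n (Suc k)) w)\<^sup>2) - E(\<lambda>w. (\<mu> (grid T n k) w)\<^sup>2))"
      unfolding Q_def by (simp only: Bochner_Integration.integral_sum[OF mu_increment_square(1)[OF gr]] mu_increment_square(2)[OF gr])
    also have "\<dots> = E(\<lambda>w. (\<mu> T w - \<mu> 0 w)\<^sup>2)"
      using sum_lessThan_telescope[of "\<lambda>k. E(\<lambda>w. (\<mu> (grid T n k) w)\<^sup>2)" "Suc n"] mu_increment_square(2)[OF order_refl T]
      by simp
    finally show ?thesis .
  qed
  have ae: "AE w in M. (\<lambda>n. Q n w) \<longlonglongrightarrow> 0 \<and> (\<forall>n. Q n w \<le> (1 + Ainf w)\<^sup>2)"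
    using cont dec[unfolded decreasing_process_def] mu_eq Z_bounds A_le_Ainf AE_space
  proof eventually_elim
    case (elim w)
    have c: "continuous_on {0..T} (\<lambda>t. \<mu> t w)" using elim(1) by (rule continuous_on_subset) simp
    \<comment> \<open>With \<open>Z\<close> decreasing, A - Z is increasing and its increments
      dominate those of \<mu> = A + Z.\<close>
    have le: "\<bar>\<mu> v w - \<mu> u w\<bar> \<le> (A v w - Z v w) - (A u w - Z u w)" if uv: "0 \<le> u" "u \<le> v" "v \<le> T" for u v
    proof -
      have "Z v w \<le> Z u w" using monotone_onD[OF elim(2), of u v] uv by simp
      moreover have "A u w \<le> A v w" using A_le[OF elim(6) uv(1,2)] .
      moreover have "\<mu> v w = A v w + Z v w" "\<mu> u w = A u w + Z u w" using elim(3) uv by auto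
      ultimately show ?thesis by linarith
    qed
    have "(A T w - Z T w) - (A 0 w - Z 0 w) \<le> 1 + Ainf w"
    proof -
      have "0 \<le> Z T w" "Z 0 w \<le> 1" "A T w \<le> Ainf w" using elim(4,5) T by auto
      then show ?thesis using A_nonneg[OF elim(6), of 0] by simp
    qed
    moreover have "0 \<le> (A T w - Z T w) - (A 0 w - Z 0 w)"
      using le[of 0 T] T by (meson abs_ge_zero order_refl order_trans)
    ultimately have "((A T w - Z T w) - (A 0 w - Z 0 w))\<^sup>2 \<le> (1 + Ainf w)\<^sup>2" by (intro power_mono)
    moreover have "Q n w \<le> ((A T w - Z T w) - (A 0 w - Z 0 w))\<^sup>2" for n
      unfolding Q_def by (rule quadratic_variation_bounds(2)[OF T c, where g = "\<lambda>t. A t w - Z t w"]) (rule le)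
    moreover have "(\<lambda>n. Q n w) \<longlonglongrightarrow> 0"
      unfolding Q_def by (rule quadratic_variation_bounds(1)[OF T c, where g = "\<lambda>t. A t w - Z t w"]) (rule le)
    ultimately show ?case by (meson order_trans)
  qed
  have i: "integrable M (\<lambda>w. (1 + Ainf w)\<^sup>2)"
    using Ainf_integrable Ainf_square_integrable by (simp add: power2_sum)
  have Q0: "0 \<le> Q n w" for n w unfolding Q_def by (intro sum_nonneg) simp
  have "(\<lambda>n. E(\<lambda>w. Q n w)) \<longlonglongrightarrow> E(\<lambda>w. 0)"
  proof (rule integral_dominated_convergence[OF _ _ i])
    show "Q n \<in> borel_measurable M" for n
      unfolding Q_def by (intro borel_measurable_sum borel_measurable_power borel_measurable_diff adaptedM[OF mu_adapted] gr)
    show "AE w in M. (\<lambda>n. Q n w) \<longlonglongrightarrow> 0" using ae by eventually_elim simp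
    show "AE w in M. norm (Q n w) \<le> (1 + Ainf w)\<^sup>2" for n using ae by eventually_elim (simp add: Q0)
  qed simp
  then have "E(\<lambda>w. (\<mu> T w - \<mu> 0 w)\<^sup>2) = 0" by (simp add: EQ LIMSEQ_const_iff)
  then have "AE w in M. (\<mu> T w - \<mu> 0 w)\<^sup>2 = 0"
    using integral_nonneg_eq_0_iff_AE[OF mu_increment_square(1)[OF order_refl T]] by simp
  then show "AE w in M. \<mu> T w = 1" using mu_initial by eventually_elim simp
qed

end

section \<open>Regularization of bounded martingales\<close>

text \<open>\<open>anchor\<close> is the value at the last oscillation of size \<open>e\<close>. For a martingale \<open>x\<close>, the expectation of
  \<open>e\<^sup>2 \<cdot> osc_count + (x - anchor)\<^sup>2\<close> grows no faster than that of \<open>x\<^sup>2\<close>; this bound plays the part of the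
  upcrossing inequality.\<close>

primrec anchor :: "real \<Rightarrow> (nat \<Rightarrow> real) \<Rightarrow> nat \<Rightarrow> real" where
  "anchor e x 0 = x 0"
| "anchor e x (Suc j) = (if e \<le> \<bar>x (Suc j) - anchor e x j\<bar> then x (Suc j) else anchor e x j)"

primrec osc_count :: "real \<Rightarrow> (nat \<Rightarrow> real) \<Rightarrow> nat \<Rightarrow> nat" where
  "osc_count e x 0 = 0"
| "osc_count e x (Suc j) = (if e \<le> \<bar>x (Suc j) - anchor e x j\<bar> then Suc (osc_count e x j) else osc_count e x j)"

lemma osc_count_mono: "j \<le> k ==> osc_count e x j \<le> osc_count e x k"
  by (rule lift_Suc_mono_le) auto

lemma anchor_close: "0 < e ==> \<bar>x j - anchor e x j\<bar> < e"
  by (induction j) auto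

lemma anchor_const: "j \<le> k ==> osc_count e x k = osc_count e x j ==> anchor e x k = anchor e x j"
proof (induction k rule: dec_induct)
  case (step k)
  then have "osc_count e x j \<le> osc_count e x k" by (intro osc_count_mono) simp
  with step show ?case by (auto split: if_splits)
qed simp

text \<open>If the count stood still, so did the anchor, and both values would lie strictly within
  \<open>e\<close> of it.\<close>

lemma osc_count_less:
  assumes e: "0 < e" and jk: "j \<le> k" and big: "2 * e \<le> \<bar>x k - x j\<bar>"
  shows "osc_count e x j < osc_count e x k"
proof (rule ccontr)
  assume "\<not> osc_count e x j < osc_count e x k"
  then have "osc_count e x k = osc_count e x j" using osc_count_mono[OF jk, of e x] by simp
  from anchor_const[OF jk this] anchor_close[OF e, of x j] anchor_close[OF e, of x k] big show False by linarith
qed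

lemma osc_count_le: "osc_count e x j \<le> j"
  by (induction j) auto

lemma anchor_bounds: "(\<And>i. 0 \<le> x i \<and> x i \<le> 1) ==> 0 \<le> anchor e x j \<and> anchor e x j \<le> 1"
  by (induction j) auto

text \<open>A monotone clock with values in \<open>\<nat>\<close> is constant on either side of every point, and it moves across each
  large oscillation.\<close>

lemma oscillation_clock:
  fixes f :: "real \<Rightarrow> real" and K :: nat
  assumes e: "0 < e" and fin: "\<exists>R. \<exists>\<^sub>\<infinity>n. osc_count e (\<lambda>j. f (real j / 2 ^ n)) (K * 2 ^ n) < R"
  obtains C :: "real \<Rightarrow> nat"
  where "\<And>p q. p \<in> dyadics ==> q \<in> dyadics ==> p < q ==> q \<le> real K ==> C p \<le> C q"
    and "\<And>p q. p \<in> dyadics ==> q \<in> dyadics ==> p < q ==> q \<le> real K ==> 2 * e \<le> \<bar>f q - f p\<bar> ==> C p < C q"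
proof
  define x where "x n j = f (real j / 2 ^ n)" for n j
  define c where "c n q = osc_count e (x n) (nat \<lfloor>q * 2 ^ n\<rfloor>)" for n and q :: real
  \<comment> \<open>The lower limit, over finer and finer grids, of the counts up to time
    \<open>q\<close>; for natural numbers it is the least bound respected infinitely often.\<close>
  define C where "C q = (LEAST r. \<exists>\<^sub>\<infinity>n. c n q \<le> r)" for q :: real
  have lvl: "\<forall>\<^sub>F n in sequentially. real (nat \<lfloor>q * 2 ^ n\<rfloor>) / 2 ^ n = q" if "q \<in> dyadics" for q :: real
  proof -
    from that obtain k n0 where q: "q = real k / 2 ^ n0" unfolding dyadics_def by blast
    show ?thesis
      using eventually_ge_at_top[of n0]
    proof eventually_elim
      case (elim n)
      then obtain d where d: "n = n0 + d" using le_Suc_ex by blast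
      have "q * 2 ^ n = real (k * 2 ^ d)" by (simp add: q d power_add)
      then show ?case by (simp add: field_simps)
    qed
  qed
  obtain R where R: "\<exists>\<^sub>\<infinity>n. osc_count e (x n) (K * 2 ^ n) < R" using fin unfolding x_def by blast
  have ex: "\<exists>r. \<exists>\<^sub>\<infinity>n. c n q \<le> r" if "q \<le> real K" for q
  proof
    have "nat \<lfloor>q * 2 ^ n\<rfloor> \<le> K * 2 ^ n" for n
    proof -
      have "q * 2 ^ n \<le> real (K * 2 ^ n)" using that by (simp add: mult_right_mono)
      then show ?thesis by linarith
    qed
    then have "c n q \<le> osc_count e (x n) (K * 2 ^ n)" for n unfolding c_def by (rule osc_count_mono)
    from le_less_trans[OF this] show "\<exists>\<^sub>\<infinity>n. c n q \<le> R" by (intro INFM_mono[OF R] less_imp_le)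
  qed
  have C: "\<exists>\<^sub>\<infinity>n. c n q \<le> C q" if "q \<le> real K" for q
    unfolding C_def using ex[OF that] by (rule LeastI_ex)
  { fix p q :: real assume pq: "p \<in> dyadics" "q \<in> dyadics" "p < q" "q \<le> real K"
    have le: "nat \<lfloor>p * 2 ^ n\<rfloor> \<le> nat \<lfloor>q * 2 ^ n\<rfloor>" for n
      using pq(3) by (intro nat_mono floor_mono) simp
    have "c n p \<le> c n q" for n unfolding c_def by (rule osc_count_mono[OF le])
    from order_trans[OF this] have "\<exists>\<^sub>\<infinity>n. c n p \<le> C q" by (rule INFM_mono[OF C[OF pq(4)]])
    then show "C p \<le> C q" unfolding C_def[of p] by (rule Least_le)
    assume big: "2 * e \<le> \<bar>f q - f p\<bar>"
    have "\<forall>\<^sub>F n in sequentially. c n p < c n q"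
      using lvl[OF pq(1)] lvl[OF pq(2)]
    proof eventually_elim
      case (elim n)
      then have "x n (nat \<lfloor>p * 2 ^ n\<rfloor>) = f p" "x n (nat \<lfloor>q * 2 ^ n\<rfloor>) = f q" by (simp_all add: x_def)
      then show ?case unfolding c_def by (intro osc_count_less[OF e le]) (use big in simp)
    qed
    then have "\<exists>\<^sub>\<infinity>n. c n q \<le> C q \<and> c n p < c n q"
      using C[OF pq(4)] by (simp add: cofinite_eq_sequentially frequently_eventually_frequently)
    then have "\<exists>\<^sub>\<infinity>n. c n p \<le> C q - 1" by (rule INFM_mono) auto
    then have "C p \<le> C q - 1" unfolding C_def[of p] by (rule Least_le)
    \<comment> \<open>Subtraction is truncated, so \<open>C p \<le> C q - 1\<close> is a strict
      inequality only for positive \<open>C q\<close>.\<close>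
    moreover have "0 < C q"
    proof -
      from \<open>\<exists>\<^sub>\<infinity>n. c n q \<le> C q \<and> c n p < c n q\<close> obtain n where "c n q \<le> C q \<and> c n p < c n q"
        by (auto dest: INFM_EX)
      then show ?thesis by simp
    qed
    ultimately show "C p < C q" by linarith }
qed

text \<open>A lower-limit condition: a bound along infinitely many grids is asked for, not along all
  of them. A probability estimate for single grids yields this form, and
  \<open>oscillation_clock\<close> can use it. Sizes 1/(i+1) keep the quantifiers countable.\<close>

definition osc_finite :: "(real \<Rightarrow> real) \<Rightarrow> bool" where
  "osc_finite f \<longleftrightarrow> (\<forall>i K. \<exists>R. \<exists>\<^sub>\<infinity>n. osc_count (1 / real (Suc i)) (\<lambda>j. f (real j / 2 ^ n)) (K * 2 ^ n) < R)"

text \<open>The clock attains a least value at dyadic times to the right of \<open>t\<close>; by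
  monotonicity it stands still between \<open>t\<close> and the place of that minimum, where no
  large oscillation can then occur.\<close>

lemma osc_finite_right:
  assumes f: "osc_finite f" and eps: "0 < \<epsilon>" and t: "0 \<le> t"
  obtains \<delta> where "0 < \<delta>" "\<And>p q. p \<in> dyadics ==> q \<in> dyadics ==> p \<in> {t<..<t+\<delta>} ==> q \<in> {t<..<t+\<delta>} ==> \<bar>f q - f p\<bar> < \<epsilon>"
proof -
  \<comment> \<open>Half of \<epsilon>, because the clock is sure to move only for oscillations of
    twice its threshold.\<close>
  obtain i where i: "1 / real (Suc i) < \<epsilon> / 2" using nat_approx_posE[of "\<epsilon> / 2"] eps by auto
  obtain K :: nat where K: "t < real K" using reals_Archimedean2 by blast
  obtain C :: "real \<Rightarrow> nat" where
    mono: "\<And>p q. p \<in> dyadics ==> q \<in> dyadics ==> p < q ==> q \<le> real K ==> C p \<le> C q" and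
    jump: "\<And>p q. p \<in> dyadics ==> q \<in> dyadics ==> p < q ==> q \<le> real K ==> 2 * (1 / real (Suc i)) \<le> \<bar>f q - f p\<bar> ==> C p < C q"
    by (rule oscillation_clock[of "1 / real (Suc i)" f K]) (use f in \<open>auto simp: osc_finite_def simp del: of_nat_Suc\<close>)
  have "\<exists>r. \<exists>p\<in>dyadics. t < p \<and> p \<le> real K \<and> C p = r" using K by (auto intro!: bexI[of _ "real K"])
  then have "\<exists>p\<in>dyadics. t < p \<and> p \<le> real K \<and> C p = (LEAST r. \<exists>p\<in>dyadics. t < p \<and> p \<le> real K \<and> C p = r)"
    by (rule LeastI_ex)
  then obtain p0 where p0: "p0 \<in> dyadics" "t < p0" "p0 \<le> real K"
     "C p0 = (LEAST r. \<exists>p\<in>dyadics. t < p \<and> p \<le> real K \<and> C p = r)" by blast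
  have const: "C p = C p0" if "p \<in> dyadics" "p \<in> {t<..<p0}" for p
  proof (rule antisym)
    show "C p \<le> C p0" using that p0 by (intro mono) auto
    show "C p0 \<le> C p" unfolding p0(4) using that p0 by (intro Least_le) auto
  qed
  show ?thesis
  proof (rule that[of "p0 - t"])
    fix p q :: real assume pq: "p \<in> dyadics" "q \<in> dyadics" "p \<in> {t<..<t + (p0 - t)}" "q \<in> {t<..<t + (p0 - t)}"
    then have e: "C p = C q" using const by simp
    have "\<not> 2 * (1 / real (Suc i)) \<le> \<bar>f q - f p\<bar>"
    proof (cases "p < q")
      case True
      then show ?thesis using jump[of p q] pq p0 e by force
    next
      case False
      show ?thesis
      proof (cases "q < p")
        case True
        then show ?thesis using jump[of q p] pq p0 e by (force simp: abs_minus_commute)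
      next
        case False with \<open>\<not> p < q\<close> have "p = q" by simp
        then show ?thesis by simp
      qed
    qed
    then show "\<bar>f q - f p\<bar> < \<epsilon>" using i by linarith
  qed (use p0 in simp)
qed

text \<open>The mirror image: before \<open>t\<close> the clock is bounded by its value at an
  integer beyond \<open>t\<close>, so it attains a greatest value and stands still from there up to
  \<open>t\<close>.\<close>

lemma osc_finite_left:
  assumes f: "osc_finite f" and eps: "0 < \<epsilon>" and t: "0 < t"
  obtains s where "0 \<le> s" "s < t" "\<And>p q. p \<in> dyadics ==> q \<in> dyadics ==> p \<in> {s<..<t} ==> q \<in> {s<..<t} ==> \<bar>f q - f p\<bar> < \<epsilon>"
proof -
  obtain i where i: "1 / real (Suc i) < \<epsilon> / 2" using nat_approx_posE[of "\<epsilon> / 2"] eps by auto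
  obtain K :: nat where K: "t < real K" using reals_Archimedean2 by blast
  obtain C :: "real \<Rightarrow> nat" where
    mono: "\<And>p q. p \<in> dyadics ==> q \<in> dyadics ==> p < q ==> q \<le> real K ==> C p \<le> C q" and
    jump: "\<And>p q. p \<in> dyadics ==> q \<in> dyadics ==> p < q ==> q \<le> real K ==> 2 * (1 / real (Suc i)) \<le> \<bar>f q - f p\<bar> ==> C p < C q"
    by (rule oscillation_clock[of "1 / real (Suc i)" f K]) (use f in \<open>auto simp: osc_finite_def simp del: of_nat_Suc\<close>)
  define P where "P r \<longleftrightarrow> (\<exists>p\<in>dyadics. p < t \<and> C p = r)" for r
  have "P (C 0)" unfolding P_def using t dyadics_I[of 0 0] by auto
  moreover have "r \<le> C (real K)" if "P r" for r
    using that K unfolding P_def by (auto intro!: mono)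
  ultimately have "P (GREATEST r. P r)" by (intro GreatestI_nat[of P "C 0" "C (real K)"]) auto
  then obtain p0 where p0: "p0 \<in> dyadics" "p0 < t" "C p0 = (GREATEST r. P r)" unfolding P_def by blast
  have const: "C p = C p0" if "p \<in> dyadics" "p \<in> {p0<..<t}" for p
  proof (rule antisym)
    show "C p0 \<le> C p" using that p0 K by (intro mono) auto
    have "P (C p)" using that unfolding P_def by auto
    then show "C p \<le> C p0"
      unfolding p0(3) using \<open>\<And>r. P r ==> r \<le> C (real K)\<close> by (intro Greatest_le_nat[of P _ "C (real K)"]) auto
  qed
  show ?thesis
  proof (rule that[of p0])
    fix p q :: real assume pq: "p \<in> dyadics" "q \<in> dyadics" "p \<in> {p0<..<t}" "q \<in> {p0<..<t}"
    then have e: "C p = C q" using const by simp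
    have "\<not> 2 * (1 / real (Suc i)) \<le> \<bar>f q - f p\<bar>"
    proof (cases "p < q")
      case True
      then show ?thesis using jump[of p q] pq K e by force
    next
      case False
      show ?thesis
      proof (cases "q < p")
        case True
        then show ?thesis using jump[of q p] pq K e by (force simp: abs_minus_commute)
      next
        case False with \<open>\<not> p < q\<close> have "p = q" by simp
        then show ?thesis by simp
      qed
    qed
    then show "\<bar>f q - f p\<bar> < \<epsilon>" using i by linarith
  qed (use p0 dyadics_nonneg in auto)
qed

definition right_limit :: "(real \<Rightarrow> real) \<Rightarrow> real \<Rightarrow> real" where
  "right_limit f t = lim (\<lambda>n. f (dyadic_above n t))"

lemma dyadic_above_eventually:
  assumes "0 \<le> t" "t < u" shows "\<forall>\<^sub>F n in sequentially. dyadic_above n t \<in> {t<..<u}"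
  using order_tendstoD(2)[OF dyadic_above_tendsto[OF assms(1)] assms(2)]
  by eventually_elim (use dyadic_above_gt[OF assms(1)] in auto)

lemma right_limit_tendsto:
  assumes f: "osc_finite f" and t: "0 \<le> t"
  shows "(\<lambda>n. f (dyadic_above n t)) \<longlonglongrightarrow> right_limit f t"
proof -
  have "Cauchy (\<lambda>n. f (dyadic_above n t))"
  proof (rule CauchyI)
    fix \<epsilon> :: real assume "0 < \<epsilon>"
    from osc_finite_right[OF f this t] obtain \<delta> where d: "0 < \<delta>"
      "\<And>p q. p \<in> dyadics ==> q \<in> dyadics ==> p \<in> {t<..<t+\<delta>} ==> q \<in> {t<..<t+\<delta>} ==> \<bar>f q - f p\<bar> < \<epsilon>" by blast
    have "\<forall>\<^sub>F n in sequentially. dyadic_above n t \<in> {t<..<t+\<delta>}" using d(1) by (intro dyadic_above_eventually[OF t]) simp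
    then obtain n0 where n0: "\<And>n. n0 \<le> n ==> dyadic_above n t \<in> {t<..<t+\<delta>}"
      unfolding eventually_sequentially by blast
    have "norm (f (dyadic_above m t) - f (dyadic_above n t)) < \<epsilon>" if "n0 \<le> m" "n0 \<le> n" for m n
      using d(2)[OF dyadic_above_in dyadic_above_in n0[OF that(2)] n0[OF that(1)]] by simp
    then show "\<exists>N. \<forall>m\<ge>N. \<forall>n\<ge>N. norm (f (dyadic_above m t) - f (dyadic_above n t)) < \<epsilon>" by blast
  qed
  then show ?thesis unfolding right_limit_def by (simp add: Cauchy_convergent convergent_LIMSEQ_iff[symmetric])
qed

text \<open>The end point \<open>a\<close> itself is allowed for \<open>s\<close> and
  \<open>t\<close>, since the dyadic times that approximate it lie strictly to its right.\<close>

lemma right_limit_close: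
  assumes f: "osc_finite f"
    and d: "\<And>p q. p \<in> dyadics ==> q \<in> dyadics ==> p \<in> {a<..<b} ==> q \<in> {a<..<b} ==> \<bar>f q - f p\<bar> < \<epsilon>"
    and st: "0 \<le> a" "a \<le> s" "s < b" "a \<le> t" "t < b"
  shows "\<bar>right_limit f t - right_limit f s\<bar> \<le> \<epsilon>"
proof (rule LIMSEQ_le_const2)
  have s0: "0 \<le> s" "0 \<le> t" using st by auto
  show "(\<lambda>n. \<bar>f (dyadic_above n t) - f (dyadic_above n s)\<bar>) \<longlonglongrightarrow> \<bar>right_limit f t - right_limit f s\<bar>"
    by (intro tendsto_rabs tendsto_diff right_limit_tendsto f s0)
  have "\<forall>\<^sub>F n in sequentially. \<bar>f (dyadic_above n t) - f (dyadic_above n s)\<bar> \<le> \<epsilon>"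
    using dyadic_above_eventually[OF s0(1) st(3)] dyadic_above_eventually[OF s0(2) st(5)]
  proof eventually_elim
    case (elim n)
    have "\<bar>f (dyadic_above n t) - f (dyadic_above n s)\<bar> < \<epsilon>"
      using elim st by (intro d dyadic_above_in) auto
    then show ?case by simp
  qed
  then show "\<exists>N. \<forall>n\<ge>N. \<bar>f (dyadic_above n t) - f (dyadic_above n s)\<bar> \<le> \<epsilon>"
    unfolding eventually_sequentially .
qed

lemma right_limit_right_continuous:
  assumes f: "osc_finite f" and t: "0 \<le> t"
  shows "continuous (at_right t) (right_limit f)"
  unfolding continuous_within
proof (rule tendstoI)
  fix \<epsilon> :: real assume e: "0 < \<epsilon>"
  then have "0 < \<epsilon> / 2" by simp
  from osc_finite_right[OF f this t] obtain \<delta> where d: "0 < \<delta>"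
    "\<And>p q. p \<in> dyadics ==> q \<in> dyadics ==> p \<in> {t<..<t+\<delta>} ==> q \<in> {t<..<t+\<delta>} ==> \<bar>f q - f p\<bar> < \<epsilon> / 2" by blast
  have "t < t + \<delta>" using d(1) by simp
  show "\<forall>\<^sub>F s in at_right t. dist (right_limit f s) (right_limit f t) < \<epsilon>"
    using eventually_at_right_real[OF \<open>t < t + \<delta>\<close>]
  proof eventually_elim
    case (elim s)
    have "\<bar>right_limit f s - right_limit f t\<bar> \<le> \<epsilon> / 2"
      by (rule right_limit_close[OF f, where a = t and b = "t + \<delta>"]) (use elim d t in auto)
    then show ?case using e by (simp add: dist_real_def)
  qed
qed

lemma right_limit_left_limit:
  assumes f: "osc_finite f" and t: "0 < t"
  shows "\<exists>l. (right_limit f \<longlongrightarrow> l) (at_left t)"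
proof -
  let ?g = "right_limit f"
  have osc: "\<exists>s. 0 \<le> s \<and> s < t \<and> (\<forall>u v. s < u \<and> u < t \<and> s < v \<and> v < t \<longrightarrow> \<bar>?g u - ?g v\<bar> \<le> \<epsilon>)" if e: "0 < \<epsilon>" for \<epsilon>
  proof -
    from osc_finite_left[OF f e t] obtain s where s: "0 \<le> s" "s < t"
      "\<And>p q. p \<in> dyadics ==> q \<in> dyadics ==> p \<in> {s<..<t} ==> q \<in> {s<..<t} ==> \<bar>f q - f p\<bar> < \<epsilon>" by blast
    have "\<bar>?g u - ?g v\<bar> \<le> \<epsilon>" if "s < u" "u < t" "s < v" "v < t" for u v
      by (rule right_limit_close[OF f s(3) s(1)]) (use that in auto)
    then show ?thesis using s(1,2) by blast
  qed
  define u where "u n = t - 1 / real (Suc n)" for n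
  have "u \<longlonglongrightarrow> t - 0" unfolding u_def by (intro tendsto_diff tendsto_const LIMSEQ_Suc[OF lim_const_over_n])
  then have ulim: "u \<longlonglongrightarrow> t" by simp
  have ult: "u n < t" for n unfolding u_def by simp
  have "Cauchy (\<lambda>n. ?g (u n))"
  proof (rule CauchyI)
    fix \<epsilon> :: real assume e: "0 < \<epsilon>"
    then have "0 < \<epsilon> / 2" by simp
    from osc[OF this] obtain s where s: "s < t" "\<forall>u v. s < u \<and> u < t \<and> s < v \<and> v < t \<longrightarrow> \<bar>?g u - ?g v\<bar> \<le> \<epsilon> / 2" by blast
    obtain n0 where n0: "\<And>n. n0 \<le> n ==> s < u n"
      using order_tendstoD(1)[OF ulim s(1)] unfolding eventually_sequentially by blast
    have "norm (?g (u m) - ?g (u n)) < \<epsilon>" if "n0 \<le> m" "n0 \<le> n" for m n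
    proof -
      have "\<bar>?g (u m) - ?g (u n)\<bar> \<le> \<epsilon> / 2" using s(2) n0[OF that(1)] n0[OF that(2)] ult by blast
      then show ?thesis using e by simp
    qed
    then show "\<exists>N. \<forall>m\<ge>N. \<forall>n\<ge>N. norm (?g (u m) - ?g (u n)) < \<epsilon>" by blast
  qed
  then obtain l where l: "(\<lambda>n. ?g (u n)) \<longlonglongrightarrow> l" by (auto simp: Cauchy_convergent_iff convergent_def)
  have "(?g \<longlongrightarrow> l) (at_left t)"
  proof (rule tendstoI)
    fix \<epsilon> :: real assume e: "0 < \<epsilon>"
    then have "0 < \<epsilon> / 2" by simp
    from osc[OF this] obtain s where s: "s < t" "\<forall>u v. s < u \<and> u < t \<and> s < v \<and> v < t \<longrightarrow> \<bar>?g u - ?g v\<bar> \<le> \<epsilon> / 2" by blast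
    obtain n0 where n0: "\<And>n. n0 \<le> n ==> s < u n"
      using order_tendstoD(1)[OF ulim s(1)] unfolding eventually_sequentially by blast
    show "\<forall>\<^sub>F v in at_left t. dist (?g v) l < \<epsilon>"
      using eventually_at_left_real[OF s(1)]
    proof eventually_elim
      case (elim v)
      have "\<bar>?g v - l\<bar> \<le> \<epsilon> / 2"
      proof (rule LIMSEQ_le_const2)
        show "(\<lambda>n. \<bar>?g v - ?g (u n)\<bar>) \<longlonglongrightarrow> \<bar>?g v - l\<bar>" by (intro tendsto_rabs tendsto_diff tendsto_const l)
        show "\<exists>N. \<forall>n\<ge>N. \<bar>?g v - ?g (u n)\<bar> \<le> \<epsilon> / 2"
          using s(2) n0 ult elim by (intro exI[of _ n0]) auto
      qed
      then show ?case using e by (simp add: dist_real_def)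
    qed
  qed
  then show ?thesis by blast
qed

section \<open>A cadlag version of the conditional expectations of a bounded variable\<close>

locale bounded_variable = usual_filtration M F for M :: "'a measure" and F +
  fixes \<xi> :: "'a \<Rightarrow> real"
  assumes xi_meas [measurable]: "\<xi> \<in> borel_measurable M" and xi_bounds: "\<And>w. 0 \<le> \<xi> w \<and> \<xi> w \<le> 1"
begin

text \<open>Clipping alters the conditional expectation on a null set only (\<open>cexp_AE\<close>)
  and makes the bounds hold at every point, as the pathwise arguments require.\<close>

definition cexp :: "real \<Rightarrow> 'a \<Rightarrow> real" where
  "cexp t w = min 1 (max 0 (real_cond_exp M (F (ennreal t)) \<xi> w))"

lemma cexp_bounds: "0 \<le> cexp t w \<and> cexp t w \<le> 1"
  by (simp add: cexp_def)

lemma cexp_F: "cexp t \<in> borel_measurable (F (ennreal t))"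
  unfolding cexp_def[abs_def] by (intro borel_measurable_min borel_measurable_max borel_measurable_const borel_measurable_cond_exp)

lemma cexp_M [measurable]: "cexp t \<in> borel_measurable M"
  using cexp_F by (rule meas_F_M)

lemma bounded_integrable: "f \<in> borel_measurable M ==> (\<And>w. w \<in> space M ==> \<bar>f w\<bar> \<le> (c::real)) ==> integrable M f"
  by (rule integrable_const_bound[where B = c]) (auto intro: AE_I2)

lemma xi_integrable: "integrable M \<xi>"
  by (rule bounded_integrable[where c = 1]) (use xi_bounds in auto)

lemma cexp_AE: "AE w in M. cexp t w = real_cond_exp M (F (ennreal t)) \<xi> w"
proof -
  interpret S: sigma_finite_subalgebra M "F (ennreal t)" by (rule cond_exp_F)
  have "AE w in M. 0 \<le> real_cond_exp M (F (ennreal t)) \<xi> w"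
    by (rule S.real_cond_exp_pos) (use xi_bounds in auto)
  moreover have "AE w in M. real_cond_exp M (F (ennreal t)) \<xi> w \<le> real_cond_exp M (F (ennreal t)) (\<lambda>_. 1) w"
    by (rule S.real_cond_exp_mono) (use xi_bounds xi_integrable in auto)
  moreover have "AE w in M. real_cond_exp M (F (ennreal t)) (\<lambda>_. 1) w = 1"
    by (rule S.real_cond_exp_F_meas) auto
  ultimately show ?thesis by eventually_elim (simp add: cexp_def)
qed

lemma cexp_test:
  assumes y: "y \<in> borel_measurable (F (ennreal t))" and b: "\<And>w. w \<in> space M ==> \<bar>y w\<bar> \<le> c"
  shows "E(\<lambda>w. y w * cexp t w) = E(\<lambda>w. y w * \<xi> w)"
proof (rule cond_exp_test(2)[OF xi_meas y _ cexp_AE cexp_M])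
  note [measurable] = meas_F_M[OF y]
  show "integrable M (\<lambda>w. y w * \<xi> w)"
  proof (rule bounded_integrable[where c = c])
    fix w assume w: "w \<in> space M"
    have "\<bar>y w\<bar> * \<bar>\<xi> w\<bar> \<le> c * 1" using b[OF w] xi_bounds[of w] by (intro mult_mono) auto
    then show "\<bar>y w * \<xi> w\<bar> \<le> c" by (simp add: abs_mult)
  qed measurable
qed

definition gridval :: "nat \<Rightarrow> 'a \<Rightarrow> nat \<Rightarrow> real" where
  "gridval n w j = cexp (real j / 2 ^ n) w"

lemma gridval_F: "j \<le> k ==> (\<lambda>w. gridval n w j) \<in> borel_measurable (F (ennreal (real k / 2 ^ n)))"
  unfolding gridval_def by (rule meas_F_mono[OF cexp_F]) (auto intro!: ennreal_leI divide_right_mono)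

lemma anchor_count_F:
  "(\<lambda>w. anchor e (gridval n w) j) \<in> borel_measurable (F (ennreal (real j / 2 ^ n))) \<and>
   (\<lambda>w. real (osc_count e (gridval n w) j)) \<in> borel_measurable (F (ennreal (real j / 2 ^ n)))"
proof (induction j)
  case 0
  show ?case using gridval_F[of 0 0 n] by simp
next
  case (Suc j)
  let ?F = "F (ennreal (real (Suc j) / 2 ^ n))"
  have le: "ennreal (real j / 2 ^ n) \<le> ennreal (real (Suc j) / 2 ^ n)"
    by (intro ennreal_leI divide_right_mono) auto
  have [measurable]: "(\<lambda>w. anchor e (gridval n w) j) \<in> borel_measurable ?F"
    "(\<lambda>w. real (osc_count e (gridval n w) j)) \<in> borel_measurable ?F"
    using Suc le by (auto intro: meas_F_mono simp del: of_nat_Suc)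
  have [measurable]: "(\<lambda>w. gridval n w (Suc j)) \<in> borel_measurable ?F" by (rule gridval_F) simp
  have e: "real (osc_count e (gridval n w) (Suc j)) = (if e \<le> \<bar>gridval n w (Suc j) - anchor e (gridval n w) j\<bar>
      then 1 + real (osc_count e (gridval n w) j) else real (osc_count e (gridval n w) j))" for w by simp
  show ?case
    unfolding anchor.simps e by (intro conjI; measurable)
qed

text \<open>When the anchor moves, (x - anchor)^2 is at least e^2 and drops to 0, which pays for the
  new count. When it stays, nothing changes. The bound 1 is that of E[x^2].\<close>

lemma osc_count_integral:
  assumes e: "0 < e"
  shows "e\<^sup>2 * E(\<lambda>w. real (osc_count e (gridval n w) k)) \<le> 1"
proof -
  define x where "x j w = gridval n w j" for j w
  define a where "a j w = anchor e (gridval n w) j" for j w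
  define N where "N j w = real (osc_count e (gridval n w) j)" for j w
  let ?F = "\<lambda>j. F (ennreal (real j / 2 ^ n))"
  have aF: "a j \<in> borel_measurable (?F j)" for j
    unfolding a_def using anchor_count_F by blast
  have [measurable]: "a j \<in> borel_measurable M" "N j \<in> borel_measurable M" "x j \<in> borel_measurable M" for j
    unfolding a_def N_def x_def using anchor_count_F gridval_F[OF order_refl] meas_F_M by blast+
  have xb: "0 \<le> x j w" "x j w \<le> 1" for j w using cexp_bounds by (auto simp: x_def gridval_def)
  have ab: "0 \<le> a j w" "a j w \<le> 1" for j w
    using anchor_bounds[of "gridval n w" e j] cexp_bounds by (auto simp: a_def gridval_def)
  have Nb: "0 \<le> N j w" "N j w \<le> real j" for j w using osc_count_le by (auto simp: N_def)
  have prod: "\<bar>f * g\<bar> \<le> 1" if "0 \<le> f" "f \<le> 1" "0 \<le> g" "g \<le> 1" for f g :: real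
    using that mult_mono[of f 1 g 1] by auto
  have i1: "integrable M (\<lambda>w. x j w * x k w)" "integrable M (\<lambda>w. a j w * x k w)" "integrable M (\<lambda>w. a j w * a k w)" for j k
    by (rule bounded_integrable[where c = 1], measurable, intro prod xb ab)+
  have i2: "integrable M (N j)" for j
    by (rule bounded_integrable[where c = "real j"]) (use Nb in auto)
  have sq: "(x k w - a j w)\<^sup>2 = x k w * x k w - 2 * (a j w * x k w) + a j w * a j w" for j k w
    by (simp add: power2_eq_square algebra_simps)
  have i3: "integrable M (\<lambda>w. (x k w - a j w)\<^sup>2)" for j k unfolding sq using i1 by simp
  have I3: "E(\<lambda>w. (x k w - a j w)\<^sup>2) = E(\<lambda>w. x k w * x k w) - 2 * E(\<lambda>w. a j w * x k w) + E(\<lambda>w. a j w * a j w)" for j k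
    unfolding sq using i1 by simp
  have test: "E(\<lambda>w. a j w * x k w) = E(\<lambda>w. a j w * \<xi> w)" if "j \<le> k" for j k
  proof -
    have "a j \<in> borel_measurable (?F k)"
      by (rule meas_F_mono[OF aF]) (use that in \<open>auto intro!: ennreal_leI divide_right_mono\<close>)
    from cexp_test[OF this, of 1] ab show ?thesis by (simp add: x_def gridval_def)
  qed
  have "e\<^sup>2 * E(\<lambda>w. N k w) + E(\<lambda>w. (x k w - a k w)\<^sup>2) \<le> E(\<lambda>w. x k w * x k w)"
  proof (induction k)
    case 0
    have "N 0 = (\<lambda>_. 0)" "(\<lambda>w. (x 0 w - a 0 w)\<^sup>2) = (\<lambda>_. 0)" by (auto simp: N_def x_def a_def)
    moreover have "0 \<le> E(\<lambda>w. x 0 w * x 0 w)" using xb by (intro integral_nonneg_AE AE_I2) simp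
    ultimately show ?case by simp
  next
    case (Suc k)
    have pw: "e\<^sup>2 * N (Suc k) w + (x (Suc k) w - a (Suc k) w)\<^sup>2 \<le> e\<^sup>2 * N k w + (x (Suc k) w - a k w)\<^sup>2" for w
    proof (cases "e \<le> \<bar>x (Suc k) w - a k w\<bar>")
      case True
      then have "e\<^sup>2 \<le> (x (Suc k) w - a k w)\<^sup>2" using e by (metis less_imp_le power2_abs power_mono)
      moreover have "N (Suc k) w = 1 + N k w" "a (Suc k) w = x (Suc k) w"
        using True by (auto simp: N_def a_def x_def)
      ultimately show ?thesis by (simp add: distrib_left)
    next
      case False
      then have "N (Suc k) w = N k w" "a (Suc k) w = a k w" by (auto simp: N_def a_def x_def)
      then show ?thesis by simp
    qed
    have "e\<^sup>2 * E(\<lambda>w. N (Suc k) w) + E(\<lambda>w. (x (Suc k) w - a (Suc k) w)\<^sup>2)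
        = E(\<lambda>w. e\<^sup>2 * N (Suc k) w + (x (Suc k) w - a (Suc k) w)\<^sup>2)"
      using i2 i3 by simp
    also have "\<dots> \<le> E(\<lambda>w. e\<^sup>2 * N k w + (x (Suc k) w - a k w)\<^sup>2)"
      by (intro integral_mono pw) (use i2 i3 in auto)
    also have "\<dots> = e\<^sup>2 * E(\<lambda>w. N k w) + E(\<lambda>w. (x (Suc k) w - a k w)\<^sup>2)"
      using i2 i3 by simp
    \<comment> \<open>The cross terms cancel: tested against the anchor at step k, both x_k and
      x_(k+1) give the mean of the anchor times \<xi>.\<close>
    also have "E(\<lambda>w. (x (Suc k) w - a k w)\<^sup>2) =
       E(\<lambda>w. x (Suc k) w * x (Suc k) w) - E(\<lambda>w. x k w * x k w) + E(\<lambda>w. (x k w - a k w)\<^sup>2)"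
      unfolding I3 by (simp add: test)
    finally show ?case using Suc by linarith
  qed
  moreover have "0 \<le> E(\<lambda>w. (x k w - a k w)\<^sup>2)" by (intro integral_nonneg_AE AE_I2) simp
  moreover have "E(\<lambda>w. x k w * x k w) \<le> E(\<lambda>w. 1)"
    by (rule integral_mono[OF i1(1)]) (use prod[OF xb xb] in \<open>auto simp: abs_le_iff\<close>)
  moreover have "E(\<lambda>w. 1) = (1::real)" by (simp add: prob_space)
  ultimately show ?thesis unfolding N_def by linarith
qed

lemma osc_count_prob:
  assumes e: "0 < e" and R: "0 < R"
  shows "measure M {w\<in>space M. R \<le> osc_count e (gridval n w) k} \<le> 1 / (e\<^sup>2 * real R)"
proof -
  have [measurable]: "(\<lambda>w. real (osc_count e (gridval n w) k)) \<in> borel_measurable M"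
    using anchor_count_F meas_F_M by blast
  have i: "integrable M (\<lambda>w. real (osc_count e (gridval n w) k))"
    by (rule bounded_integrable[where c = "real k"]) (use osc_count_le in auto)
  have "measure M {w\<in>space M. real R \<le> real (osc_count e (gridval n w) k)} \<le>
      E(\<lambda>w. real (osc_count e (gridval n w) k)) / real R"
    by (rule integral_Markov_inequality_measure[where A = "{}"]) (use i R in auto)
  also have "\<dots> \<le> 1 / (e\<^sup>2 * real R)"
    using osc_count_integral[OF e, of n k] e R by (simp add: field_simps)
  finally show ?thesis by simp
qed

text \<open>Markov's inequality bounds P(count \<ge> R) by 1 / (e^2 R) on every grid. The event that
  this holds on all but finitely many grids is an increasing union and obeys the same bound, which
  vanishes as R grows.\<close>

lemma osc_AE:
  assumes e: "0 < e"
  shows "AE w in M. \<exists>R. \<exists>\<^sub>\<infinity>n. osc_count e (gridval n w) (K * 2 ^ n) < R"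
proof -
  define Ev where "Ev R n = {w\<in>space M. R \<le> osc_count e (gridval n w) (K * 2 ^ n)}" for R n
  have "(\<lambda>w. real (osc_count e (gridval n w) (K * 2 ^ n))) \<in> borel_measurable M" for n
    using anchor_count_F meas_F_M by blast
  then have "{w\<in>space M. real R \<le> real (osc_count e (gridval n w) (K * 2 ^ n))} \<in> sets M" for R n
    by measurable
  then have Ev [measurable]: "Ev R n \<in> sets M" for R n by (simp add: Ev_def)
  define U where "U R = (\<Union>m. \<Inter>n\<in>{m..}. Ev R n)" for R
  have U [measurable]: "U R \<in> sets M" for R unfolding U_def by measurable
  have Ub: "measure M (U R) \<le> 1 / (e\<^sup>2 * real R)" if R: "0 < R" for R
  proof -
    have "(\<lambda>m. measure M (\<Inter>n\<in>{m..}. Ev R n)) \<longlonglongrightarrow> measure M (\<Union>m. \<Inter>n\<in>{m..}. Ev R n)"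
    proof (rule finite_Lim_measure_incseq)
      show "incseq (\<lambda>m. \<Inter>n\<in>{m..}. Ev R n)" by (auto simp: incseq_def)
    qed (auto intro!: sets.countable_INT')
    moreover have "measure M (\<Inter>n\<in>{m..}. Ev R n) \<le> 1 / (e\<^sup>2 * real R)" for m
    proof -
      have "measure M (\<Inter>n\<in>{m..}. Ev R n) \<le> measure M (Ev R m)" by (rule finite_measure_mono) auto
      also have "\<dots> \<le> 1 / (e\<^sup>2 * real R)" unfolding Ev_def by (rule osc_count_prob[OF e R])
      finally show ?thesis .
    qed
    ultimately show ?thesis unfolding U_def by (intro LIMSEQ_le_const2) auto
  qed
  have "measure M (\<Inter>R. U R) \<le> 0"
  proof (rule LIMSEQ_le_const)
    have "(\<lambda>R. 1 / real (Suc R) * (1 / e\<^sup>2)) \<longlonglongrightarrow> 0 * (1 / e\<^sup>2)"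
      by (intro tendsto_mult tendsto_const LIMSEQ_Suc[OF lim_const_over_n])
    then show "(\<lambda>R. 1 / (e\<^sup>2 * real (Suc R))) \<longlonglongrightarrow> 0" by (simp add: mult.commute)
    have "measure M (\<Inter>R. U R) \<le> 1 / (e\<^sup>2 * real (Suc R))" for R
      by (rule order_trans[OF finite_measure_mono Ub[of "Suc R"]]) auto
    then show "\<exists>N. \<forall>R\<ge>N. measure M (\<Inter>R. U R) \<le> 1 / (e\<^sup>2 * real (Suc R))" by blast
  qed
  then have "measure M (\<Inter>R. U R) = 0" using measure_nonneg[of M "\<Inter>R. U R"] by linarith
  then have "emeasure M (\<Inter>R. U R) = 0" by (simp add: emeasure_eq_measure)
  then have "(\<Inter>R. U R) \<in> null_sets M" by (intro null_setsI) auto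
  from AE_not_in[OF this] AE_space show ?thesis
  proof eventually_elim
    case (elim w)
    then obtain R where "w \<notin> U R" by blast
    then have "\<exists>\<^sub>\<infinity>n. w \<notin> Ev R n" unfolding U_def INFM_nat_le by auto
    then have "\<exists>\<^sub>\<infinity>n. osc_count e (gridval n w) (K * 2 ^ n) < R"
      by (rule INFM_mono) (use elim in \<open>auto simp: Ev_def\<close>)
    then show ?case by blast
  qed
qed

lemma cexp_osc_finite: "AE w in M. osc_finite (\<lambda>t. cexp t w)"
proof -
  have "AE w in M. \<forall>i K. \<exists>R. \<exists>\<^sub>\<infinity>n. osc_count (1 / real (Suc i)) (gridval n w) (K * 2 ^ n) < R"
    unfolding AE_all_countable by (intro allI osc_AE) simp
  then show ?thesis by (simp add: osc_finite_def gridval_def[abs_def])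
qed

text \<open>The value 0 on the exceptional null set makes every path cadlag, as the definition of a
  martingale demands.\<close>

definition cversion :: "real \<Rightarrow> 'a \<Rightarrow> real" where
  "cversion t w = (if osc_finite (\<lambda>t. cexp t w) then right_limit (\<lambda>t. cexp t w) t else 0)"

lemma cversion_cadlag: "cadlag M cversion"
  unfolding cadlag_def
proof (intro ballI conjI allI impI)
  fix w and t :: real
  show "continuous (at_right t) (\<lambda>s. cversion s w)" if "0 \<le> t"
    using right_limit_right_continuous[OF _ that, of "\<lambda>t. cexp t w"]
    by (cases "osc_finite (\<lambda>t. cexp t w)") (simp_all add: cversion_def)
  show "\<exists>l. ((\<lambda>s. cversion s w) \<longlongrightarrow> l) (at_left t)" if "0 < t"
    using right_limit_left_limit[OF _ that, of "\<lambda>t. cexp t w"]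
    by (cases "osc_finite (\<lambda>t. cexp t w)") (auto simp: cversion_def)
qed

lemma good_F: "{w\<in>space M. osc_finite (\<lambda>t. cexp t w)} \<in> sets (F u)"
proof -
  have "space M - {w\<in>space M. \<not> osc_finite (\<lambda>t. cexp t w)} \<in> sets (F u)"
    using sets.compl_sets[OF null_in_F[OF AE_null[OF cexp_osc_finite]], of u] by (simp add: space_F)
  also have "space M - {w\<in>space M. \<not> osc_finite (\<lambda>t. cexp t w)} = {w\<in>space M. osc_finite (\<lambda>t. cexp t w)}" by auto
  finally show ?thesis .
qed

lemma cversion_lim:
  assumes t: "0 \<le> t" shows "(\<lambda>n. if osc_finite (\<lambda>t. cexp t w) then cexp (dyadic_above n t) w else 0) \<longlonglongrightarrow> cversion t w"
  using right_limit_tendsto[OF _ t, of "\<lambda>t. cexp t w"]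
  by (cases "osc_finite (\<lambda>t. cexp t w)") (simp_all add: cversion_def)

text \<open>The right limit at \<open>t\<close> is measurable for each F_u with u > t, hence for F_t
  by right continuity of the filtration. The exceptional set belongs to every F_u because it is
  null.\<close>

lemma cversion_adapted: "adapted F cversion"
  unfolding adapted_def
proof (intro allI impI measurableI)
  fix t :: real and B :: "real set" assume t: "0 \<le> t" and B: "B \<in> sets borel"
  have m: "cversion t \<in> borel_measurable (F u)" if u: "ennreal t < u" for u
  proof -
    have "(\<lambda>n. ennreal (dyadic_above n t)) \<longlonglongrightarrow> ennreal t" by (intro tendsto_ennrealI dyadic_above_tendsto t)
    from order_tendstoD(2)[OF this u] obtain n0 where n0: "\<And>n. n0 \<le> n ==> ennreal (dyadic_above n t) < u"
      unfolding eventually_sequentially by blast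
    show ?thesis
    proof (rule borel_measurable_LIMSEQ_real)
      show "(\<lambda>n. if osc_finite (\<lambda>t. cexp t w) then cexp (dyadic_above (n + n0) t) w else 0) \<longlonglongrightarrow> cversion t w" for w
        by (rule LIMSEQ_ignore_initial_segment[OF cversion_lim[OF t]])
      fix n
      have "cexp (dyadic_above (n + n0) t) \<in> borel_measurable (F u)"
        by (rule meas_F_mono[OF cexp_F less_imp_le[OF n0]]) simp
      then show "(\<lambda>w. if osc_finite (\<lambda>t. cexp t w) then cexp (dyadic_above (n + n0) t) w else 0) \<in> borel_measurable (F u)"
        by (rule measurable_If) (use good_F[of u] in \<open>auto simp: space_F\<close>)
    qed
  qed
  have "cversion t -` B \<inter> space M \<in> sets (F u)" if "ennreal t < u" for u
    using measurable_sets[OF m[OF that] B] by (simp add: space_F)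
  from right_cont_F[OF _ this] show "cversion t -` B \<inter> space (F (ennreal t)) \<in> sets (F (ennreal t))"
    by (simp add: space_F)
qed simp

lemma cversion_bounds: "0 \<le> t ==> 0 \<le> cversion t w \<and> cversion t w \<le> 1"
  using cexp_bounds
  by (intro conjI LIMSEQ_le_const[OF cversion_lim] LIMSEQ_le_const2[OF cversion_lim]) auto

lemma cversion_integrable: "0 \<le> t ==> integrable M (cversion t)"
  by (rule bounded_integrable[where c = 1]) (use cversion_bounds adaptedM[OF cversion_adapted] in auto)

text \<open>For C in F_t the integral over C equals that of \<xi> at each dyadic time after t;
  bounded convergence carries this to the right limit.\<close>

lemma cversion_projection: "cadlag_projection M F (\<lambda>_. \<xi>) cversion"
  unfolding cadlag_projection_def
proof (intro conjI allI impI)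
  show "adapted F cversion" "cadlag M cversion" by (rule cversion_adapted, rule cversion_cadlag)
  fix t :: real assume t: "0 \<le> t"
  have "AE w in M. real_cond_exp M (F (ennreal t)) \<xi> w = cversion t w"
  proof (rule cond_exp_eqI[OF xi_integrable cversion_integrable[OF t] adaptedD[OF cversion_adapted t order_refl]])
    fix C assume C: "C \<in> sets (F (ennreal t))"
    have [measurable]: "C \<in> sets M" using C sets_F_subset by blast
    have [measurable]: "cversion t \<in> borel_measurable M" by (rule adaptedM[OF cversion_adapted t])
    have e: "E(\<lambda>w. indicator C w * cexp (dyadic_above n t) w) = E(\<lambda>w. indicator C w * \<xi> w)" for n
    proof (rule cexp_test[where c = 1])
      have "C \<in> sets (F (ennreal (dyadic_above n t)))"
        using C sets_F_mono[OF ennreal_leI[OF less_imp_le[OF dyadic_above_gt[OF t]]]] by blast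
      then show "(indicator C :: 'a \<Rightarrow> real) \<in> borel_measurable (F (ennreal (dyadic_above n t)))" by measurable
    qed (simp add: indicator_def)
    have "(\<lambda>n. E(\<lambda>w. indicator C w * cexp (dyadic_above n t) w)) \<longlonglongrightarrow> E(\<lambda>w. indicator C w * cversion t w)"
    proof (rule integral_dominated_convergence[where w = "\<lambda>_. 1"])
      show "AE w in M. (\<lambda>n. indicator C w * cexp (dyadic_above n t) w) \<longlonglongrightarrow> indicator C w * cversion t w"
        using cexp_osc_finite
      proof eventually_elim
        case (elim w)
        then show ?case using cversion_lim[OF t, of w] by (intro tendsto_mult_left) simp
      qed
    qed (use cexp_bounds in \<open>auto simp: indicator_def\<close>)
    then show "E(\<lambda>w. indicator C w * \<xi> w) = E(\<lambda>w. indicator C w * cversion t w)"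
      by (simp add: e LIMSEQ_const_iff)
  qed
  then show "AE w in M. cversion t w = real_cond_exp M (F (ennreal t)) \<xi> w" by eventually_elim simp
qed

lemma cversion_martingale: "martingale M F cversion"
  by (rule projection_martingale[OF cversion_projection xi_integrable])

end

section \<open>Predictability of decreasing processes\<close>

lemma cadlag_continuous_time:
  assumes "continuous_on UNIV f" shows "cadlag M (\<lambda>t w. f t :: real)"
proof -
  have "isCont f t" for t using assms by (simp add: continuous_on_eq_continuous_at)
  then show ?thesis
    unfolding cadlag_def by (auto simp: continuous_within isCont_def intro: tendsto_within_subset)
qed

context usual_filtration begin

lemma null_supported_measurable:
  assumes N: "N \<in> null_sets M"
  shows "(\<lambda>w. if w \<in> N then g w else (0::real)) \<in> borel_measurable (F t)"
proof (rule measurableI)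
  fix B :: "real set" assume "B \<in> sets borel"
  have n1: "{w\<in>N. g w \<in> B} \<in> sets (F t)"
    by (rule null_in_F[OF subset_null[OF _ N]]) auto
  have n2: "space M - N \<in> sets (F t)"
    using sets.compl_sets[OF null_in_F[OF N], of t] by (simp add: space_F)
  have "N \<subseteq> space M" using N sets.sets_into_space by blast
  then have "(\<lambda>w. if w \<in> N then g w else 0) -` B \<inter> space (F t) = {w\<in>N. g w \<in> B} \<union> (if 0 \<in> B then space M - N else {})"
    by (auto simp: space_F split: if_splits)
  then show "(\<lambda>w. if w \<in> N then g w else 0) -` B \<inter> space (F t) \<in> sets (F t)"
    using n1 n2 by simp
qed simp

abbreviation "PS \<equiv> process_sigma M {Y. adapted F Y \<and> left_continuous M Y}"

text \<open>The ceiling is constant just to the left of each point, so a process sampled at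
  \<open>grid_above\<close> is left-continuous whatever its paths are.\<close>

lemma grid_above_left: "\<forall>\<^sub>F s in at_left t. grid_above 1 n s = grid_above 1 n t"
proof -
  define c where "c = (of_int \<lceil>t * real (Suc n)\<rceil> - 1) / real (Suc n)"
  have "of_int \<lceil>t * real (Suc n)\<rceil> - 1 < t * real (Suc n)" by linarith
  then have "c < t" unfolding c_def by (simp add: pos_divide_less_eq del: of_nat_Suc)
  then show ?thesis
    using eventually_at_left_real[of c t]
  proof (rule_tac eventually_mono)
    fix s assume s: "s \<in> {c<..<t}"
    have "\<lceil>s * real (Suc n)\<rceil> = \<lceil>t * real (Suc n)\<rceil>"
    proof (rule ceiling_unique)
      show "of_int \<lceil>t * real (Suc n)\<rceil> - 1 < s * real (Suc n)"
        using s unfolding c_def by (simp add: pos_divide_less_eq del: of_nat_Suc)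
      have "s * real (Suc n) \<le> t * real (Suc n)" using s by (intro mult_right_mono) auto
      then show "s * real (Suc n) \<le> of_int \<lceil>t * real (Suc n)\<rceil>" by linarith
    qed
    then show "grid_above 1 n s = grid_above 1 n t" by (simp add: grid_above_def)
  qed
qed

text \<open>Every random variable supported by a null set is \<open>F\<^sub>t\<close>-measurable, so the approximation may look ahead in time.\<close>

lemma evanescent_predictable:
  assumes N: "N \<in> null_sets M" and X: "cadlag M X"
  shows "(\<lambda>(t, w). if w \<in> N then X t w else (0::real)) \<in> borel_measurable PS"
proof (rule borel_measurable_LIMSEQ_real[where u = "\<lambda>n (t, w). if w \<in> N then X (grid_above 1 n t) w else 0"])
  show "(\<lambda>(t, w). if w \<in> N then X (grid_above 1 n t) w else 0) \<in> borel_measurable PS" for n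
  proof (rule measurable_process_sigma, intro CollectI conjI)
    show "adapted F (\<lambda>t w. if w \<in> N then X (grid_above 1 n t) w else 0)"
      unfolding adapted_def by (intro allI impI null_supported_measurable N)
    have "continuous (at_left t) (\<lambda>s. if w \<in> N then X (grid_above 1 n s) w else 0)" for t w
      unfolding continuous_within
      by (rule tendsto_eventually) (use grid_above_left[of n t] in eventually_elim, simp)
    then show "left_continuous M (\<lambda>t w. if w \<in> N then X (grid_above 1 n t) w else 0)"
      unfolding left_continuous_def by blast
  qed
  fix p assume p: "p \<in> space PS"
  obtain t w where tw: "p = (t, w)" "0 \<le> t" "w \<in> space M"
    using p by (auto simp: space_process_sigma)
  have "(\<lambda>n. X (grid_above 1 n t) w) \<longlonglongrightarrow> X t w"
    using right_continuous_compose_seq[OF cadlag_rightD[OF X tw(3,2)] grid_above_ge[OF zero_less_one] grid_above_tendsto[OF zero_less_one]] .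
  then show "(\<lambda>n. case p of (t, w) \<Rightarrow> if w \<in> N then X (grid_above 1 n t) w else 0) \<longlonglongrightarrow> (case p of (t, w) \<Rightarrow> if w \<in> N then X t w else 0)"
    by (simp add: tw)
qed

end

section \<open>Recognizing a stopping time from a martingale\<close>

context bounded_variable begin

text \<open>With \<open>\<xi> = e\<^bsup>-T\<^esup>\<close> for a stopping time \<open>T\<close>, \<open>T \<le> t\<close> reads \<open>e\<^bsup>-t\<^esup> \<le> \<xi>\<close>, and \<open>gap t\<close> is the supermartingale
  \<open>E[e\<^bsup>-(t\<and>T)\<^esup> - e\<^bsup>-T\<^esup> | F\<^sub>t]\<close>.\<close>

definition floor_var :: "real \<Rightarrow> 'a \<Rightarrow> real" where
  "floor_var t w = max (exp (- t)) (\<xi> w)"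

definition gap :: "real \<Rightarrow> 'a \<Rightarrow> real" where
  "gap t w = floor_var t w - cversion t w"

context
  assumes stop: "\<And>t. 0 \<le> t ==> {w\<in>space M. exp (- t) \<le> \<xi> w} \<in> sets (F (ennreal t))"
begin

lemma floor_var_bounds: "0 \<le> t ==> 0 \<le> floor_var t w \<and> floor_var t w \<le> 1 \<and> \<xi> w \<le> floor_var t w"
  using xi_bounds[of w] by (auto simp: floor_var_def)

lemma floor_var_F:
  assumes t: "0 \<le> t" shows "floor_var t \<in> borel_measurable (F (ennreal t))"
proof (rule borel_measurable_iff_ge[THEN iffD2], intro allI)
  fix a :: real
  show "{w \<in> space (F (ennreal t)). a \<le> floor_var t w} \<in> sets (F (ennreal t))"
  proof (cases "a \<le> exp (- t)")
    case True
    then have "{w \<in> space (F (ennreal t)). a \<le> floor_var t w} = space (F (ennreal t))" by (auto simp: floor_var_def)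
    then show ?thesis by simp
  next
    case False
    show ?thesis
    proof (cases "a \<le> 1")
      case True
      have a0: "0 < a" using False exp_gt_zero[of "- t"] by linarith
      \<comment> \<open>For a level \<open>a\<close> above e^-t the event is T \<le> s with e^-s =
        a, which is decided at time s \<le> t.\<close>
      define s where "s = - ln a"
      have s: "exp (- s) = a" "0 \<le> s" using a0 True by (auto simp: s_def)
      have "s \<le> t" using False s(1) by (metis exp_le_cancel_iff linorder_linear neg_le_iff_le)
      have "{w \<in> space (F (ennreal t)). a \<le> floor_var t w} = {w\<in>space M. exp (- s) \<le> \<xi> w}"
        using False by (auto simp: floor_var_def space_F s le_max_iff_disj)
      also have "\<dots> \<in> sets (F (ennreal t))"
        using stop[OF s(2)] sets_F_mono[OF ennreal_leI[OF \<open>s \<le> t\<close>]] by blast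
      finally show ?thesis .
    next
      case False
      then have "\<not> a \<le> floor_var t w" for w using floor_var_bounds[OF t, of w] by linarith
      then have "{w \<in> space (F (ennreal t)). a \<le> floor_var t w} = {}" by blast
      then show ?thesis by (simp only: sets.empty_sets)
    qed
  qed
qed

lemma gap_F: "0 \<le> t ==> gap t \<in> borel_measurable (F (ennreal t))"
  unfolding gap_def[abs_def] by (intro borel_measurable_diff floor_var_F adaptedD[OF cversion_adapted] order_refl)

lemma gap_M: "0 \<le> t ==> gap t \<in> borel_measurable M"
  using gap_F by (rule meas_F_M)

lemma gap_abs: "0 \<le> t ==> \<bar>gap t w\<bar> \<le> 1"
  using floor_var_bounds[of t w] cversion_bounds[of t w] by (auto simp: gap_def)

lemma mult_ind_integrable:
  assumes "f \<in> borel_measurable M" "C \<in> sets M" "\<And>w. \<bar>f w\<bar> \<le> (1::real)"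
  shows "integrable M (\<lambda>w. indicator C w * f w)"
  by (rule bounded_integrable[where c = 1]) (use assms in \<open>auto simp: indicator_def\<close>)

lemma gap_test:
  assumes t: "0 \<le> t" and C: "C \<in> sets (F (ennreal t))"
  shows "E(\<lambda>w. indicator C w * gap t w) = E(\<lambda>w. indicator C w * (floor_var t w - \<xi> w))"
proof -
  have [measurable]: "C \<in> sets M" using C sets_F_subset by blast
  have [measurable]: "floor_var t \<in> borel_measurable M" "cversion t \<in> borel_measurable M"
    by (rule meas_F_M[OF floor_var_F[OF t]], rule adaptedM[OF cversion_adapted t])
  have i: "integrable M (\<lambda>w. indicator C w * floor_var t w)" "integrable M (\<lambda>w. indicator C w * \<xi> w)"
    "integrable M (\<lambda>w. indicator C w * cversion t w)"
    using floor_var_bounds[OF t] xi_bounds cversion_bounds[OF t] by (intro mult_ind_integrable; auto)+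
  have "E(\<lambda>w. indicator C w * cversion t w) = E(\<lambda>w. indicator C w * \<xi> w)"
    by (rule projection_test(2)[OF cversion_projection t xi_meas _ i(2)]) (use C in measurable)
  then show ?thesis unfolding gap_def right_diff_distrib using i by simp
qed

text \<open>\<open>floor_var\<close> decreases in time, while the mean of \<open>cversion\<close>
  over C is always that of \<xi>.\<close>

lemma gap_super:
  assumes st: "0 \<le> s" "s \<le> t" and C: "C \<in> sets (F (ennreal s))"
  shows "E(\<lambda>w. indicator C w * gap t w) \<le> E(\<lambda>w. indicator C w * gap s w)"
proof -
  have t: "0 \<le> t" using st by simp
  have Ct: "C \<in> sets (F (ennreal t))" using C sets_F_mono[OF ennreal_leI[OF st(2)]] by blast
  have CM: "C \<in> sets M" using C sets_F_subset by blast
  have m [measurable]: "floor_var u \<in> borel_measurable M" if "0 \<le> u" for u using floor_var_F[OF that] by (rule meas_F_M)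
  have i: "integrable M (\<lambda>w. indicator C w * (floor_var u w - \<xi> w))" if "0 \<le> u" for u
  proof (rule mult_ind_integrable[OF _ CM])
    show "\<bar>floor_var u w - \<xi> w\<bar> \<le> 1" for w using floor_var_bounds[OF that, of w] xi_bounds[of w] by auto
  qed (use m[OF that] in measurable)
  have fl: "floor_var t w \<le> floor_var s w" for w
    unfolding floor_var_def using st(2) by (intro max.mono) auto
  show ?thesis
    unfolding gap_test[OF t Ct] gap_test[OF st(1) C]
    by (rule integral_mono[OF i[OF t] i[OF st(1)]])
       (auto intro!: mult_left_mono fl)
qed

lemma gap_nonneg:
  assumes t: "0 \<le> t" shows "AE w in M. 0 \<le> gap t w"
proof -
  interpret Q: sigma_finite_subalgebra M "F (ennreal t)" by (rule cond_exp_F)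
  have m: "floor_var t \<in> borel_measurable M" using floor_var_F[OF t] by (rule meas_F_M)
  have i: "integrable M (floor_var t)"
    by (rule bounded_integrable[OF m, where c = 1]) (use floor_var_bounds[OF t] in auto)
  have "AE w in M. real_cond_exp M (F (ennreal t)) \<xi> w \<le> real_cond_exp M (F (ennreal t)) (floor_var t) w"
    by (rule Q.real_cond_exp_mono[OF _ xi_integrable i]) (use floor_var_bounds[OF t] in auto)
  moreover have "AE w in M. real_cond_exp M (F (ennreal t)) (floor_var t) w = floor_var t w"
    by (rule Q.real_cond_exp_F_meas[OF i floor_var_F[OF t]])
  moreover have "AE w in M. cversion t w = real_cond_exp M (F (ennreal t)) \<xi> w"
    using cversion_projection t by (simp add: cadlag_projection_def)
  ultimately show ?thesis by eventually_elim (simp add: gap_def)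
qed

lemma gap_zero_after:
  assumes t: "0 \<le> t" shows "AE w in M. exp (- t) \<le> \<xi> w \<longrightarrow> gap t w = 0"
proof -
  define C where "C = {w\<in>space M. exp (- t) \<le> \<xi> w}"
  have C: "C \<in> sets (F (ennreal t))" unfolding C_def by (rule stop[OF t])
  have CM [measurable]: "C \<in> sets M" using C sets_F_subset by blast
  have i: "integrable M (\<lambda>w. indicator C w * gap t w)"
    by (rule mult_ind_integrable[OF gap_M[OF t] CM gap_abs[OF t]])
  have "E(\<lambda>w. indicator C w * gap t w) = E(\<lambda>w. 0)"
    unfolding gap_test[OF t C]
    by (intro Bochner_Integration.integral_cong refl) (auto simp: C_def indicator_def floor_var_def)
  then have "E(\<lambda>w. indicator C w * gap t w) = 0" by simp
  moreover have "AE w in M. 0 \<le> indicator C w * gap t w"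
    using gap_nonneg[OF t] by eventually_elim (simp add: indicator_def)
  ultimately have "AE w in M. indicator C w * gap t w = 0"
    using integral_nonneg_eq_0_iff_AE[OF i] by blast
  then show ?thesis using AE_space by eventually_elim (auto simp: C_def indicator_def)
qed

text \<open>Over the event {gap t \<le> 0} the nonnegative variable
  \<open>floor_var t - \<xi>\<close> has integral at most 0, so it vanishes there, which says T
  \<le> t.\<close>

lemma gap_pos_before:
  assumes t: "0 \<le> t" shows "AE w in M. gap t w \<le> 0 \<longrightarrow> exp (- t) \<le> \<xi> w"
proof -
  define B where "B = {w\<in>space M. gap t w \<le> 0}"
  have "{w\<in>space (F (ennreal t)). gap t w \<le> 0} \<in> sets (F (ennreal t))" using gap_F[OF t] by measurable
  then have B: "B \<in> sets (F (ennreal t))" by (simp add: B_def space_F)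
  have BM [measurable]: "B \<in> sets M" using B sets_F_subset by blast
  have [measurable]: "floor_var t \<in> borel_measurable M" using floor_var_F[OF t] by (rule meas_F_M)
  have i: "integrable M (\<lambda>w. indicator B w * (floor_var t w - \<xi> w))"
  proof (rule mult_ind_integrable[OF _ BM])
    show "\<bar>floor_var t w - \<xi> w\<bar> \<le> 1" for w using floor_var_bounds[OF t, of w] xi_bounds[of w] by auto
  qed measurable
  have "E(\<lambda>w. indicator B w * gap t w) \<le> E(\<lambda>w. 0)"
    by (rule integral_mono[OF mult_ind_integrable[OF gap_M[OF t] BM gap_abs[OF t]]]) (auto simp: B_def indicator_def)
  then have "E(\<lambda>w. indicator B w * (floor_var t w - \<xi> w)) \<le> 0" by (simp add: gap_test[OF t B])
  moreover have nn: "0 \<le> indicator B w * (floor_var t w - \<xi> w)" for w using floor_var_bounds[OF t, of w] by simp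
  have "0 \<le> E(\<lambda>w. indicator B w * (floor_var t w - \<xi> w))" by (intro integral_nonneg_AE AE_I2 nn)
  ultimately have "E(\<lambda>w. indicator B w * (floor_var t w - \<xi> w)) = 0" by linarith
  then have "AE w in M. indicator B w * (floor_var t w - \<xi> w) = 0"
    using integral_nonneg_eq_0_iff_AE[OF i] nn by simp
  then show ?thesis using AE_space by eventually_elim (auto simp: B_def indicator_def floor_var_def max_def split: if_splits)
qed

text \<open>A nonnegative supermartingale that has come close to zero stays close to zero.\<close>

lemma gap_grid_bound:
  assumes d: "0 \<le> d"
  shows "E(\<lambda>w. indicator {w\<in>space M. \<exists>i\<le>j. gap (real i / 2 ^ n) w < d} w * gap (real j / 2 ^ n) w)
     \<le> d * measure M {w\<in>space M. \<exists>i\<le>j. gap (real i / 2 ^ n) w < d}"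
proof (induction j)
  have ind: "E(\<lambda>w. indicator D w * gap t w) \<le> d * measure M D"
    if t: "0 \<le> t" and D: "D \<in> sets M" "\<And>w. w \<in> D ==> gap t w < d" for t D
  proof -
    have iD: "integrable M (\<lambda>w. indicator D w * d)"
      by (rule bounded_integrable[where c = "\<bar>d\<bar>"]) (use D(1) in \<open>auto simp: indicator_def\<close>)
    have "E(\<lambda>w. indicator D w * gap t w) \<le> E(\<lambda>w. indicator D w * d)"
      by (rule integral_mono[OF mult_ind_integrable[OF gap_M[OF t] D(1) gap_abs[OF t]] iD])
         (use D(2) in \<open>auto simp: indicator_def less_imp_le\<close>)
    also have "\<dots> = d * measure M D" using D(1) sets.sets_into_space[OF D(1)] by (simp add: Int_absorb2)
    finally show ?thesis .
  qed
  {
    case 0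
    have "{w\<in>space M. gap 0 w < d} \<in> sets M" using gap_M[of 0] by measurable
    from ind[OF _ this, of 0] show ?case by simp
  next
    case (Suc j)
    let ?s = "\<lambda>j. real j / 2 ^ n"
    have s0: "0 \<le> ?s i" for i by simp
    have sm: "?s i \<le> ?s k" if "i \<le> k" for i k using that by (intro divide_right_mono) auto
    \<comment> \<open>\<open>B\<close> collects the paths that were below the level by step j,
      \<open>D\<close> those that first get there at step j+1. On \<open>B\<close> the
      supermartingale inequality applies, on \<open>D\<close> the value itself is below
      \<open>d\<close>.\<close>
    define B where "B = {w\<in>space M. \<exists>i\<le>j. gap (?s i) w < d}"
    define D where "D = {w\<in>space M. gap (?s (Suc j)) w < d} - B"
    have "{w\<in>space (F (ennreal (?s j))). gap (?s i) w < d} \<in> sets (F (ennreal (?s j)))" if "i \<le> j" for i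
      using meas_F_mono[OF gap_F[OF s0] ennreal_leI[OF sm[OF that]]] by measurable
    then have "(\<Union>i\<in>{..j}. {w\<in>space M. gap (?s i) w < d}) \<in> sets (F (ennreal (?s j)))"
      by (intro sets.finite_UN) (auto simp: space_F)
    moreover have "(\<Union>i\<in>{..j}. {w\<in>space M. gap (?s i) w < d}) = B" unfolding B_def by auto
    ultimately have B: "B \<in> sets (F (ennreal (?s j)))" by simp
    then have BM: "B \<in> sets M" using sets_F_subset by blast
    have "{w\<in>space M. gap (?s (Suc j)) w < d} \<in> sets M" using gap_M[OF s0, of "Suc j"] by measurable
    then have DM: "D \<in> sets M" unfolding D_def using BM by simp
    have e: "{w\<in>space M. \<exists>i\<le>Suc j. gap (?s i) w < d} = B \<union> D" unfolding B_def D_def by (auto simp: le_Suc_eq)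
    have disj: "B \<inter> D = {}" unfolding D_def by auto
    have i: "integrable M (\<lambda>w. indicator C w * gap (?s (Suc j)) w)" if "C \<in> sets M" for C
      by (rule mult_ind_integrable[OF gap_M[OF s0] that gap_abs[OF s0]])
    have "E(\<lambda>w. indicator (B \<union> D) w * gap (?s (Suc j)) w)
      = E(\<lambda>w. indicator B w * gap (?s (Suc j)) w + indicator D w * gap (?s (Suc j)) w)"
      using disj by (intro Bochner_Integration.integral_cong refl) (auto simp: indicator_def)
    also have "\<dots> = E(\<lambda>w. indicator B w * gap (?s (Suc j)) w) + E(\<lambda>w. indicator D w * gap (?s (Suc j)) w)"
      by (rule Bochner_Integration.integral_add[OF i[OF BM] i[OF DM]])
    also have "\<dots> \<le> E(\<lambda>w. indicator B w * gap (?s j) w) + d * measure M D"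
      by (intro add_mono gap_super[OF s0 sm B] ind[OF s0 DM]) (auto simp: D_def)
    also have "\<dots> \<le> d * measure M B + d * measure M D" using Suc unfolding B_def by simp
    also have "\<dots> = d * measure M (B \<union> D)" using finite_measure_Union[OF BM DM disj] by (simp add: distrib_left)
    finally show ?case unfolding e .
  }
qed

text \<open>The grid bound with d = 1/(i+1) is used on grids of mesh 2^-(a+m), which all contain
  \<open>q\<close>. Refining the grid and then letting i grow shows that the nonnegative
  \<open>gap q\<close> has integral 0 on the event in question.\<close>

lemma gap_absorption:
  assumes q: "q \<in> dyadics"
  shows "AE w in M. (\<forall>i. \<exists>u\<in>dyadics. u \<le> q \<and> gap u w < 1 / real (Suc i)) \<longrightarrow> gap q w \<le> 0"
proof -
  obtain k a where ka: "q = real k / 2 ^ a" using q unfolding dyadics_def by blast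
  have q0: "0 \<le> q" by (rule dyadics_nonneg[OF q])
  define B where "B i = {w\<in>space M. \<exists>u\<in>dyadics. u \<le> q \<and> gap u w < 1 / real (Suc i)}" for i :: nat
  define H where "H i m = {w\<in>space M. \<exists>j\<le>k * 2 ^ m. gap (real j / 2 ^ (a + m)) w < 1 / real (Suc i)}" for i m :: nat
  have qm: "real (k * 2 ^ m) / 2 ^ (a + m) = q" for m by (simp add: ka power_add)
  have HM: "H i m \<in> sets M" for i m
  proof -
    have "{w\<in>space M. gap (real j / 2 ^ (a + m)) w < 1 / real (Suc i)} \<in> sets M" for j
      using gap_M[of "real j / 2 ^ (a + m)"] by measurable
    then have "(\<Union>j\<in>{..k * 2 ^ m}. {w\<in>space M. gap (real j / 2 ^ (a + m)) w < 1 / real (Suc i)}) \<in> sets M"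
      by (intro sets.finite_UN) auto
    moreover have "(\<Union>j\<in>{..k * 2 ^ m}. {w\<in>space M. gap (real j / 2 ^ (a + m)) w < 1 / real (Suc i)}) = H i m"
      unfolding H_def by auto
    ultimately show ?thesis by simp
  qed
  have mem: "w \<in> H i m" if "w \<in> space M" "u = real j / 2 ^ (a + m)" "u \<le> q" "gap u w < 1 / real (Suc i)" for w i m u j
  proof -
    have "real j / 2 ^ (a + m) \<le> real (k * 2 ^ m) / 2 ^ (a + m)" using that(2,3) qm by simp
    then have "j \<le> k * 2 ^ m" by (simp add: divide_le_cancel del: of_nat_mult of_nat_power)
    then show ?thesis using that unfolding H_def by blast
  qed
  have ev: "\<forall>\<^sub>F m in sequentially. indicator (H i m) w = (indicator (B i) w :: real)" if w: "w \<in> space M" for i w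
  proof (cases "w \<in> B i")
    case True
    then obtain u where u: "u \<in> dyadics" "u \<le> q" "gap u w < 1 / real (Suc i)" unfolding B_def by blast
    obtain j b where jb: "u = real j / 2 ^ b" using u(1) unfolding dyadics_def by blast
    show ?thesis
      using eventually_ge_at_top[of b]
    proof eventually_elim
      case (elim m)
      obtain c where c: "a + m = b + c" using elim by (metis le_Suc_ex trans_le_add2)
      have "u = real (j * 2 ^ c) / 2 ^ (a + m)" unfolding c by (simp add: jb power_add)
      from mem[OF w this u(2,3)] show ?case using True by simp
    qed
  next
    case False
    have "w \<notin> H i m" for m
    proof
      assume "w \<in> H i m"
      then obtain j where j: "j \<le> k * 2 ^ m" "gap (real j / 2 ^ (a + m)) w < 1 / real (Suc i)" unfolding H_def by blast
      have "real j / 2 ^ (a + m) \<le> real (k * 2 ^ m) / 2 ^ (a + m)" using j(1) by (intro divide_right_mono of_nat_mono) auto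
      then have "real j / 2 ^ (a + m) \<le> q" unfolding qm .
      then show False using False j(2) w dyadics_I[of j "a + m"] unfolding B_def by blast
    qed
    then show ?thesis using False by simp
  qed
  have BM: "B i \<in> sets M" for i
  proof -
    have "{w\<in>space M. gap u w < 1 / real (Suc i)} \<in> sets M" if "u \<in> dyadics" for u
      using gap_M[OF dyadics_nonneg[OF that]] by measurable
    then have "(\<Union>u\<in>dyadics \<inter> {..q}. {w\<in>space M. gap u w < 1 / real (Suc i)}) \<in> sets M"
      using countable_dyadics by (intro sets.countable_UN' countable_Int1) auto
    moreover have "(\<Union>u\<in>dyadics \<inter> {..q}. {w\<in>space M. gap u w < 1 / real (Suc i)}) = B i" unfolding B_def by auto
    ultimately show ?thesis by simp
  qed
  have Ble: "E(\<lambda>w. indicator (B i) w * gap q w) \<le> 1 / real (Suc i)" for i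
  proof (rule LIMSEQ_le_const2)
    show "(\<lambda>m. E(\<lambda>w. indicator (H i m) w * gap q w)) \<longlonglongrightarrow> E(\<lambda>w. indicator (B i) w * gap q w)"
    proof (rule integral_dominated_convergence[where w = "\<lambda>_. 1"])
      show "AE w in M. (\<lambda>m. indicator (H i m) w * gap q w) \<longlonglongrightarrow> indicator (B i) w * gap q w"
        using AE_space
      proof eventually_elim
        case (elim w)
        have "\<forall>\<^sub>F m in sequentially. indicator (H i m) w * gap q w = indicator (B i) w * gap q w"
          using ev[OF elim, of i] by eventually_elim simp
        then show ?case by (rule tendsto_eventually)
      qed
    qed (use HM BM gap_M[OF q0] gap_abs[OF q0] in \<open>auto simp: indicator_def\<close>)
    have "E(\<lambda>w. indicator (H i m) w * gap q w) \<le> 1 / real (Suc i)" for m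
    proof -
      have "E(\<lambda>w. indicator (H i m) w * gap q w) \<le> 1 / real (Suc i) * measure M (H i m)"
        using gap_grid_bound[of "1 / real (Suc i)" "k * 2 ^ m" "a + m"] unfolding qm H_def by simp
      also have "\<dots> \<le> 1 / real (Suc i) * 1" by (intro mult_left_mono) auto
      finally show ?thesis by simp
    qed
    then show "\<exists>N. \<forall>m\<ge>N. E(\<lambda>w. indicator (H i m) w * gap q w) \<le> 1 / real (Suc i)" by blast
  qed
  define D where "D = (\<Inter>i. B i)"
  note BM [measurable]
  have DM: "D \<in> sets M" unfolding D_def by measurable
  have iD: "integrable M (\<lambda>w. indicator D w * gap q w)"
    by (rule mult_ind_integrable[OF gap_M[OF q0] DM gap_abs[OF q0]])
  have "E(\<lambda>w. indicator D w * gap q w) \<le> 0"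
  proof (rule LIMSEQ_le_const)
    show "(\<lambda>i. 1 / real (Suc i)) \<longlonglongrightarrow> 0" by (rule LIMSEQ_Suc[OF lim_const_over_n])
    have "E(\<lambda>w. indicator D w * gap q w) \<le> E(\<lambda>w. indicator (B i) w * gap q w)" for i
    proof (rule integral_mono_AE[OF iD mult_ind_integrable[OF gap_M[OF q0] BM gap_abs[OF q0]]])
      show "AE w in M. indicator D w * gap q w \<le> indicator (B i) w * gap q w"
        using gap_nonneg[OF q0] by eventually_elim (auto simp: D_def indicator_def)
    qed
    from order_trans[OF this Ble] show "\<exists>N. \<forall>i\<ge>N. E(\<lambda>w. indicator D w * gap q w) \<le> 1 / real (Suc i)" by blast
  qed
  moreover have nn: "AE w in M. 0 \<le> indicator D w * gap q w"
    using gap_nonneg[OF q0] by eventually_elim (simp add: indicator_def)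
  then have "0 \<le> E(\<lambda>w. indicator D w * gap q w)" by (rule integral_nonneg_AE)
  ultimately have "E(\<lambda>w. indicator D w * gap q w) = 0" by linarith
  then have "AE w in M. indicator D w * gap q w = 0" using integral_nonneg_eq_0_iff_AE[OF iD nn] by blast
  then show ?thesis using AE_space by eventually_elim (auto simp: D_def B_def indicator_def)
qed

lemma gap_cadlag: "cadlag M gap"
  unfolding gap_def[abs_def]
proof (rule cadlag_diff[OF _ cversion_cadlag])
  have "continuous_on UNIV (\<lambda>t::real. exp (- t))" by (intro continuous_intros)
  from cadlag_combine[where h = max, OF cadlag_continuous_time[OF this] cadlag_const[of M \<xi>]]
  show "cadlag M floor_var" unfolding floor_var_def[abs_def]
    by (simp add: continuous_on_max continuous_on_fst continuous_on_snd)
qed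

text \<open>From T on the gap is 0, by right continuity. If t < T, some dyadic q > t still precedes
  T, so \<open>gap q\<close> is positive; by absorption the gap is bounded away from 0 at all dyadic
  times up to q, and right continuity makes \<open>gap t\<close> positive, that is,
  \<open>cversion t\<close> smaller than e^-t.\<close>

lemma level_by_martingale:
  "AE w in M. \<forall>t\<ge>0. exp (- t) \<le> \<xi> w \<longleftrightarrow> exp (- t) \<le> cversion t w"
proof -
  have 1: "AE w in M. \<forall>q\<in>dyadics. exp (- q) \<le> \<xi> w \<longrightarrow> gap q w = 0"
    by (subst AE_ball_countable[OF countable_dyadics]) (intro ballI gap_zero_after dyadics_nonneg)
  have 2: "AE w in M. \<forall>q\<in>dyadics. gap q w \<le> 0 \<longrightarrow> exp (- q) \<le> \<xi> w"
    by (subst AE_ball_countable[OF countable_dyadics]) (intro ballI gap_pos_before dyadics_nonneg)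
  have 3: "AE w in M. \<forall>q\<in>dyadics. (\<forall>i. \<exists>u\<in>dyadics. u \<le> q \<and> gap u w < 1 / real (Suc i)) \<longrightarrow> gap q w \<le> 0"
    by (subst AE_ball_countable[OF countable_dyadics]) (intro ballI gap_absorption)
  show ?thesis
    using 1 2 3 AE_space
  proof eventually_elim
    case (elim w)
    show ?case
    proof (intro allI impI iffI)
      fix t :: real assume t: "0 \<le> t"
      have S: "(\<lambda>n. gap (dyadic_above n t) w) \<longlonglongrightarrow> gap t w"
        by (rule right_continuous_dyadic_seq[OF t cadlag_rightD[OF gap_cadlag elim(4) t]])
      { assume le: "exp (- t) \<le> \<xi> w"
        have "gap (dyadic_above n t) w = 0" for n
        proof -
          have "exp (- dyadic_above n t) \<le> exp (- t)" using dyadic_above_gt[OF t, of n] by simp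
          then have "exp (- dyadic_above n t) \<le> \<xi> w" using le by (rule order_trans)
          then show ?thesis using elim(1) dyadic_above_in by blast
        qed
        then have "gap t w = 0" using S by (simp add: LIMSEQ_const_iff)
        then show "exp (- t) \<le> cversion t w" using le by (simp add: gap_def floor_var_def) }
      assume le: "exp (- t) \<le> cversion t w"
      show "exp (- t) \<le> \<xi> w"
      proof (rule ccontr)
        assume "\<not> exp (- t) \<le> \<xi> w"
        then have lt: "\<xi> w < exp (- t)" by simp
        have "(\<lambda>n. exp (- dyadic_above n t)) \<longlonglongrightarrow> exp (- t)"
          by (intro tendsto_intros dyadic_above_tendsto t)
        from order_tendstoD(1)[OF this lt] obtain n where n: "\<xi> w < exp (- dyadic_above n t)"
          by (auto simp: eventually_sequentially)
        let ?q = "dyadic_above n t"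
        have "\<not> gap ?q w \<le> 0" using elim(2) n dyadic_above_in[of n t] by force
        then obtain i where i: "\<And>u. u \<in> dyadics ==> u \<le> ?q ==> 1 / real (Suc i) \<le> gap u w"
          using elim(3) dyadic_above_in[of n t] by (meson not_le)
        have "1 / real (Suc i) \<le> gap t w"
        proof (rule LIMSEQ_le_const[OF S])
          have "\<forall>\<^sub>F m in sequentially. 1 / real (Suc i) \<le> gap (dyadic_above m t) w"
            using dyadic_above_eventually[OF t dyadic_above_gt[OF t, of n]]
            by eventually_elim (rule i[OF dyadic_above_in], simp)
          then show "\<exists>N. \<forall>m\<ge>N. 1 / real (Suc i) \<le> gap (dyadic_above m t) w" unfolding eventually_sequentially .
        qed
        then have "0 < gap t w" by (rule less_le_trans[rotated]) simp
        then show False using le lt by (simp add: gap_def floor_var_def)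
      qed
    qed
  qed
qed

end

end

section \<open>Level sets of decreasing processes\<close>

context usual_filtration begin

text \<open>\<xi> is e^-T for T = inf {t. X t \<le> c}, with e^-\<infinity> = 0; this coding makes
  it bounded. Monotone and right-continuous paths make {t. X t \<le> c} the closed half line
  [T,\<infinity>), which gives the equivalence at t = T too.\<close>

lemma decreasing_level_variable:
  assumes ad: "adapted F X" and cX: "cadlag M X" and dec: "decreasing_process M X"
  obtains N \<xi> where "N \<in> null_sets M" "bounded_variable M F \<xi>"
    "\<And>w t. w \<in> space M ==> w \<notin> N ==> 0 \<le> t ==> exp (- t) \<le> \<xi> w \<longleftrightarrow> X t w \<le> c"
    "\<And>t. 0 \<le> t ==> {w\<in>space M. exp (- t) \<le> \<xi> w} \<in> sets (F (ennreal t))"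
proof -
  define N0 where "N0 = {w\<in>space M. \<not> antimono_on {0..} (\<lambda>t. X t w)}"
  have N0: "N0 \<in> null_sets M" unfolding N0_def by (rule AE_null[OF dec[unfolded decreasing_process_def]])
  \<comment> \<open>Inserting 0 gives the supremum the value 0 when the level is never
    reached.\<close>
  define \<xi> where "\<xi> w = (if w \<in> space M - N0 then Sup (insert 0 {exp (- t) |t. 0 \<le> t \<and> X t w \<le> c}) else 0)" for w
  have bdd: "bdd_above (insert 0 {exp (- t) |t. 0 \<le> t \<and> X t w \<le> c})" for w
    by (intro bdd_aboveI[of _ 1]) auto
  have xi_b: "0 \<le> \<xi> w \<and> \<xi> w \<le> 1" for w
    unfolding \<xi>_def by (auto intro!: cSup_upper bdd cSup_least)
  have iff: "exp (- t) \<le> \<xi> w \<longleftrightarrow> X t w \<le> c" if w: "w \<in> space M" "w \<notin> N0" and t: "0 \<le> t" for t w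
  proof
    assume "X t w \<le> c"
    then show "exp (- t) \<le> \<xi> w" unfolding \<xi>_def using w t by (auto intro!: cSup_upper bdd)
  next
    assume le: "exp (- t) \<le> \<xi> w"
    show "X t w \<le> c"
    proof (rule ccontr)
      assume "\<not> X t w \<le> c"
      then have "c < X t w" by simp
      moreover have "((\<lambda>s. X s w) \<longlongrightarrow> X t w) (at_right t)"
        using cadlag_rightD[OF cX w(1) t] by (simp add: continuous_within)
      ultimately have "\<forall>\<^sub>F s in at_right t. c < X s w" by (rule order_tendstoD(1)[rotated])
      then obtain u where u: "t < u" "\<And>s. t < s ==> s < u ==> c < X s w"
        unfolding eventually_at_right[OF less_add_one] by blast
      define v where "v = (t + u) / 2"
      have v: "t < v" "c < X v w" using u by (auto simp: v_def)
      have mono: "antimono_on {0..} (\<lambda>t. X t w)" using w by (simp add: N0_def)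
      have "v \<le> s" if "0 \<le> s" "X s w \<le> c" for s
      proof (rule ccontr)
        assume "\<not> v \<le> s"
        then have "X v w \<le> X s w" using monotone_onD[OF mono, of s v] that by simp
        then show False using v that by simp
      qed
      then have "\<xi> w \<le> exp (- v)" unfolding \<xi>_def using w by (auto intro!: cSup_least)
      also have "\<dots> < exp (- t)" using v by simp
      finally show False using le by simp
    qed
  qed
  have stop: "{w\<in>space M. exp (- t) \<le> \<xi> w} \<in> sets (F (ennreal t))" if t: "0 \<le> t" for t
  proof -
    have "{w\<in>space M. exp (- t) \<le> \<xi> w} = {w\<in>space (F (ennreal t)). X t w \<le> c} - N0"
    proof (intro equalityI subsetI)
      fix w assume a: "w \<in> {w\<in>space M. exp (- t) \<le> \<xi> w}"
      have "w \<notin> N0"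
      proof
        assume "w \<in> N0"
        then have "\<xi> w = 0" by (simp add: \<xi>_def)
        then show False using a exp_gt_zero[of "- t"] by simp
      qed
      then show "w \<in> {w\<in>space (F (ennreal t)). X t w \<le> c} - N0" using a iff[of w, OF _ _ t] by (auto simp: space_F)
    qed (use iff[OF _ _ t] in \<open>auto simp: space_F\<close>)
    moreover have "{w\<in>space (F (ennreal t)). X t w \<le> c} \<in> sets (F (ennreal t))"
      using adaptedD[OF ad t order_refl] by measurable
    ultimately show ?thesis using null_in_F[OF N0] by simp
  qed
  have "\<xi> \<in> borel_measurable M"
    unfolding borel_measurable_iff_ge
  proof
    fix a :: real
    consider "a \<le> 0" | "1 < a" | "0 < a" "a \<le> 1" by linarith
    then show "{w\<in>space M. a \<le> \<xi> w} \<in> sets M"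
    proof cases
      case 1
      then have "{w\<in>space M. a \<le> \<xi> w} = space M" using xi_b by (auto intro: order_trans)
      then show ?thesis by simp
    next
      case 2
      then have "\<not> a \<le> \<xi> w" for w using xi_b[of w] by linarith
      then show ?thesis by simp
    next
      case 3
      then have "exp (- (- ln a)) = a" "0 \<le> - ln a" by auto
      then show ?thesis using stop[of "- ln a"] sets_F_subset by auto
    qed
  qed
  then have "bounded_variable M F \<xi>" by unfold_locales (use xi_b in auto)
  then show thesis using that[OF N0] iff stop by blast
qed

text \<open>Off a null set, X t \<le> c reads 0 \<le> L_t - e^-t with a continuous adapted
  \<open>L\<close>, a condition on a left-continuous process. On the null set the level set of
  \<open>X\<close> is predictable by \<open>evanescent_predictable\<close>.\<close>

lemma decreasing_level_predictable:
  assumes cont: "all_martingales_continuous M F"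
    and ad: "adapted F X" and cX: "cadlag M X" and dec: "decreasing_process M X"
  shows "{p \<in> space PS. (case p of (t, w) \<Rightarrow> X t w) \<le> c} \<in> sets PS"
proof -
  obtain N0 \<xi> where N0: "N0 \<in> null_sets M" and bv: "bounded_variable M F \<xi>"
    and iff: "\<And>w t. w \<in> space M ==> w \<notin> N0 ==> 0 \<le> t ==> exp (- t) \<le> \<xi> w \<longleftrightarrow> X t w \<le> c"
    and stop: "\<And>t. 0 \<le> t ==> {w\<in>space M. exp (- t) \<le> \<xi> w} \<in> sets (F (ennreal t))"
    using decreasing_level_variable[OF ad cX dec, of c] by blast
  interpret L: bounded_variable M F \<xi> by (rule bv)
  have "AE w in M. continuous_on {0..} (\<lambda>t. L.cversion t w)"
    using cont L.cversion_martingale unfolding all_martingales_continuous_def by blast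
  moreover have "AE w in M. \<forall>t\<ge>0. exp (- t) \<le> \<xi> w \<longleftrightarrow> exp (- t) \<le> L.cversion t w"
    by (rule L.level_by_martingale) (rule stop)
  ultimately have "AE w in M. continuous_on {0..} (\<lambda>t. L.cversion t w) \<and> (\<forall>t\<ge>0. exp (- t) \<le> \<xi> w \<longleftrightarrow> exp (- t) \<le> L.cversion t w)"
    by eventually_elim simp
  from AE_null[OF this] obtain N1 where N1: "N1 \<in> null_sets M"
    "\<And>w. w \<in> space M ==> w \<notin> N1 ==> continuous_on {0..} (\<lambda>t. L.cversion t w) \<and> (\<forall>t\<ge>0. exp (- t) \<le> \<xi> w \<longleftrightarrow> exp (- t) \<le> L.cversion t w)"
    by blast
  define N where "N = N0 \<union> N1"
  have N: "N \<in> null_sets M" unfolding N_def using N0 N1(1) by auto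
  have NF: "N \<in> sets (F t)" "space M - N \<in> sets (F t)" for t
    using null_in_F[OF N] sets.compl_sets[OF null_in_F[OF N], of t] by (auto simp: space_F)
  \<comment> \<open>Setting the process to 0 on \<open>N\<close> makes all its paths
    left-continuous; it stays adapted since \<open>N\<close> lies in every F_t.\<close>
  let ?Y = "\<lambda>t w. if w \<in> N then 0 else L.cversion t w - exp (- t)"
  have Y: "(\<lambda>(t, w). ?Y t w) \<in> borel_measurable PS"
  proof (rule measurable_process_sigma, intro CollectI conjI)
    show "adapted F ?Y"
      unfolding adapted_def
    proof (intro allI impI)
      fix t :: real assume t: "0 \<le> t"
      have "(\<lambda>w. L.cversion t w - exp (- t)) \<in> borel_measurable (F (ennreal t))"
        by (intro borel_measurable_diff adaptedD[OF L.cversion_adapted t order_refl] borel_measurable_const)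
      then show "?Y t \<in> borel_measurable (F (ennreal t))"
        by (rule measurable_If[OF borel_measurable_const]) (use NF[of "ennreal t"] sets.sets_into_space[OF NF(1)[of "ennreal t"]] in \<open>simp add: space_F Collect_conj_eq Int_absorb1\<close>)
    qed
    show "left_continuous M ?Y"
      unfolding left_continuous_def
    proof (intro ballI allI impI)
      fix w and t :: real assume w: "w \<in> space M" and t: "0 < t"
      show "continuous (at_left t) (\<lambda>s. ?Y s w)"
      proof (cases "w \<in> N")
        case False
        then have "continuous_on {0..} (\<lambda>t. L.cversion t w)" using N1(2)[OF w] by (simp add: N_def)
        then have "isCont (\<lambda>t. L.cversion t w) t"
          by (rule continuous_on_interior) (use t in simp)
        then have "continuous (at_left t) (\<lambda>t. L.cversion t w)" by (rule continuous_at_imp_continuous_at_within)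
        then show ?thesis using False by (simp, intro continuous_intros)
      qed simp
    qed
  qed
  have I: "(\<lambda>(t::real, w). indicator N w :: real) \<in> borel_measurable PS"
  proof (rule measurable_process_sigma[where X = "\<lambda>t w. indicator N w"], intro CollectI conjI)
    show "adapted F (\<lambda>t. indicator N)" unfolding adapted_def using NF by auto
    show "left_continuous M (\<lambda>t. indicator N)" unfolding left_continuous_def by (intro ballI allI impI continuous_const)
  qed
  note E = evanescent_predictable[OF N cX]
  let ?I = "\<lambda>(t::real, w). indicator N w :: real"
  have "{p \<in> space PS. (case p of (t, w) \<Rightarrow> X t w) \<le> c} =
      ({p \<in> space PS. ?I p = 1} \<inter> {p \<in> space PS. (case p of (t, w) \<Rightarrow> if w \<in> N then X t w else 0) \<le> c})
      \<union> ({p \<in> space PS. ?I p = 0} \<inter> {p \<in> space PS. 0 \<le> (case p of (t, w) \<Rightarrow> ?Y t w)})" (is "?L = ?R")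
  proof (rule set_eqI)
    fix p :: "real \<times> 'a"
    obtain t w where p: "p = (t, w)" by (cases p)
    show "p \<in> ?L \<longleftrightarrow> p \<in> ?R"
    proof (cases "p \<in> space PS \<and> w \<notin> N")
      case True
      then have w: "w \<in> space M" "w \<notin> N0" "w \<notin> N1" "0 \<le> t" using p by (auto simp: space_process_sigma N_def)
      have "X t w \<le> c \<longleftrightarrow> exp (- t) \<le> L.cversion t w" using iff[OF w(1,2,4)] N1(2)[OF w(1,3)] w(4) by blast
      then show ?thesis using True p by auto
    qed (use p in auto)
  qed
  also have "\<dots> \<in> sets PS"
    by (intro sets.Un sets.Int borel_measurable_eq[OF I borel_measurable_const]
        borel_measurable_le[OF E borel_measurable_const] borel_measurable_le[OF borel_measurable_const Y])
  finally show ?thesis .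
qed

lemma decreasing_predictable:
  assumes "all_martingales_continuous M F" "adapted F X" "cadlag M X" "decreasing_process M X"
  shows "predictable_process M F X"
  unfolding predictable_process_def borel_measurable_iff_le
  using decreasing_level_predictable[OF assms] by blast

end

lemma (in azema) terminal_imp_decreasing:
  assumes T1: "AE w in M. terminal_value A w = 1"
  shows "decreasing_process M Z"
  unfolding decreasing_process_def
  using terminal_imp_mu_one[OF T1] mu_eq AE_space
proof eventually_elim
  case (elim w)
  show ?case
  proof (rule monotone_onI)
    fix s t :: real assume "s \<in> {0..}" "t \<in> {0..}" "s \<le> t"
    then have st: "0 \<le> s" "0 \<le> t" "s \<le> t" by auto
    have "A s w + Z s w = 1" "A t w + Z t w = 1" using elim(1,2) st by metis+
    then show "Z t w \<le> Z s w" using A_le[OF elim(3) st(1,3)] by linarith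
  qed
qed

theorem theorem1:
  fixes M :: "'a measure" and F G :: "ennreal \<Rightarrow> 'a measure" and \<rho> :: "'a \<Rightarrow> ennreal"
    and Z A \<mu> :: "real \<Rightarrow> 'a \<Rightarrow> real"
  assumes "prob_space M"
    and "usual_conditions M F"
    and "\<rho> \<in> borel_measurable M"
    and "measure M {\<omega> \<in> space M. \<rho> \<omega> = \<infinity>} = 0"
    and "progressive_enlargement M F \<rho> G"
    and "azema_supermartingale M F \<rho> Z"
    and "dual_optional_projection M F \<rho> A"
    and "mu_martingale M F A \<mu>"
  shows "(pseudo_stopping_time M F \<rho> \<longleftrightarrow> (AE \<omega> in M. \<forall>t\<ge>0. \<mu> t \<omega> = 1)) \<and>
    (pseudo_stopping_time M F \<rho> \<longleftrightarrow> (AE \<omega> in M. terminal_value A \<omega> = 1)) \<and>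
    (pseudo_stopping_time M F \<rho> \<longleftrightarrow>
      (\<forall>X. local_martingale M F X \<longrightarrow> local_martingale M G (stopped X \<rho>))) \<and>
    (all_martingales_continuous M F \<longrightarrow>
      (pseudo_stopping_time M F \<rho> \<longleftrightarrow> decreasing_process M Z \<and> predictable_process M F Z))"
proof -
  interpret prob_space M by fact
  have "{w \<in> space M. \<rho> w = \<infinity>} \<in> null_sets M"
    using assms(3,4) by (intro null_setsI) (auto simp: emeasure_eq_measure)
  from AE_not_in[OF this] AE_space have "AE w in M. \<rho> w < \<infinity>"
    by eventually_elim (use not_less_infinity in blast)
  then interpret enlarged M F \<rho> A Z \<mu> G
    using assms by unfold_locales
  let ?pst = "pseudo_stopping_time M F \<rho>"
  let ?one = "AE w in M. terminal_value A w = 1"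
  let ?loc = "\<forall>X. local_martingale M F X \<longrightarrow> local_martingale M G (stopped X \<rho>)"
  have loc: "?one ==> ?loc" using stopped_local_martingale by blast
  have pst: "?loc ==> ?pst" using local_imp_pseudo by blast
  \<comment> \<open>This closes the cycle from (3) to (4) to (1) and back to (3).\<close>
  have pst_iff: "?pst \<longleftrightarrow> ?one" using pseudo_imp_terminal loc pst by blast
  have "?one \<longleftrightarrow> (AE w in M. \<forall>t\<ge>0. \<mu> t w = 1)"
    using mu_one_imp_terminal terminal_imp_mu_one by blast
  moreover have "?pst \<longleftrightarrow> decreasing_process M Z \<and> predictable_process M F Z" if c: "all_martingales_continuous M F"
  proof
    assume ?pst
    then have "decreasing_process M Z" unfolding pst_iff by (rule terminal_imp_decreasing)
    then show "decreasing_process M Z \<and> predictable_process M F Z"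
      using decreasing_predictable[OF c Z_adapted Z_cadlag] by simp
  next
    assume d: "decreasing_process M Z \<and> predictable_process M F Z"
    have "AE w in M. continuous_on {0..} (\<lambda>t. \<mu> t w)"
      using c mu_martingale unfolding all_martingales_continuous_def by blast
    from decreasing_imp_mu_one[OF this conjunct1[OF d]] show ?pst
      unfolding pst_iff by (rule mu_one_imp_terminal)
  qed
  ultimately show ?thesis using pst_iff loc pst by blast
qed

end
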